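(* Let $\theta>0$, $N\in\mathbb{N}$, $\lambda\in\mathbb{GT}_N$ and $x\in\mathbb{C}$ with $|x|>1$. Let $M>\lambda_1$ and $r>0$ be arbitrary real numbers, and let $\mathcal{C}^-$ be the positively oriented contour consisting of the segment $[M+r\mathbf{i},\,M-r\mathbf{i}]$ and the horizontal lines $[M+r\mathbf{i},-\infty+r\mathbf{i})$ and $[M-r\mathbf{i},-\infty-r\mathbf{i})$ (that is, it runs from $-\infty-r\mathbf{i}$ to $M-r\mathbf{i}$, then to $M+r\mathbf{i}$, then to $-\infty+r\mathbf{i}$). Then the integral below converges absolutely and $$J_\lambda(x;N,\theta)=\frac{\Gamma(\theta N)}{(1-x^{-1})^{\theta N-1}}\,\frac1{2\pi\mathbf{i}}\int_{\mathcal{C}^-}x^z\prod_{i=1}^N\frac{\Gamma(z-(\lambda_i-\theta i+\theta))}{\Gamma(z-(\lambda_i-\theta i))}\,dz.$$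
   Context: $\mathbb{N}=\{1,2,\dots\}$ and $\mathbf{i}=\sqrt{-1}$. $\mathbb{GT}_N$ is the set of signatures of length $N$, i.e. integer sequences $\lambda=(\lambda_1\ge\dots\ge\lambda_N)$; $\mathbb{GT}^+_N$ is the subset with $\lambda_N\ge 0$; $|\lambda|=\sum_i\lambda_i$. Jack polynomials: for $\theta>0$ and $\lambda\in\mathbb{GT}_N^+$, $J_\lambda(x_1,\dots,x_N;\theta)$ is the Jack symmetric polynomial with Jack parameter $\alpha=1/\theta$, normalized so that the coefficient of $x_1^{\lambda_1}\cdots x_N^{\lambda_N}$ is $1$ (the limit $q\to1$, $t=q^\theta$, of Macdonald polynomials $P_\lambda(\cdot;q,t)$). Explicitly it is determined by $J_{(\lambda_1)}(x_1;\theta)=x_1^{\lambda_1}$ and the branching rule $J_\lambda(x_1,\dots,x_{N+1};\theta)=\sum_{\mu\prec\lambda}\psi_{\lambda/\mu}(\theta)\,x_{N+1}^{|\lambda|-|\mu|}J_\mu(x_1,\dots,x_N;\theta)$ for $\lambda\in\mathbb{GT}^+_{N+1}$, where the sum is over $\mu\in\mathbb{GT}^+_N$ with $\lambda_{N+1}\le\mu_N\le\lambda_N\le\dots\le\mu_1\le\lambda_1$, and, with $(a)_n=a(a+1)\cdots(a+n-1)$, $$\psi_{\lambda/\mu}(\theta)=\prod_{1\le i\le j\le N}\frac{(\mu_i-\mu_j+\theta(j-i)+\theta)_{\mu_j-\lambda_{j+1}}}{(\mu_i-\mu_j+\theta(j-i)+1)_{\mu_j-\lambda_{j+1}}}\cdot\frac{(\lambda_i-\mu_j+\theta(j-i)+1)_{\mu_j-\lambda_{j+1}}}{(\lambda_i-\mu_j+\theta(j-i)+\theta)_{\mu_j-\lambda_{j+1}}}.$$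 For general $\lambda\in\mathbb{GT}_N$, $J_\lambda(x_1,\dots,x_N;\theta)=(x_1\cdots x_N)^{-K}J_{(\lambda_1+K,\dots,\lambda_N+K)}(x_1,\dots,x_N;\theta)$ for any integer $K\ge0$ with $\lambda_N+K\ge0$ (independent of $K$). Jack characters: for $1\le m\le N$ and $\lambda\in\mathbb{GT}_N$, $J_\lambda(x_1,\dots,x_m;N,\theta)=J_\lambda(x_1,\dots,x_m,1^{N-m};\theta)/J_\lambda(1^N;\theta)$, where $1^k$ is a string of $k$ ones (the denominator is nonzero). Branches: $x^z=\exp(z\ln x)$ with the principal logarithm if $x\notin(-\infty,0)$, and with $\operatorname{Im}\ln x=\pi$ if $x\in(-\infty,0)$; $(1-x^{-1})^{\theta N-1}$ is the principal branch. *)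

theory Defs
  imports "HOL-Complex_Analysis.Complex_Analysis"
begin

text \<open>Sequences of length N are functions on the 1-based index set \<open>{1..N}\<close>
  (extensional, so that sequences of length N are in bijection with such functions).\<close>

definition signatures :: "nat \<Rightarrow> (nat \<Rightarrow> int) set" where
  "signatures N = {lam \<in> {1..N} \<rightarrow>\<^sub>E UNIV. \<forall>i\<in>{1..N}. \<forall>j\<in>{1..N}. i \<le> j \<longrightarrow> lam j \<le> lam i}"

text \<open>The branching coefficient, for \<open>mu\<close> of length N interlacing with \<open>lam\<close> of length N + 1;
  interlacing makes every argument of \<open>nat\<close> nonnegative.\<close>

definition jack_psi :: "real \<Rightarrow> nat \<Rightarrow> (nat \<Rightarrow> int) \<Rightarrow> (nat \<Rightarrow> int) \<Rightarrow> real" where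
  "jack_psi \<theta> N lam mu =
    (\<Prod>j\<in>{1..N}. \<Prod>i\<in>{1..j}.
        pochhammer (of_int (mu i - mu j) + \<theta> * real (j - i) + \<theta>) (nat (mu j - lam (j + 1)))
      / pochhammer (of_int (mu i - mu j) + \<theta> * real (j - i) + 1) (nat (mu j - lam (j + 1)))
      * (pochhammer (of_int (lam i - mu j) + \<theta> * real (j - i) + 1) (nat (mu j - lam (j + 1)))
      / pochhammer (of_int (lam i - mu j) + \<theta> * real (j - i) + \<theta>) (nat (mu j - lam (j + 1)))))"

text \<open>The value at \<open>(x 1, \<dots>, x N)\<close> of the Jack polynomial of a nonnegative signature of length N,
  by the branching rule; the exponents are then nonnegative. The number of variables is the second
  argument; its value 0 is never used.\<close>

fun jack_poly :: "real \<Rightarrow> nat \<Rightarrow> (nat \<Rightarrow> int) \<Rightarrow> (nat \<Rightarrow> complex) \<Rightarrow> complex" where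
  "jack_poly \<theta> 0 lam x = 1"
| "jack_poly \<theta> (Suc 0) lam x = x 1 powi lam 1"
| "jack_poly \<theta> (Suc (Suc n)) lam x =
    (\<Sum>mu \<in> (\<Pi>\<^sub>E i\<in>{1..Suc n}. {lam (i + 1)..lam i}).
        of_real (jack_psi \<theta> (Suc n) lam mu)
      * x (Suc (Suc n)) powi ((\<Sum>i\<in>{1..Suc (Suc n)}. lam i) - (\<Sum>i\<in>{1..Suc n}. mu i))
      * jack_poly \<theta> (Suc n) mu x)"

definition shift_signature :: "nat \<Rightarrow> int \<Rightarrow> (nat \<Rightarrow> int) \<Rightarrow> nat \<Rightarrow> int" where
  "shift_signature N K lam = (\<lambda>i\<in>{1..N}. lam i + K)"

text \<open>Arbitrary signatures: the smallest admissible shift is used, so that nonnegative signatures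
  are not shifted; by \<open>jack_eq_shift\<close> below any other admissible shift gives the same
  value.\<close>

definition jack :: "real \<Rightarrow> nat \<Rightarrow> (nat \<Rightarrow> int) \<Rightarrow> (nat \<Rightarrow> complex) \<Rightarrow> complex" where
  "jack \<theta> N lam x =
    (let K = max 0 (- lam N)
     in (\<Prod>i\<in>{1..N}. x i) powi (- K) * jack_poly \<theta> N (shift_signature N K lam) x)"

text \<open>The Jack character in the variables \<open>x 1, \<dots>, x m\<close>, where \<open>m \<le> N\<close>.\<close>

definition jack_character :: "real \<Rightarrow> nat \<Rightarrow> nat \<Rightarrow> (nat \<Rightarrow> int) \<Rightarrow> (nat \<Rightarrow> complex) \<Rightarrow> complex" where
  "jack_character \<theta> N m lam x =
    jack \<theta> N lam (\<lambda>i. if i \<le> m then x i else 1) / jack \<theta> N lam (\<lambda>_. 1)"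

text \<open>The contour coming from \<open>-\<infinity> - r\<i>\<close> along a horizontal ray to \<open>M - r\<i>\<close>, going up the segment to
  \<open>M + r\<i>\<close>, and returning along a horizontal ray to \<open>-\<infinity> + r\<i>\<close>. Since \<open>set_integrable\<close> is Bochner
  integrability, the first predicate is absolute convergence with respect to arc length.\<close>

definition left_contour_abs_convergent :: "real \<Rightarrow> real \<Rightarrow> (complex \<Rightarrow> complex) \<Rightarrow> bool" where
  "left_contour_abs_convergent M r f \<longleftrightarrow>
     set_integrable lborel {..M} (\<lambda>t. f (Complex t (- r))) \<and>
     set_integrable lborel {- r..r} (\<lambda>s. f (Complex M s)) \<and>
     set_integrable lborel {..M} (\<lambda>t. f (Complex t r))"

definition left_contour_integral :: "real \<Rightarrow> real \<Rightarrow> (complex \<Rightarrow> complex) \<Rightarrow> complex" where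
  "left_contour_integral M r f =
     (LINT t:{..M}|lborel. f (Complex t (- r)))
     + contour_integral (linepath (Complex M (- r)) (Complex M r)) f
     - (LINT t:{..M}|lborel. f (Complex t r))"

lemma shift_signature_apply: "i \<in> {1..N} \<Longrightarrow> shift_signature N K lam i = lam i + K"
  by (simp add: shift_signature_def)

lemma jack_psi_shift:
  "jack_psi \<theta> N (shift_signature (Suc N) K lam) (shift_signature N K mu) = jack_psi \<theta> N lam mu"
  unfolding jack_psi_def
  by (intro prod.cong refl) (auto simp: shift_signature_apply)

lemma jack_poly_shift:
  assumes "\<And>i. i \<in> {1..Suc n} \<Longrightarrow> x i \<noteq> 0"
  shows "jack_poly \<theta> (Suc n) (shift_signature (Suc n) K lam) x =
         (\<Prod>i\<in>{1..Suc n}. x i) powi K * jack_poly \<theta> (Suc n) lam x"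
  using assms
proof (induction n arbitrary: lam)
  case 0
  then show ?case
    by (simp add: shift_signature_apply power_int_add mult.commute)
next
  case (Suc n)
  let ?A = "\<lambda>lam. \<Pi>\<^sub>E i\<in>{1..Suc n}. {lam (i + 1)..lam i :: int}"
  let ?F = "\<lambda>lam mu. of_real (jack_psi \<theta> (Suc n) lam mu)
      * x (Suc (Suc n)) powi ((\<Sum>i\<in>{1..Suc (Suc n)}. lam i) - (\<Sum>i\<in>{1..Suc n}. mu i))
      * jack_poly \<theta> (Suc n) mu x"
  let ?lam = "shift_signature (Suc (Suc n)) K lam"
  have x: "x (Suc (Suc n)) \<noteq> 0" using Suc.prems by auto
  have IH: "jack_poly \<theta> (Suc n) (shift_signature (Suc n) K mu) x =
         (\<Prod>i\<in>{1..Suc n}. x i) powi K * jack_poly \<theta> (Suc n) mu x" for mu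
    using Suc.IH Suc.prems by auto
  have "(\<Sum>mu\<in>?A ?lam. ?F ?lam mu) =
        (\<Sum>mu\<in>?A lam. (\<Prod>i\<in>{1..Suc (Suc n)}. x i) powi K * ?F lam mu)"
  proof (rule sum.reindex_bij_witness[where j = "shift_signature (Suc n) (- K)"
        and i = "shift_signature (Suc n) K"], goal_cases)
    case (1 mu)
    then show ?case by (auto simp: shift_signature_def fun_eq_iff PiE_def extensional_def)
  next
    case (2 mu)
    then show ?case by (force simp: shift_signature_def PiE_iff)
  next
    case (3 mu)
    then show ?case by (auto simp: shift_signature_def fun_eq_iff PiE_def extensional_def)
  next
    case (4 mu)
    then show ?case by (force simp: shift_signature_def PiE_iff)
  next
    case (5 mu)
    define nu where "nu = shift_signature (Suc n) (- K) mu"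
    have mu: "mu = shift_signature (Suc n) K nu"
      using 5 by (auto simp: nu_def shift_signature_def fun_eq_iff PiE_def extensional_def)
    have s1: "(\<Sum>i\<in>{1..Suc (Suc n)}. ?lam i) = (\<Sum>i\<in>{1..Suc (Suc n)}. lam i) + (int n + 2) * K"
      by (simp add: shift_signature_def sum.distrib algebra_simps)
    have s2: "(\<Sum>i\<in>{1..Suc n}. shift_signature (Suc n) K nu i)
              = (\<Sum>i\<in>{1..Suc n}. nu i) + (int n + 1) * K"
      by (simp add: shift_signature_def sum.distrib algebra_simps)
    have e: "(\<Sum>i\<in>{1..Suc (Suc n)}. ?lam i) - (\<Sum>i\<in>{1..Suc n}. shift_signature (Suc n) K nu i)
      = K + ((\<Sum>i\<in>{1..Suc (Suc n)}. lam i) - (\<Sum>i\<in>{1..Suc n}. nu i))"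
      unfolding s1 s2 by (simp add: algebra_simps)
    have p: "(\<Prod>i\<in>{1..Suc (Suc n)}. x i) = (\<Prod>i\<in>{1..Suc n}. x i) * x (Suc (Suc n))"
      by simp
    have "?F ?lam (shift_signature (Suc n) K nu)
        = (\<Prod>i\<in>{1..Suc (Suc n)}. x i) powi K * ?F lam nu"
      unfolding e IH jack_psi_shift p power_int_mult_distrib
      using x by (simp add: power_int_add)
    then show ?case
      unfolding nu_def[symmetric] mu[symmetric] by simp
  qed
  then show ?case
    unfolding jack_poly.simps sum_distrib_left .
qed

lemma jack_eq_shift:
  assumes "N \<ge> 1" and "K \<ge> 0" and "lam N + K \<ge> 0" and "\<And>i. i \<in> {1..N} \<Longrightarrow> x i \<noteq> 0"
  shows "jack \<theta> N lam x =
         (\<Prod>i\<in>{1..N}. x i) powi (- K) * jack_poly \<theta> N (shift_signature N K lam) x"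
proof -
  obtain n where N: "N = Suc n" using assms(1) by (cases N) auto
  have nz: "(\<Prod>i\<in>{1..N}. x i) \<noteq> 0" using assms(4) by simp
  have *: "(\<Prod>i\<in>{1..N}. x i) powi (- L) * jack_poly \<theta> N (shift_signature N L lam) x
      = jack_poly \<theta> N lam x" for L
    using jack_poly_shift[of n x \<theta> L lam] assms(4) nz unfolding N
    by (simp add: power_int_minus field_simps)
  show ?thesis unfolding jack_def Let_def * ..
qed

end

theory Submission
  imports Defs "HOL-Real_Asymp.Real_Asymp"
begin

text \<open>With \<open>x\<close> in the innermost variable, the branching rule writes \<open>J_lam(x; N, \<theta>)\<close> as a finite
  average of powers \<open>x^n\<close> with \<open>lam_N \<le> n \<le> lam_1\<close>. For one power the formula, with \<open>a = \<theta> N\<close>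
  and kernel \<open>Gamma(z - n) / Gamma(z - n + a)\<close>, is a residue computation whose residues sum to the
  binomial series. It remains to see that averaging this kernel over \<open>n\<close> gives
  \<open>\<Prod>i. Gamma(z - lam_i + \<theta> i - \<theta>) / Gamma(z - lam_i + \<theta> i)\<close>, a discrete Markov-Krein
  correspondence. Both sides satisfy all Pieri rules
  \<open>\<Sum>I. t^|I| A_I(lam) V_{lam + 1_I}(z) = (1 + t)^(N - 1) (V_lam(z) + t V_lam(z - 1))\<close>, where
  \<open>A_I(lam)\<close> is the product of \<open>1 + \<theta> / (l_i - l_j)\<close> over \<open>i \<in> I\<close> and \<open>j \<notin> I\<close>, with
  \<open>l_i = lam_i - \<theta> i\<close>, and these rules determine \<open>V\<close> from its value at the zero signature. That
  the branching rule respects the Pieri rules is the Kajihara-Noumi identity, used for irrational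
  \<open>\<theta>\<close>; the remaining \<open>\<theta>\<close> follow by continuity.\<close>

section \<open>The Kajihara-Noumi identity\<close>

text \<open>The numbers \<open>A_I\<close> are the coefficients with which elementary symmetric
  polynomials multiply Jack polynomials normalized to value 1 at \<open>1^N\<close>. At
  \<open>(x, 1, ..., 1)\<close> the generating product of the elementary symmetric polynomials is
  \<open>(1 + t) ^ (N - 1) * (1 + t * x)\<close>; this explains the right-hand side of the rules,
  with the shift to \<open>z - 1\<close> in the role of multiplication by \<open>x\<close>. The
  value at \<open>1^N\<close> is proportional to \<open>jack_weight\<close>, and conjugating by
  \<open>jack_weight\<close> keeps the branching coefficients products over pairs. That this is the
  right normalization is itself deduced from uniqueness, applied to the constant function 1. The
  obstacle is the boundary of interlacing. Adding \<open>1_I\<close> leads one unit beyond it, to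
  integer vectors that need not be decreasing, so for special \<open>\<theta>\<close> two positions
  may collide or a Gamma function may meet an accidental pole. Irrational \<open>\<theta>\<close>
  rules this out, and the poles that encode interlacing become zeros of polynomial factors; hence
  the form of the identity with denominators cleared.\<close>

lemma prod_one_plus_partial_fractions:
  fixes v c :: "'i \<Rightarrow> 'a::field"
  assumes "finite S" "inj_on v S" "u \<notin> v ` S"
  shows "(\<Prod>s\<in>S. 1 + c s / (u - v s))
       = 1 + (\<Sum>s\<in>S. c s / (u - v s) * (\<Prod>k\<in>S - {s}. 1 + c k / (v s - v k)))"
  using assms
proof (induction S arbitrary: u rule: finite_induct)
  case empty
  then show ?case by simp
next
  case (insert a S)
  let ?P = "\<lambda>s. \<Prod>k\<in>S - {s}. 1 + c k / (v s - v k)"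
  have IH: "(\<Prod>s\<in>S. 1 + c s / (w - v s)) = 1 + (\<Sum>s\<in>S. c s / (w - v s) * ?P s)"
    if "w \<notin> v ` S" for w
    using insert.IH insert.prems that by auto
  have va: "v a \<notin> v ` S" and u: "u \<noteq> v a" "u \<notin> v ` S"
    using insert.prems insert.hyps by auto
  have step: "(\<Prod>k\<in>insert a S - {s}. 1 + c k / (v s - v k)) = (1 + c a / (v s - v a)) * ?P s"
    if "s \<in> S" for s
  proof -
    have "insert a S - {s} = insert a (S - {s})" using that insert.hyps by auto
    then show ?thesis using insert.hyps by simp
  qed
  have "(\<Sum>s\<in>S. c s / (u - v s) * (\<Prod>k\<in>insert a S - {s}. 1 + c k / (v s - v k)))
      = (\<Sum>s\<in>S. c s / (u - v s) * ?P s + c a / (u - v a) * (c s / (u - v s) * ?P s)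
           - c a / (u - v a) * (c s / (v a - v s) * ?P s))"
  proof (rule sum.cong[OF refl])
    fix s assume s: "s \<in> S"
    have ne: "u - v s \<noteq> 0" "u - v a \<noteq> 0" "v s - v a \<noteq> 0" "v a - v s \<noteq> 0"
      using u va imageI[OF s, of v] by auto
    \<comment> \<open>The product of two simple fractions is split so that the resulting sums are
      those of the induction hypothesis at \<open>u\<close> and, for the part with pole
      \<open>v a\<close>, at \<open>v a\<close>.\<close>
    have pf: "c s / (u - v s) * (1 + c a / (v s - v a))
        = c s / (u - v s) + c a / (u - v a) * (c s / (u - v s)) - c a / (u - v a) * (c s / (v a - v s))"
    proof -
      have e: "c s / (v a - v s) = - (c s / (v s - v a))" by (metis minus_diff_eq minus_divide_right)
      have "c s / (u - v s) * (c a / (v s - v a)) = c a / (u - v a) * (c s / (u - v s)) + c a / (u - v a) * (c s / (v s - v a))"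
        using ne by (simp add: divide_simps) (simp add: algebra_simps)
      then show ?thesis unfolding e distrib_left by simp
    qed
    show "c s / (u - v s) * (\<Prod>k\<in>insert a S - {s}. 1 + c k / (v s - v k)) =
      c s / (u - v s) * ?P s + c a / (u - v a) * (c s / (u - v s) * ?P s)
           - c a / (u - v a) * (c s / (v a - v s) * ?P s)"
      unfolding step[OF s] mult.assoc[symmetric] pf by (simp add: algebra_simps)
  qed
  also have "\<dots> = (\<Sum>s\<in>S. c s / (u - v s) * ?P s)
      + c a / (u - v a) * (\<Sum>s\<in>S. c s / (u - v s) * ?P s)
      - c a / (u - v a) * (\<Sum>s\<in>S. c s / (v a - v s) * ?P s)"
    by (simp add: sum.distrib sum_subtractf sum_distrib_left)
  finally have *: "(\<Sum>s\<in>S. c s / (u - v s) * (\<Prod>k\<in>insert a S - {s}. 1 + c k / (v s - v k))) = \<dots>" .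
  have "insert a S - {a} = S" using insert.hyps by auto
  moreover have "(1 + k) * (1 + X) = 1 + (k * (1 + Y) + (X + k * X - k * Y))" for k X Y :: 'a
    by (simp add: algebra_simps)
  ultimately show ?case
    unfolding prod.insert[OF insert.hyps] sum.insert[OF insert.hyps] * IH[OF u(2)] by (simp only: IH[OF va])
qed

lemma sum_Pow_insert:
  fixes g :: "'i set \<Rightarrow> 'a::comm_monoid_add"
  assumes "finite B" "b \<notin> B"
  shows "(\<Sum>J\<in>Pow (insert b B). g J) = (\<Sum>J\<in>Pow B. g J + g (insert b J))"
proof -
  have i: "inj_on (insert b) (Pow B)" using assms(2) by (auto simp: inj_on_def)
  have d: "Pow B \<inter> insert b ` Pow B = {}" using assms(2) by auto
  show ?thesis unfolding Pow_insert
    using assms(1) d by (simp add: sum.union_disjoint sum.reindex[OF i] sum.distrib)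
qed

text \<open>Both forms reindex pairs of a set and a marked element by taking the mark out of the
  set. The first serves to cancel poles, the second to reach sums over a smaller index set.\<close>

lemma sum_Pow_remove:
  fixes g :: "'i set \<Rightarrow> 'i \<Rightarrow> 'a::comm_monoid_add"
  assumes "finite B"
  shows "(\<Sum>J\<in>Pow B. \<Sum>a\<in>J. g J a) = (\<Sum>J\<in>Pow B. \<Sum>a\<in>B - J. g (insert a J) a)" (is ?A)
    and "(\<Sum>J\<in>Pow B. \<Sum>a\<in>J. g J a) = (\<Sum>a\<in>B. \<Sum>J\<in>Pow (B - {a}). g (insert a J) a)" (is ?B)
proof -
  have f: "finite (Pow B)" "\<And>J. J \<in> Pow B \<Longrightarrow> finite J" "\<And>J. finite (B - J)"
    using assms finite_subset by auto
  have l: "(\<Sum>J\<in>Pow B. \<Sum>a\<in>J. g J a) = (\<Sum>(J,a)\<in>Sigma (Pow B) (\<lambda>J. J). g J a)"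
    using f by (subst sum.Sigma) auto
  have ra: "(\<Sum>J\<in>Pow B. \<Sum>a\<in>B-J. g (insert a J) a) = (\<Sum>(J,a)\<in>Sigma (Pow B) (\<lambda>J. B - J). g (insert a J) a)"
    using f by (subst sum.Sigma) auto
  have rb: "(\<Sum>a\<in>B. \<Sum>J\<in>Pow (B - {a}). g (insert a J) a) = (\<Sum>(a,J)\<in>Sigma B (\<lambda>a. Pow (B - {a})). g (insert a J) a)"
    using assms by (subst sum.Sigma) auto
  show ?A unfolding l ra
    by (rule sum.reindex_bij_witness[where i = "\<lambda>(J,a). (insert a J, a)" and j = "\<lambda>(J,a). (J - {a}, a)"])
       (auto simp: insert_absorb)
  show ?B unfolding l rb
    by (rule sum.reindex_bij_witness[where i = "\<lambda>(a,J). (insert a J, a)" and j = "\<lambda>(J,a). (a, J - {a})"])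
       (auto simp: insert_absorb)
qed

context
  fixes x :: "'i \<Rightarrow> 'a::field" and y :: "'j \<Rightarrow> 'a" and \<phi> t :: 'a
begin

text \<open>Together with \<open>kn_right\<close> this is the rational form of the Kajihara-Noumi
  duality: subsets of the \<open>x\<close> side on the left, subsets of the \<open>y\<close> side
  with the sign of \<open>\<phi>\<close> reversed in the cut product on the right. The variable
  \<open>t\<close> collects the identities for all subset sizes.\<close>

definition kn_left :: "'i set \<Rightarrow> 'j set \<Rightarrow> 'a" where
  "kn_left A B = (\<Sum>I\<in>Pow A. t ^ card I * (\<Prod>i\<in>I. \<Prod>j\<in>A - I. 1 + \<phi> / (x i - x j))
      * (\<Prod>i\<in>I. \<Prod>b\<in>B. 1 + \<phi> / (y b - x i)))"

definition kn_right :: "'i set \<Rightarrow> 'j set \<Rightarrow> 'a" where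
  "kn_right A B = (\<Sum>J\<in>Pow B. t ^ card J * (\<Prod>a\<in>J. \<Prod>b\<in>B - J. 1 - \<phi> / (y a - y b))
      * (\<Prod>a\<in>J. \<Prod>i\<in>A. 1 + \<phi> / (y a - x i)))"

text \<open>As a function of \<open>y b\<close>, each summand has simple poles at the
  \<open>x i\<close> with \<open>i \<in> I\<close>. Expanding in partial fractions and taking the
  marked \<open>i\<close> out of \<open>I\<close> leaves the same sum over
  \<open>A - {i}\<close>.\<close>

lemma kn_left_insert:
  assumes "finite A" "finite B" "b \<notin> B" "inj_on x A" "y b \<notin> x ` A"
  shows "kn_left A (insert b B) = kn_left A B
    + t * (\<Sum>i\<in>A. \<phi> / (y b - x i) * (\<Prod>k\<in>A - {i}. 1 + \<phi> / (x i - x k))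
        * (\<Prod>c\<in>B. 1 + \<phi> / (y c - x i)) * kn_left (A - {i}) B)"
proof -
  define T where "T A I = t ^ card I * (\<Prod>i\<in>I. \<Prod>j\<in>A - I. 1 + \<phi> / (x i - x j))
      * (\<Prod>i\<in>I. \<Prod>b\<in>B. 1 + \<phi> / (y b - x i))" for A I
  let ?Q = "\<lambda>I i. \<phi> / (y b - x i) * (\<Prod>k\<in>I - {i}. 1 + \<phi> / (x i - x k))"
  have "kn_left A (insert b B) = (\<Sum>I\<in>Pow A. T A I * (\<Prod>i\<in>I. 1 + \<phi> / (y b - x i)))"
    unfolding kn_left_def T_def using assms(2,3)
    by (intro sum.cong) (auto simp: prod.distrib)
  also have "\<dots> = (\<Sum>I\<in>Pow A. T A I + (\<Sum>i\<in>I. T A I * ?Q I i))"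
  proof (rule sum.cong[OF refl])
    fix I assume "I \<in> Pow A"
    then have "finite I" "inj_on x I" "y b \<notin> x ` I"
      using assms by (auto intro: finite_subset inj_on_subset)
    from prod_one_plus_partial_fractions[OF this, of "\<lambda>_. \<phi>"]
    show "T A I * (\<Prod>i\<in>I. 1 + \<phi> / (y b - x i)) = T A I + (\<Sum>i\<in>I. T A I * ?Q I i)"
      by (simp add: distrib_left sum_distrib_left)
  qed
  also have "\<dots> = kn_left A B + (\<Sum>I\<in>Pow A. \<Sum>i\<in>I. T A I * ?Q I i)"
    by (simp add: sum.distrib kn_left_def T_def)
  also have "(\<Sum>I\<in>Pow A. \<Sum>i\<in>I. T A I * ?Q I i)
      = (\<Sum>i\<in>A. \<Sum>I\<in>Pow (A - {i}). T A (insert i I) * ?Q (insert i I) i)"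
    by (rule sum_Pow_remove(2)) (rule assms)
  also have "\<dots> = (\<Sum>i\<in>A. t * (\<phi> / (y b - x i) * (\<Prod>k\<in>A - {i}. 1 + \<phi> / (x i - x k))
        * (\<Prod>c\<in>B. 1 + \<phi> / (y c - x i)) * kn_left (A - {i}) B))"
  proof (rule sum.cong[OF refl])
    fix i assume i: "i \<in> A"
    have E: "T A (insert i I) * ?Q (insert i I) i = t * (\<phi> / (y b - x i) * (\<Prod>k\<in>A - {i}. 1 + \<phi> / (x i - x k))
        * (\<Prod>c\<in>B. 1 + \<phi> / (y c - x i))) * T (A - {i}) I" if "I \<in> Pow (A - {i})" for I
    proof -
      have I: "finite I" "i \<notin> I" "insert i I - {i} = I" "A - insert i I = A - {i} - I"
        using that assms(1) by (auto intro: finite_subset)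
      have s: "(\<Prod>k\<in>A - {i}. 1 + \<phi> / (x i - x k))
          = (\<Prod>k\<in>A - {i} - I. 1 + \<phi> / (x i - x k)) * (\<Prod>k\<in>I. 1 + \<phi> / (x i - x k))"
        using that assms(1) by (intro prod.subset_diff) auto
      show ?thesis unfolding T_def s I(3,4) using I(1,2) by (simp add: mult_ac)
    qed
    have "kn_left (A - {i}) B = (\<Sum>I\<in>Pow (A - {i}). T (A - {i}) I)"
      by (simp only: kn_left_def T_def)
    then show "(\<Sum>I\<in>Pow (A - {i}). T A (insert i I) * ?Q (insert i I) i)
       = t * (\<phi> / (y b - x i) * (\<Prod>k\<in>A - {i}. 1 + \<phi> / (x i - x k))
        * (\<Prod>c\<in>B. 1 + \<phi> / (y c - x i)) * kn_left (A - {i}) B)"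
      by (simp only: sum_distrib_left mult.assoc[symmetric]) (rule sum.cong[OF refl], drule E, simp only: mult.assoc)
  qed
  finally show ?thesis by (simp add: sum_distrib_left)
qed

text \<open>This is the recursion of \<open>kn_left\<close>, except for the factor
  \<open>1 + t\<close>, which comes from the constant terms of the subsets without and with
  \<open>b\<close>. The apparent poles at \<open>y b = y c\<close> cancel between these two kinds of
  subsets, so only the poles at the \<open>x i\<close> survive.\<close>

lemma kn_right_insert:
  assumes "finite A" "finite B" "b \<notin> B" "inj_on x A" "inj_on y (insert b B)"
    and "x ` A \<inter> y ` insert b B = {}"
  shows "kn_right A (insert b B) = (1 + t) * kn_right A B
    + t * (\<Sum>i\<in>A. \<phi> / (y b - x i) * (\<Prod>k\<in>A - {i}. 1 + \<phi> / (x i - x k))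
        * (\<Prod>c\<in>B. 1 + \<phi> / (y c - x i)) * kn_right (A - {i}) B)"
proof -
  define T where "T A J = t ^ card J * (\<Prod>a\<in>J. \<Prod>b\<in>B - J. 1 - \<phi> / (y a - y b))
      * (\<Prod>a\<in>J. \<Prod>i\<in>A. 1 + \<phi> / (y a - x i))" for A J
  \<comment> \<open>\<open>U\<close> holds the polar parts in \<open>y b\<close> at the points
    \<open>y a\<close>, and \<open>W\<close> those at the points \<open>x i\<close>.\<close>
  define U where "U J a = T A J * (\<phi> / (y b - y a) * (\<Prod>k\<in>J - {a}. 1 + \<phi> / (y a - y k)))" for J a
  define W where "W J i = \<phi> / (y b - x i) * ((\<Prod>c\<in>B - J. 1 - \<phi> / (x i - y c))
      * (\<Prod>k\<in>A - {i}. 1 + \<phi> / (x i - x k)))" for J i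
  have flip: "1 - \<phi> / (p - q) = 1 + \<phi> / (q - p)" for p q :: 'a
    by (metis add_uminus_conv_diff minus_diff_eq minus_divide_right)
  have fin: "J \<subseteq> B \<Longrightarrow> finite J" for J using assms(2) finite_subset by auto
  have R: "kn_right A (insert b B) = (\<Sum>J\<in>Pow B.
      T A J * (\<Prod>a\<in>J. 1 + \<phi> / (y b - y a))
      + t * T A J * ((\<Prod>c\<in>B - J. 1 - \<phi> / (y b - y c)) * (\<Prod>i\<in>A. 1 + \<phi> / (y b - x i))))"
    unfolding kn_right_def sum_Pow_insert[OF assms(2,3)]
  proof (rule sum.cong[OF refl], goal_cases)
    case (1 J)
    then have J: "J \<subseteq> B" "finite J" "b \<notin> J" "insert b B - J = insert b (B - J)" "b \<notin> B - J"
      "insert b B - insert b J = B - J" "finite (B - J)"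
      using assms(2,3) fin by auto
    show ?case unfolding J(4,6) T_def using J(2,3,5,7) by (simp add: prod.distrib mult_ac flip[of _ "y b"])
  qed
  have E1: "T A J * (\<Prod>a\<in>J. 1 + \<phi> / (y b - y a)) = T A J + (\<Sum>a\<in>J. U J a)" if "J \<in> Pow B" for J
  proof -
    have "finite J" "inj_on y J" "y b \<notin> y ` J"
      using that fin assms(3,5) by (auto intro: inj_on_subset)
    from prod_one_plus_partial_fractions[OF this, of "\<lambda>_. \<phi>"]
    show ?thesis by (simp add: distrib_left sum_distrib_left U_def)
  qed
  \<comment> \<open>The subsets \<open>insert b J\<close> and \<open>insert c J\<close> have
    opposite polar parts at \<open>y c\<close>.\<close>
  have UT: "t * T A J * (\<phi> / (y b - y c) * ((\<Prod>k\<in>B - J - {c}. 1 - \<phi> / (y c - y k)) * (\<Prod>i\<in>A. 1 + \<phi> / (y c - x i))))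
      = U (insert c J) c" if "J \<in> Pow B" "c \<in> B - J" for J c
  proof -
    have J: "finite J" "c \<notin> J" "insert c J - {c} = J" "B - insert c J = B - J - {c}"
      using that fin by auto
    have s: "(\<Prod>e\<in>B - J. 1 - \<phi> / (y a - y e)) = (1 - \<phi> / (y a - y c)) * (\<Prod>e\<in>B - J - {c}. 1 - \<phi> / (y a - y e))" for a
      using that assms(2) by (intro prod.remove) auto
    show ?thesis unfolding U_def T_def s J(3,4) using J(1,2)
      by (simp add: prod.distrib flip[of _ "y c"] mult_ac)
  qed
  have E2: "t * T A J * ((\<Prod>c\<in>B - J. 1 - \<phi> / (y b - y c)) * (\<Prod>i\<in>A. 1 + \<phi> / (y b - x i)))
     = t * T A J - (\<Sum>c\<in>B - J. U (insert c J) c) + (\<Sum>i\<in>A. t * T A J * W J i)" if J: "J \<in> Pow B" for J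
  proof -
    \<comment> \<open>Poles of both kinds are indexed by one sum type, with numerator
      \<open>- \<phi>\<close> at \<open>y c\<close> and \<open>\<phi>\<close> at
      \<open>x i\<close>.\<close>
    let ?v = "case_sum y x" and ?c = "case_sum (\<lambda>_. - \<phi>) (\<lambda>_. \<phi>)"
    have fB: "finite (B - J)" using assms(2) by auto
    have "finite ((B - J) <+> A)" using assms(1) fB by simp
    moreover have "inj_on ?v ((B - J) <+> A)"
    proof (rule inj_onI, elim PlusE, goal_cases)
      case (1 p q c d) then show ?case using assms(5) by (auto dest: inj_onD)
    next
      case (2 p q c i) then show ?case using assms(6) by auto
    next
      case (3 p q i c)
      then have "x i = y c" "i \<in> A" "c \<in> insert b B" by simp_all
      then have "x i = y c" "x i \<in> x ` A" "y c \<in> y ` insert b B" by blast+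
      then show ?case using assms(6) by (metis IntI emptyE)
    next
      case (4 p q i k) then show ?case using assms(4) by (auto dest: inj_onD)
    qed
    moreover have "y b \<notin> ?v ` ((B - J) <+> A)"
    proof
      assume "y b \<in> ?v ` ((B - J) <+> A)"
      then consider c where "c \<in> B" "y b = y c" | i where "i \<in> A" "y b = x i"
        by (auto elim!: PlusE)
      then show False
      proof cases
        case 1 then show False using assms(3,5) by (auto dest: inj_onD)
      next
        case 2
        then have "y b \<in> x ` A \<inter> y ` insert b B" by auto
        then show False using assms(6) by simp
      qed
    qed
    ultimately have "finite ((B - J) <+> A)" "inj_on ?v ((B - J) <+> A)" "y b \<notin> ?v ` ((B - J) <+> A)"
      by blast+
    from prod_one_plus_partial_fractions[OF this, of ?c]
    have "(\<Prod>c\<in>B - J. 1 - \<phi> / (y b - y c)) * (\<Prod>i\<in>A. 1 + \<phi> / (y b - x i))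
      = 1 + ((\<Sum>c\<in>B - J. - \<phi> / (y b - y c) * (\<Prod>k\<in>((B - J) <+> A) - {Inl c}. 1 + ?c k / (y c - ?v k)))
         + (\<Sum>i\<in>A. \<phi> / (y b - x i) * (\<Prod>k\<in>((B - J) <+> A) - {Inr i}. 1 + ?c k / (x i - ?v k))))"
      by (simp add: prod.Plus[OF fB assms(1)] sum.Plus[OF fB assms(1)] comp_def)
    also have "(\<Sum>c\<in>B - J. - \<phi> / (y b - y c) * (\<Prod>k\<in>((B - J) <+> A) - {Inl c}. 1 + ?c k / (y c - ?v k)))
       = (\<Sum>c\<in>B - J. - (\<phi> / (y b - y c) * ((\<Prod>k\<in>B - J - {c}. 1 - \<phi> / (y c - y k)) * (\<Prod>i\<in>A. 1 + \<phi> / (y c - x i)))))"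
    proof (rule sum.cong[OF refl])
      fix c
      have e: "((B - J) <+> A) - {Inl c} = (B - J - {c}) <+> A" by auto
      show "- \<phi> / (y b - y c) * (\<Prod>k\<in>((B - J) <+> A) - {Inl c}. 1 + ?c k / (y c - ?v k))
       = - (\<phi> / (y b - y c) * ((\<Prod>k\<in>B - J - {c}. 1 - \<phi> / (y c - y k)) * (\<Prod>i\<in>A. 1 + \<phi> / (y c - x i))))"
        unfolding e using fB assms(1) by (subst prod.Plus) (auto simp: comp_def)
    qed
    also have "(\<Sum>i\<in>A. \<phi> / (y b - x i) * (\<Prod>k\<in>((B - J) <+> A) - {Inr i}. 1 + ?c k / (x i - ?v k))) = (\<Sum>i\<in>A. W J i)"
    proof (rule sum.cong[OF refl])
      fix i
      have e: "((B - J) <+> A) - {Inr i} = (B - J) <+> (A - {i})" by auto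
      show "\<phi> / (y b - x i) * (\<Prod>k\<in>((B - J) <+> A) - {Inr i}. 1 + ?c k / (x i - ?v k)) = W J i"
        unfolding e W_def using fB assms(1) by (subst prod.Plus) (auto simp: comp_def)
    qed
    finally have X: "(\<Prod>c\<in>B - J. 1 - \<phi> / (y b - y c)) * (\<Prod>i\<in>A. 1 + \<phi> / (y b - x i))
      = 1 + (- (\<Sum>c\<in>B - J. \<phi> / (y b - y c) * ((\<Prod>k\<in>B - J - {c}. 1 - \<phi> / (y c - y k)) * (\<Prod>i\<in>A. 1 + \<phi> / (y c - x i))))
         + (\<Sum>i\<in>A. W J i))" (is "_ = 1 + (- ?S + _)")
      by (simp only: sum_negf)
    have S: "(\<Sum>c\<in>B - J. U (insert c J) c) = t * T A J * ?S"
      unfolding sum_distrib_left by (intro sum.cong refl UT[OF J, symmetric])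
    show ?thesis unfolding X S sum_distrib_left[symmetric] by (simp add: algebra_simps)
  qed
  have W: "(\<Sum>J\<in>Pow B. t * T A J * W J i) = t * (\<phi> / (y b - x i) * (\<Prod>k\<in>A - {i}. 1 + \<phi> / (x i - x k))
        * (\<Prod>c\<in>B. 1 + \<phi> / (y c - x i)) * kn_right (A - {i}) B)" if "i \<in> A" for i
  proof -
    have "T A J * (\<Prod>c\<in>B - J. 1 - \<phi> / (x i - y c)) = (\<Prod>c\<in>B. 1 + \<phi> / (y c - x i)) * T (A - {i}) J"
      if "J \<in> Pow B" for J
    proof -
      have s: "(\<Prod>c\<in>B. 1 + \<phi> / (y c - x i)) = (\<Prod>c\<in>B - J. 1 + \<phi> / (y c - x i)) * (\<Prod>c\<in>J. 1 + \<phi> / (y c - x i))"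
        using that assms(2) by (intro prod.subset_diff) auto
      have r: "(\<Prod>i\<in>A. 1 + \<phi> / (y a - x i)) = (1 + \<phi> / (y a - x i)) * (\<Prod>i\<in>A - {i}. 1 + \<phi> / (y a - x i))" for a
        using \<open>i \<in> A\<close> assms(1) by (intro prod.remove) auto
      show ?thesis unfolding T_def s r by (simp add: prod.distrib flip[of "x i"] mult_ac)
    qed
    then have "t * T A J * W J i = t * (\<phi> / (y b - x i) * (\<Prod>k\<in>A - {i}. 1 + \<phi> / (x i - x k))
        * (\<Prod>c\<in>B. 1 + \<phi> / (y c - x i))) * T (A - {i}) J" if "J \<in> Pow B" for J
      unfolding W_def using that by (simp add: mult_ac)
    moreover have "kn_right (A - {i}) B = (\<Sum>J\<in>Pow B. T (A - {i}) J)"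
      by (simp add: kn_right_def T_def)
    ultimately show ?thesis by (simp add: sum_distrib_left mult.assoc)
  qed
  have "kn_right A (insert b B) = (\<Sum>J\<in>Pow B. T A J + t * T A J) + ((\<Sum>J\<in>Pow B. \<Sum>a\<in>J. U J a)
      - (\<Sum>J\<in>Pow B. \<Sum>c\<in>B - J. U (insert c J) c)) + (\<Sum>J\<in>Pow B. \<Sum>i\<in>A. t * T A J * W J i)"
    unfolding R using E1 E2 by (simp add: sum.distrib sum_subtractf)
  also have "(\<Sum>J\<in>Pow B. T A J + t * T A J) = (1 + t) * kn_right A B"
    by (simp add: kn_right_def T_def sum.distrib sum_distrib_left algebra_simps)
  also have "(\<Sum>J\<in>Pow B. \<Sum>a\<in>J. U J a) = (\<Sum>J\<in>Pow B. \<Sum>c\<in>B - J. U (insert c J) c)"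
    by (rule sum_Pow_remove(1)) (rule assms)
  also have "(\<Sum>J\<in>Pow B. \<Sum>i\<in>A. t * T A J * W J i) = (\<Sum>i\<in>A. \<Sum>J\<in>Pow B. t * T A J * W J i)"
    by (rule sum.swap)
  finally show ?thesis using W by (simp add: sum_distrib_left)
qed

end

text \<open>With one index set empty, the left and right sums differ only in the sign of
  \<open>\<phi>\<close>. On the right-hand form the recursion has no poles left, so each new point
  contributes exactly a factor \<open>1 + t\<close>.\<close>

lemma kn_left_empty:
  fixes x :: "'i \<Rightarrow> 'a::field"
  assumes "finite A" "inj_on x A"
  shows "kn_left x y \<phi> t A {} = (1 + t) ^ card A"
proof -
  have "kn_right x' x (- \<phi>) t ({}::'i set) A = (1 + t) ^ card A" for x'
    using assms
  proof (induction A rule: finite_induct)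
    case empty
    then show ?case by (simp add: kn_right_def)
  next
    case (insert a A)
    then show ?case by (subst kn_right_insert) auto
  qed
  then show ?thesis by (simp add: kn_left_def kn_right_def)
qed

text \<open>Both sides satisfy the same recursion in \<open>B\<close>. Its terms remove one point
  from each side, which preserves the difference of cardinalities, so a common power of
  \<open>1 + t\<close> factors out.\<close>

theorem kajihara_noumi:
  fixes x :: "'i \<Rightarrow> 'a::field"
  assumes "finite A" "finite B" "inj_on x A" "inj_on y B" "x ` A \<inter> y ` B = {}" "card B \<le> card A"
  shows "kn_left x y \<phi> t A B = (1 + t) ^ (card A - card B) * kn_right x y \<phi> t A B"
  using assms(2,1,3-)
proof (induction B arbitrary: A rule: finite_induct)
  case empty
  then show ?case by (simp add: kn_left_empty kn_right_def)
next
  case (insert b B)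
  let ?d = "card A - card (insert b B)"
  have c: "card A - card B = Suc ?d" using insert by simp
  have IH: "kn_left x y \<phi> t (A - {i}) B = (1 + t) ^ ?d * kn_right x y \<phi> t (A - {i}) B" if "i \<in> A" for i
  proof -
    have "card (A - {i}) = card A - 1" "card A - 1 - card B = ?d" using that insert by auto
    moreover have "finite (A - {i})" "inj_on x (A - {i})" "inj_on y B" "x ` (A - {i}) \<inter> y ` B = {}"
      "card B \<le> card (A - {i})"
      using insert.prems insert.hyps that by (auto simp: inj_on_diff)
    ultimately show ?thesis using insert.IH[of "A - {i}"] by simp
  qed
  have "kn_left x y \<phi> t A (insert b B) = (1 + t) ^ ?d * ((1 + t) * kn_right x y \<phi> t A B)
    + t * (\<Sum>i\<in>A. (1 + t) ^ ?d * (\<phi> / (y b - x i) * (\<Prod>k\<in>A - {i}. 1 + \<phi> / (x i - x k))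
        * (\<Prod>c\<in>B. 1 + \<phi> / (y c - x i)) * kn_right x y \<phi> t (A - {i}) B))"
    using insert IH by (subst kn_left_insert) (auto simp: c mult_ac)
  also have "\<dots> = (1 + t) ^ ?d * kn_right x y \<phi> t A (insert b B)"
    using insert by (subst kn_right_insert) (auto simp: distrib_left sum_distrib_left mult_ac)
  finally show ?case .
qed

lemma eventually_at_avoid_finite:
  fixes a :: "'a::t1_space"
  assumes "finite S"
  shows "\<forall>\<^sub>F e in at a. e \<notin> S"
proof -
  have "open (- (S - {a}))" using assms by (intro open_Compl finite_imp_closed) auto
  then have "\<forall>\<^sub>F e in nhds a. e \<in> - (S - {a})" by (intro eventually_nhds_in_open) auto
  then show ?thesis unfolding eventually_at_filter by eventually_elim auto
qed

text \<open>Multiplying by all \<open>x i - y b\<close> makes the identity meaningful when some \<open>x i\<close> equals some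
  \<open>y b\<close>; this happens at the boundary of interlacing.\<close>

lemma kajihara_noumi_cleared_generic:
  fixes x :: "'i \<Rightarrow> 'a::field" and y :: "'j \<Rightarrow> 'a"
  assumes "finite A" "finite B" "inj_on x A" "inj_on y B" "x ` A \<inter> y ` B = {}" "card B \<le> card A"
  shows "(\<Sum>I\<in>Pow A. t ^ card I * (\<Prod>i\<in>I. \<Prod>j\<in>A - I. 1 + \<phi> / (x i - x j))
           * (\<Prod>b\<in>B. \<Prod>i\<in>A. x i - y b - (if i \<in> I then \<phi> else 0)))
       = (1 + t) ^ (card A - card B) *
         (\<Sum>J\<in>Pow B. t ^ card J * (\<Prod>a\<in>J. \<Prod>b\<in>B - J. 1 - \<phi> / (y a - y b))
           * (\<Prod>b\<in>B. \<Prod>i\<in>A. x i - y b - (if b \<in> J then \<phi> else 0)))"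
proof -
  define P where "P = (\<Prod>b\<in>B. \<Prod>i\<in>A. x i - y b)"
  have one: "(1 + \<phi> / (y b - x i)) * (x i - y b) = x i - y b - \<phi>" if "b \<in> B" "i \<in> A" for b i
  proof -
    have "y b \<noteq> x i" using assms(5) that by (metis IntI emptyE imageI)
    then show ?thesis by (simp add: field_simps)
  qed
  have L: "(\<Prod>i\<in>I. \<Prod>b\<in>B. 1 + \<phi> / (y b - x i)) * P
      = (\<Prod>b\<in>B. \<Prod>i\<in>A. x i - y b - (if i \<in> I then \<phi> else 0))" if "I \<subseteq> A" for I
  proof -
    have e: "(\<Prod>i\<in>I. \<Prod>b\<in>B. 1 + \<phi> / (y b - x i))
        = (\<Prod>b\<in>B. \<Prod>i\<in>A. if i \<in> I then 1 + \<phi> / (y b - x i) else 1)"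
      using that assms(1) by (subst prod.swap) (simp add: prod.If_cases Int_absorb1)
    show ?thesis unfolding e P_def prod.distrib[symmetric]
      by (auto intro!: prod.cong simp: one)
  qed
  have R: "(\<Prod>a\<in>J. \<Prod>i\<in>A. 1 + \<phi> / (y a - x i)) * P
      = (\<Prod>b\<in>B. \<Prod>i\<in>A. x i - y b - (if b \<in> J then \<phi> else 0))" if "J \<subseteq> B" for J
  proof -
    have e: "(\<Prod>a\<in>J. \<Prod>i\<in>A. 1 + \<phi> / (y a - x i))
        = (\<Prod>b\<in>B. if b \<in> J then \<Prod>i\<in>A. 1 + \<phi> / (y b - x i) else 1)"
      using that assms(2) by (simp add: prod.If_cases Int_absorb1)
    show ?thesis unfolding e P_def prod.distrib[symmetric]
      by (auto intro!: prod.cong simp: one simp flip: prod.distrib)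
  qed
  have "kn_left x y \<phi> t A B * P = (1 + t) ^ (card A - card B) * (kn_right x y \<phi> t A B * P)"
    using kajihara_noumi[OF assms] by simp
  then show ?thesis
    unfolding kn_left_def kn_right_def sum_distrib_right mult.assoc using L R by (simp add: mult.assoc)
qed

text \<open>Translating all \<open>y b\<close> by a small \<open>e\<close> separates the two
  families of points. Both cleared sides are polynomial in \<open>e\<close>, so the identity
  survives the limit at 0.\<close>

lemma kajihara_noumi_cleared:
  fixes x :: "'i \<Rightarrow> 'a::real_normed_field" and y :: "'j \<Rightarrow> 'a"
  assumes "finite A" "finite B" "inj_on x A" "inj_on y B" "card B \<le> card A"
  shows "(\<Sum>I\<in>Pow A. t ^ card I * (\<Prod>i\<in>I. \<Prod>j\<in>A - I. 1 + \<phi> / (x i - x j))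
           * (\<Prod>b\<in>B. \<Prod>i\<in>A. x i - y b - (if i \<in> I then \<phi> else 0)))
       = (1 + t) ^ (card A - card B) *
         (\<Sum>J\<in>Pow B. t ^ card J * (\<Prod>a\<in>J. \<Prod>b\<in>B - J. 1 - \<phi> / (y a - y b))
           * (\<Prod>b\<in>B. \<Prod>i\<in>A. x i - y b - (if b \<in> J then \<phi> else 0)))"
    (is "?L 0 = ?R 0" is "(\<Sum>I\<in>_. ?l I * _) = ?c * (\<Sum>J\<in>_. ?r J * _)")
proof -
  let ?L = "\<lambda>e::'a. \<Sum>I\<in>Pow A. ?l I * (\<Prod>b\<in>B. \<Prod>i\<in>A. x i - (y b + e) - (if i \<in> I then \<phi> else 0))"
  let ?R = "\<lambda>e::'a. ?c * (\<Sum>J\<in>Pow B. ?r J * (\<Prod>b\<in>B. \<Prod>i\<in>A. x i - (y b + e) - (if b \<in> J then \<phi> else 0)))"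
  have "\<forall>\<^sub>F e in at 0. e \<notin> (\<lambda>(i, b). x i - y b) ` (A \<times> B)"
    using assms by (intro eventually_at_avoid_finite) auto
  then have ev: "\<forall>\<^sub>F e in at 0. ?L e = ?R e"
  proof eventually_elim
    case (elim e)
    have "x i \<noteq> y b + e" if "i \<in> A" "b \<in> B" for i b
    proof
      assume "x i = y b + e"
      then have "e = (\<lambda>(i, b). x i - y b) (i, b)" by simp
      then show False using elim that by blast
    qed
    then have "x ` A \<inter> (\<lambda>b. y b + e) ` B = {}" by auto
    moreover have "inj_on (\<lambda>b. y b + e) B" using assms(4) by (auto simp: inj_on_def)
    ultimately show ?case
      using kajihara_noumi_cleared_generic[of A B x "\<lambda>b. y b + e" t \<phi>] assms by simp
  qed
  have "isCont (\<lambda>e. ?L e) 0" "isCont (\<lambda>e. ?R e) 0" by (intro continuous_intros)+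
  then have L: "?L \<midarrow>0\<rightarrow> ?L 0" and R: "?R \<midarrow>0\<rightarrow> ?R 0" by (simp_all only: isCont_def)
  have "?L \<midarrow>0\<rightarrow> ?R 0" by (rule iffD2[OF tendsto_cong[OF ev] R])
  then have "?L 0 = ?R 0" by (rule LIM_unique[OF L])
  then show ?thesis by simp
qed

text \<open>With a single \<open>y\<close> the right-hand sum has only two terms. This is the case
  behind the Pieri rule of the Gamma kernel.\<close>

lemma kajihara_noumi_single:
  fixes x :: "'i \<Rightarrow> 'a::field"
  assumes "finite A" "A \<noteq> {}" "inj_on x A" "y \<notin> x ` A"
  shows "(\<Sum>I\<in>Pow A. t ^ card I * (\<Prod>i\<in>I. \<Prod>j\<in>A - I. 1 + \<phi> / (x i - x j))
      * (\<Prod>i\<in>I. 1 + \<phi> / (y - x i)))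
     = (1 + t) ^ (card A - 1) * (1 + t * (\<Prod>i\<in>A. 1 + \<phi> / (y - x i)))"
proof -
  have "card A \<noteq> 0" using assms by auto
  then have c: "card {()} \<le> card A" by simp
  have p: "Pow {()} = {{}, {()}}" by auto
  show ?thesis
    using kajihara_noumi[OF assms(1) _ assms(3) _ _ c, of "\<lambda>_. y" \<phi> t] assms(4)
    by (simp add: kn_left_def kn_right_def p)
qed

section \<open>The branching rule\<close>

lemma signaturesD: "lam \<in> signatures N \<Longrightarrow> i \<in> {1..N} \<Longrightarrow> j \<in> {1..N} \<Longrightarrow> i \<le> j \<Longrightarrow> lam j \<le> lam i"
  by (simp add: signatures_def)

abbreviation interlacing :: "nat \<Rightarrow> (nat \<Rightarrow> int) \<Rightarrow> (nat \<Rightarrow> int) set" where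
  "interlacing N lam \<equiv> \<Pi>\<^sub>E i\<in>{1..N}. {lam (i + 1)..lam i}"

lemma interlacing_signatures:
  assumes "lam \<in> signatures (Suc N)" "mu \<in> interlacing N lam"
  shows "mu \<in> signatures N"
proof -
  have "mu j \<le> mu i" if "i \<in> {1..N}" "j \<in> {1..N}" "i \<le> j" for i j
  proof (cases "i = j")
    case False
    then have "mu j \<le> lam j" "lam j \<le> lam (i + 1)" "lam (i + 1) \<le> mu i"
      using assms that by (auto simp: PiE_iff intro!: signaturesD[OF assms(1)])
    then show ?thesis by linarith
  qed simp
  then show ?thesis using assms(2) by (auto simp: signatures_def PiE_iff)
qed

lemma restrict_interlacing:
  assumes "lam \<in> signatures (Suc N)"
  shows "restrict lam {1..N} \<in> interlacing N lam"
  using assms by (auto intro!: signaturesD)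

text \<open>Only the innermost variable carries \<open>x\<close>, so replacing \<open>x powi k\<close> by an arbitrary \<open>h k\<close> gives
  the unnormalized expectation of \<open>h\<close> at level 1 of the Gelfand-Tsetlin pattern.\<close>

fun branch_sum :: "real \<Rightarrow> nat \<Rightarrow> (nat \<Rightarrow> int) \<Rightarrow> (int \<Rightarrow> complex) \<Rightarrow> complex" where
  "branch_sum \<theta> 0 lam h = 0"
| "branch_sum \<theta> (Suc 0) lam h = h (lam 1)"
| "branch_sum \<theta> (Suc (Suc n)) lam h =
    (\<Sum>mu\<in>interlacing (Suc n) lam. of_real (jack_psi \<theta> (Suc n) lam mu) * branch_sum \<theta> (Suc n) mu h)"

lemma branch_sum_Suc:
  "N \<ge> 1 \<Longrightarrow> branch_sum \<theta> (Suc N) lam h =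
    (\<Sum>mu\<in>interlacing N lam. of_real (jack_psi \<theta> N lam mu) * branch_sum \<theta> N mu h)"
  by (cases N) auto

lemma jack_poly_eq_branch_sum:
  "jack_poly \<theta> (Suc n) lam (\<lambda>i. if i \<le> 1 then x else 1) = branch_sum \<theta> (Suc n) lam (\<lambda>k. x powi k)"
  by (induction n arbitrary: lam) simp_all

text \<open>The branching recursion is written with integer powers, so away from zero variables it
  is already equivariant under shifts, and negative signatures can be treated like nonnegative
  ones.\<close>

lemma jack_eq_jack_poly:
  assumes "N \<ge> 1" "\<And>i. i \<in> {1..N} \<Longrightarrow> x i \<noteq> 0"
  shows "jack \<theta> N lam x = jack_poly \<theta> N lam x"
proof -
  obtain n where N: "N = Suc n" using assms(1) by (cases N) auto
  have nz: "(\<Prod>i\<in>{1..N}. x i) \<noteq> 0" using assms(2) by simp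
  show ?thesis
    using jack_poly_shift[of n x \<theta> "max 0 (- lam N)" lam] assms(2) nz unfolding N jack_def Let_def
    by (simp add: power_int_minus field_simps)
qed

lemma jack_character_eq:
  assumes "N \<ge> 1" "x \<noteq> 0"
  shows "jack_character \<theta> N 1 lam (\<lambda>_. x)
    = branch_sum \<theta> N lam (\<lambda>k. x powi k) / branch_sum \<theta> N lam (\<lambda>_. 1)"
proof -
  obtain n where N: "N = Suc n" using assms(1) by (cases N) auto
  have "jack \<theta> N lam (\<lambda>_. 1) = branch_sum \<theta> N lam (\<lambda>_. 1)"
    using jack_poly_eq_branch_sum[of \<theta> n lam 1] assms(1) by (simp add: jack_eq_jack_poly N)
  moreover have "jack \<theta> N lam (\<lambda>i. if i \<le> 1 then x else 1) = branch_sum \<theta> N lam (\<lambda>k. x powi k)"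
    using jack_poly_eq_branch_sum[of \<theta> n lam x] assms by (subst jack_eq_jack_poly) (simp_all add: N)
  ultimately show ?thesis by (simp add: jack_character_def)
qed

lemma interlacing_bounds:
  assumes "lam \<in> signatures (Suc N)" "mu \<in> interlacing N lam" "1 \<le> i" "i \<le> j" "j \<le> N"
  shows "mu j \<le> mu i" "mu j \<le> lam i" "lam (j + 1) \<le> mu i" "lam (j + 1) \<le> mu j"
proof -
  show a: "mu j \<le> mu i"
    using interlacing_signatures[OF assms(1,2)] assms(3-) by (auto intro!: signaturesD)
  have "mu j \<le> lam j" "lam j \<le> lam i"
    using assms by (auto simp: PiE_iff intro!: signaturesD[OF assms(1)])
  then show "mu j \<le> lam i" by linarith
  show b: "lam (j + 1) \<le> mu j" using assms by (auto simp: PiE_iff)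
  show "lam (j + 1) \<le> mu i" using a b by linarith
qed

lemma jack_psi_pos:
  assumes "\<theta> > 0" "lam \<in> signatures (Suc N)" "mu \<in> interlacing N lam"
  shows "jack_psi \<theta> N lam mu > 0"
  unfolding jack_psi_def
proof (intro prod_pos mult_pos_pos divide_pos_pos pochhammer_pos)
  fix i j assume ij: "j \<in> {1..N}" "i \<in> {1..j}"
  then have "real_of_int (mu i - mu j) \<ge> 0" "real_of_int (lam i - mu j) \<ge> 0" "\<theta> * real (j - i) \<ge> 0"
    using interlacing_bounds[OF assms(2,3), of i j] assms(1) by auto
  with assms(1) show "0 < real_of_int (mu i - mu j) + \<theta> * real (j - i) + \<theta>"
    "0 < real_of_int (mu i - mu j) + \<theta> * real (j - i) + 1"
    "0 < real_of_int (lam i - mu j) + \<theta> * real (j - i) + 1"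
    "0 < real_of_int (lam i - mu j) + \<theta> * real (j - i) + \<theta>"
    by linarith+
qed

lemma finite_interlacing: "finite (interlacing N lam)"
  by (intro finite_PiE) auto

text \<open>All \<open>jack_psi\<close> are positive and \<open>restrict lam {1..N}\<close> always
  interlaces, so a nonempty sum of positive terms arises at each level. This is what makes the
  denominator of the character nonzero.\<close>

lemma branch_sum_one_pos:
  assumes "\<theta> > 0" "N \<ge> 1" "lam \<in> signatures N"
  shows "\<exists>c>0. branch_sum \<theta> N lam (\<lambda>_. 1) = of_real c"
  using assms(2,3)
proof (induction N arbitrary: lam rule: dec_induct)
  case base
  then show ?case by (intro exI[of _ 1]) simp
next
  case (step N)
  then obtain c where c: "\<And>mu. mu \<in> interlacing N lam \<Longrightarrow> c mu > 0 \<and> branch_sum \<theta> N mu (\<lambda>_. 1) = of_real (c mu)"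
    using interlacing_signatures[OF step.prems] by metis
  have ne: "interlacing N lam \<noteq> {}" using restrict_interlacing[OF step.prems] by blast
  show ?case
  proof (intro exI conjI)
    show "branch_sum \<theta> (Suc N) lam (\<lambda>_. 1) = of_real (\<Sum>mu\<in>interlacing N lam. jack_psi \<theta> N lam mu * c mu)"
      using c step.hyps by (simp add: branch_sum_Suc)
    show "0 < (\<Sum>mu\<in>interlacing N lam. jack_psi \<theta> N lam mu * c mu)"
      using c jack_psi_pos[OF assms(1) step.prems]
      by (intro sum_pos finite_interlacing ne mult_pos_pos) blast+
  qed
qed

text \<open>The coefficients do not depend on \<open>h\<close>, so one expansion serves both the
  powers of \<open>x\<close> and the kernels in \<open>z\<close>, and integration can act term by
  term. A free superset \<open>S\<close> lets the same index set be used for all interlacing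
  \<open>mu\<close> in the induction.\<close>

lemma branch_sum_expand:
  assumes "N \<ge> 1" "lam \<in> signatures N" "finite S" "{lam N..lam 1} \<subseteq> S"
  shows "branch_sum \<theta> N lam h = (\<Sum>n\<in>S. branch_sum \<theta> N lam (\<lambda>k. of_bool (k = n)) * h n)"
  using assms(1,2,4)
proof (induction N arbitrary: lam rule: dec_induct)
  case base
  then have "lam 1 \<in> S" by auto
  then show ?case using assms(3) by (simp add: of_bool_def if_distrib[of "\<lambda>c. c * _"] cong: if_cong)
next
  case (step N)
  have "branch_sum \<theta> (Suc N) lam h = (\<Sum>mu\<in>interlacing N lam. \<Sum>n\<in>S. of_real (jack_psi \<theta> N lam mu)
      * branch_sum \<theta> N mu (\<lambda>k. of_bool (k = n)) * h n)"
    unfolding branch_sum_Suc[OF step.hyps(1)]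
  proof (intro sum.cong refl)
    fix mu assume mu: "mu \<in> interlacing N lam"
    have "mu 1 \<le> lam 1" "lam (N + 1) \<le> mu N"
      using interlacing_bounds[OF step.prems(1) mu, of 1 1] interlacing_bounds[OF step.prems(1) mu, of N N] step.hyps
      by auto
    then have "{mu N..mu 1} \<subseteq> S" using step.prems(2) by force
    then show "of_real (jack_psi \<theta> N lam mu) * branch_sum \<theta> N mu h = (\<Sum>n\<in>S. of_real (jack_psi \<theta> N lam mu)
      * branch_sum \<theta> N mu (\<lambda>k. of_bool (k = n)) * h n)"
      using step.IH[OF interlacing_signatures[OF step.prems(1) mu]] by (simp add: sum_distrib_left mult.assoc)
  qed
  also have "\<dots> = (\<Sum>n\<in>S. branch_sum \<theta> (Suc N) lam (\<lambda>k. of_bool (k = n)) * h n)"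
    unfolding branch_sum_Suc[OF step.hyps(1)] sum_distrib_right by (rule sum.swap)
  finally show ?case .
qed

lemma branch_sum_const:
  assumes "N \<ge> 1" "\<And>i. i \<in> {1..N} \<Longrightarrow> lam i = c"
  shows "branch_sum \<theta> N lam h = h c * branch_sum \<theta> N lam (\<lambda>_. 1)"
  using assms
proof (induction N arbitrary: lam rule: dec_induct)
  case base
  then show ?case by simp
next
  case (step N)
  have "branch_sum \<theta> N mu h = h c * branch_sum \<theta> N mu (\<lambda>_. 1)" if "mu \<in> interlacing N lam" for mu
  proof (rule step.IH)
    fix i assume "i \<in> {1..N}"
    then show "mu i = c" using that step.prems[of i] step.prems[of "i + 1"] by (force simp: PiE_iff)
  qed
  then show ?case using step.hyps by (simp add: branch_sum_Suc sum_distrib_left mult_ac)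
qed

section \<open>Branching coefficients as products of Gamma functions\<close>

definition pos :: "real \<Rightarrow> (nat \<Rightarrow> int) \<Rightarrow> nat \<Rightarrow> real" where
  "pos \<theta> lam i = of_int (lam i) - \<theta> * real i"

text \<open>By the evaluation formula this is \<open>J_lam(1^N)\<close> up to a constant depending
  on \<open>\<theta>\<close> and \<open>N\<close> only. The formula is not assumed; it comes out as
  the fact \<open>one\<close> in \<open>markov_krein_irrational\<close>.\<close>

definition jack_weight :: "real \<Rightarrow> nat \<Rightarrow> (nat \<Rightarrow> int) \<Rightarrow> real" where
  "jack_weight \<theta> N lam = (\<Prod>j\<in>{1..N}. \<Prod>i\<in>{1..<j}.
     Gamma (pos \<theta> lam i - pos \<theta> lam j + \<theta>) / Gamma (pos \<theta> lam i - pos \<theta> lam j))"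

text \<open>At fixed differences \<open>l i - l j\<close> this is the product of
  \<open>jack_weight\<close> with \<open>1 - \<theta>\<close> in place of \<open>\<theta>\<close>,
  divided by the one with \<open>\<theta>\<close>. It is responsible for the passage from
  \<open>\<theta>\<close> to \<open>1 - \<theta>\<close> in the Pieri coefficients.\<close>

definition dual_weight :: "real \<Rightarrow> nat \<Rightarrow> (nat \<Rightarrow> real) \<Rightarrow> real" where
  "dual_weight \<theta> N l = (\<Prod>j\<in>{1..N}. \<Prod>i\<in>{1..<j}. Gamma (l i - l j + 1 - \<theta>) / Gamma (l i - l j + \<theta>))"

definition vandermonde :: "nat \<Rightarrow> (nat \<Rightarrow> real) \<Rightarrow> real" where
  "vandermonde N m = (\<Prod>j\<in>{1..N}. \<Prod>i\<in>{1..<j}. m i - m j)"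

text \<open>Formally both branches satisfy
  \<open>f (d + 1) / f d = (d + \<theta>) / (d + 1)\<close>; by the reflection formula their
  quotient is 1-periodic. The branch is chosen by the order that interlacing prescribes for
  \<open>l i\<close> and \<open>m a\<close>, so that the reciprocal Gamma factor vanishes where that
  order is violated for adjacent positions.\<close>

definition link_factor :: "real \<Rightarrow> nat \<Rightarrow> nat \<Rightarrow> real \<Rightarrow> real" where
  "link_factor \<theta> a i d = (if i \<le> a then Gamma (d + \<theta>) / Gamma (d + 1) else Gamma (- d) / Gamma (1 - \<theta> - d))"

definition link_weight :: "real \<Rightarrow> nat \<Rightarrow> (nat \<Rightarrow> real) \<Rightarrow> (nat \<Rightarrow> real) \<Rightarrow> real" where
  "link_weight \<theta> N l m = (\<Prod>a\<in>{1..N}. \<Prod>i\<in>{1..Suc N}. link_factor \<theta> a i (l i - m a))"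

lemma pos_diff: "i \<le> j \<Longrightarrow> pos \<theta> lam i - pos \<theta> mu j = of_int (lam i - mu j) + \<theta> * real (j - i)"
  by (simp add: pos_def of_nat_diff algebra_simps)

lemma pos_diff_ge:
  assumes "lam \<in> signatures N" "1 \<le> i" "i < j" "j \<le> N" "\<theta> > 0"
  shows "pos \<theta> lam i - pos \<theta> lam j \<ge> \<theta>"
proof -
  have "lam j \<le> lam i" using assms by (auto intro!: signaturesD[OF assms(1)])
  then have "real_of_int (lam i - lam j) \<ge> 0" by simp
  moreover have "\<theta> * 1 \<le> \<theta> * real (j - i)" using assms by (intro mult_left_mono) auto
  ultimately show ?thesis unfolding pos_diff[OF less_imp_le[OF assms(3)]] by linarith
qed

lemma jack_weight_pos:
  assumes "\<theta> > 0" "lam \<in> signatures N"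
  shows "jack_weight \<theta> N lam > 0"
  unfolding jack_weight_def
  using assms pos_diff_ge[OF assms(2)] by (intro prod_pos divide_pos_pos Gamma_real_pos) (force simp: add_pos_pos)+

lemma Gamma_real_neq_0: "x > 0 \<Longrightarrow> Gamma x \<noteq> 0" for x :: real
  using Gamma_real_pos[of x] by linarith

lemma pochhammer_Gamma_real:
  fixes z :: real
  assumes "z > 0"
  shows "pochhammer z n = Gamma (z + real n) / Gamma z"
  using assms by (intro pochhammer_Gamma) (auto elim!: nonpos_Ints_cases)

lemma prod_triangle_swap:
  "(\<Prod>a\<in>{1..N}. \<Prod>i\<in>{Suc a..Suc N}. f a i) = (\<Prod>j\<in>{1..N}. \<Prod>i\<in>{1..j}. f i (Suc j))"
  for f :: "nat \<Rightarrow> nat \<Rightarrow> 'a::comm_monoid_mult"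
proof -
  have "(\<Prod>a\<in>{1..N}. \<Prod>i\<in>{Suc a..Suc N}. f a i) = (\<Prod>a\<in>{1..N}. \<Prod>j\<in>{j\<in>{1..N}. a \<le> j}. f a (Suc j))"
  proof (rule prod.cong[OF refl])
    fix a assume "a \<in> {1..N}"
    then have "{j\<in>{1..N}. a \<le> j} = {a..N}" by auto
    then show "(\<Prod>i\<in>{Suc a..Suc N}. f a i) = (\<Prod>j\<in>{j\<in>{1..N}. a \<le> j}. f a (Suc j))"
      by (simp only: prod.shift_bounds_cl_Suc_ivl)
  qed
  also have "\<dots> = (\<Prod>j\<in>{1..N}. \<Prod>i\<in>{i\<in>{1..N}. i \<le> j}. f i (Suc j))"
    by (rule prod.swap_restrict) auto
  also have "\<dots> = (\<Prod>j\<in>{1..N}. \<Prod>i\<in>{1..j}. f i (Suc j))"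
    by (intro prod.cong refl) auto
  finally show ?thesis .
qed

lemma prod_triangle_shift:
  "(\<Prod>j\<in>{1..Suc N}. \<Prod>i\<in>{1..<j}. f i j) = (\<Prod>j\<in>{1..N}. \<Prod>i\<in>{1..j}. f i (Suc j))"
  for f :: "nat \<Rightarrow> nat \<Rightarrow> 'a::comm_monoid_mult"
proof -
  have "(\<Prod>j\<in>{1..Suc N}. \<Prod>i\<in>{1..<j}. f i j) = (\<Prod>j\<in>{0..N}. \<Prod>i\<in>{1..j}. f i (Suc j))"
    using prod.shift_bounds_cl_Suc_ivl[of "\<lambda>j. \<Prod>i\<in>{1..<j}. f i j" 0 N]
    by (simp add: atLeastLessThanSuc_atLeastAtMost)
  also have "\<dots> = (\<Prod>j\<in>{1..N}. \<Prod>i\<in>{1..j}. f i (Suc j))"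
    by (simp add: prod.atLeast_Suc_atMost)
  finally show ?thesis .
qed

text \<open>Every Pochhammer symbol is a ratio of two Gamma values, one with \<open>mu j\<close> and
  one with \<open>lam (j + 1)\<close>. Sorting them gives factors for the pairs mu-lam
  (\<open>G1\<close>), lam-mu (\<open>G2\<close>), lam-lam (\<open>G3\<close>) and mu-mu
  (\<open>G4\<close>). The power of \<open>Gamma \<theta>\<close> is the diagonal of
  \<open>G4\<close>.\<close>

lemma jack_psi_closed_form:
  assumes "\<theta> > 0" "lam \<in> signatures (Suc N)" "mu \<in> interlacing N lam"
  shows "jack_psi \<theta> N lam mu * jack_weight \<theta> N mu * Gamma \<theta> ^ N
    = jack_weight \<theta> (Suc N) lam * (dual_weight \<theta> (Suc N) (pos \<theta> lam) * vandermonde N (pos \<theta> mu)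
       * link_weight \<theta> N (pos \<theta> lam) (pos \<theta> mu))"
proof -
  note mu_sig = interlacing_signatures[OF assms(2,3)]
  let ?l = "pos \<theta> lam" and ?m = "pos \<theta> mu"
  define G1 where "G1 i j = Gamma (?m i - ?l j) / Gamma (?m i - ?l j + 1 - \<theta>)" for i j
  define G2 where "G2 i j = Gamma (?l i - ?m j + \<theta>) / Gamma (?l i - ?m j + 1)" for i j
  define G3 where "G3 i j = Gamma (?l i - ?l j + 1 - \<theta>) / Gamma (?l i - ?l j)" for i j
  define G4 where "G4 i j = Gamma (?m i - ?m j + 1) / Gamma (?m i - ?m j + \<theta>)" for i j
  let ?T = "\<lambda>G. \<Prod>j\<in>{1..N}. \<Prod>i\<in>{1..j}. G i j"
  let ?T' = "\<lambda>G. \<Prod>j\<in>{1..N}. \<Prod>i\<in>{1..j}. G i (Suc j)"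
  have psi: "jack_psi \<theta> N lam mu = ?T' G1 * ?T G2 * ?T' G3 * ?T G4"
    unfolding jack_psi_def prod.distrib[symmetric]
  proof (intro prod.cong refl)
    fix i j assume "j \<in> {1..N}" "i \<in> {1..j}"
    then have ij: "1 \<le> i" "i \<le> j" "j \<le> N" by auto
    note b = interlacing_bounds[OF assms(2,3) ij]
    let ?k = "nat (mu j - lam (j + 1))"
    have k: "real ?k = of_int (mu j) - of_int (lam (j + 1))" using b by simp
    \<comment> \<open>The index step from \<open>j\<close> to \<open>Suc j\<close> contributes the
      extra \<open>\<theta>\<close>. Raising an argument by \<open>?k\<close> thus replaces
      \<open>- ?m j\<close> by \<open>- ?l (Suc j) - \<theta>\<close>, which is the origin of the
      shifts \<open>1 - \<theta>\<close>.\<close>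
    have s: "?m j - ?l (Suc j) = real ?k + \<theta>" unfolding k by (simp add: pos_def algebra_simps)
    have p: "?m i - ?m j \<ge> 0" "?l i - ?m j \<ge> 0"
      using b assms(1) ij by (simp_all add: pos_diff)
    have "pochhammer (?m i - ?m j + \<theta>) ?k = Gamma (?m i - ?l (Suc j)) / Gamma (?m i - ?m j + \<theta>)"
      using p assms(1) s by (subst pochhammer_Gamma_real) (auto simp: algebra_simps)
    moreover have "pochhammer (?m i - ?m j + 1) ?k = Gamma (?m i - ?l (Suc j) + 1 - \<theta>) / Gamma (?m i - ?m j + 1)"
      using p assms(1) s by (subst pochhammer_Gamma_real) (auto simp: algebra_simps)
    moreover have "pochhammer (?l i - ?m j + 1) ?k = Gamma (?l i - ?l (Suc j) + 1 - \<theta>) / Gamma (?l i - ?m j + 1)"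
      using p assms(1) s by (subst pochhammer_Gamma_real) (auto simp: algebra_simps)
    moreover have "pochhammer (?l i - ?m j + \<theta>) ?k = Gamma (?l i - ?l (Suc j)) / Gamma (?l i - ?m j + \<theta>)"
      using p assms(1) s by (subst pochhammer_Gamma_real) (auto simp: algebra_simps)
    ultimately show "pochhammer (of_int (mu i - mu j) + \<theta> * real (j - i) + \<theta>) ?k
      / pochhammer (of_int (mu i - mu j) + \<theta> * real (j - i) + 1) ?k
      * (pochhammer (of_int (lam i - mu j) + \<theta> * real (j - i) + 1) ?k
      / pochhammer (of_int (lam i - mu j) + \<theta> * real (j - i) + \<theta>) ?k)
      = G1 i (Suc j) * G2 i j * G3 i (Suc j) * G4 i j"
      unfolding pos_diff[OF ij(2), symmetric] G1_def G2_def G3_def G4_def by (simp add: mult_ac)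
  qed
  have d: "?T G4 * jack_weight \<theta> N mu * Gamma \<theta> ^ N = vandermonde N ?m"
  proof -
    have "(\<Prod>i\<in>{1..j}. G4 i j) * (\<Prod>i\<in>{1..<j}. Gamma (?m i - ?m j + \<theta>) / Gamma (?m i - ?m j)) * Gamma \<theta>
       = (\<Prod>i\<in>{1..<j}. ?m i - ?m j)" if j: "j \<in> {1..N}" for j
    proof -
      have "{1..j} = insert j {1..<j}" using j by auto
      then have "(\<Prod>i\<in>{1..j}. G4 i j) = G4 j j * (\<Prod>i\<in>{1..<j}. G4 i j)" by simp
      moreover have "G4 j j * Gamma \<theta> = 1" using Gamma_real_neq_0[OF assms(1)] by (simp add: G4_def)
      moreover have "(\<Prod>i\<in>{1..<j}. G4 i j) * (\<Prod>i\<in>{1..<j}. Gamma (?m i - ?m j + \<theta>) / Gamma (?m i - ?m j))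
        = (\<Prod>i\<in>{1..<j}. ?m i - ?m j)"
        unfolding prod.distrib[symmetric]
      proof (intro prod.cong refl)
        fix i assume "i \<in> {1..<j}"
        then have d: "?m i - ?m j > 0" using pos_diff_ge[OF mu_sig, of i j \<theta>] j assms(1) by auto
        then have "Gamma (?m i - ?m j + 1) = (?m i - ?m j) * Gamma (?m i - ?m j)"
          by (intro Gamma_plus1) (auto elim!: nonpos_Ints_cases)
        then show "G4 i j * (Gamma (?m i - ?m j + \<theta>) / Gamma (?m i - ?m j)) = ?m i - ?m j"
          using Gamma_real_neq_0[OF d] Gamma_real_neq_0[of "?m i - ?m j + \<theta>"] d assms(1)
          by (simp add: G4_def)
      qed
      ultimately show ?thesis by (metis (no_types, lifting) mult.commute mult.left_commute mult_1)
    qed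
    then have "(\<Prod>j\<in>{1..N}. (\<Prod>i\<in>{1..j}. G4 i j) * (\<Prod>i\<in>{1..<j}. Gamma (?m i - ?m j + \<theta>) / Gamma (?m i - ?m j)) * Gamma \<theta>)
      = vandermonde N ?m" unfolding vandermonde_def by (intro prod.cong refl) auto
    then show ?thesis unfolding jack_weight_def by (simp add: prod.distrib)
  qed
  have c: "jack_weight \<theta> (Suc N) lam * dual_weight \<theta> (Suc N) ?l = ?T' G3"
    unfolding jack_weight_def dual_weight_def prod_triangle_shift prod.distrib[symmetric]
  proof (intro prod.cong refl)
    fix i j assume "j \<in> {1..N}" "i \<in> {1..j}"
    then have "?l i - ?l (Suc j) > 0" using pos_diff_ge[OF assms(2), of i "Suc j" \<theta>] assms(1) by auto
    then have "Gamma (?l i - ?l (Suc j) + \<theta>) \<noteq> 0" using assms(1) by (intro Gamma_real_neq_0) simp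
    then show "Gamma (?l i - ?l (Suc j) + \<theta>) / Gamma (?l i - ?l (Suc j)) *
      (Gamma (?l i - ?l (Suc j) + 1 - \<theta>) / Gamma (?l i - ?l (Suc j) + \<theta>)) = G3 i (Suc j)"
      by (simp add: G3_def)
  qed
  have w: "link_weight \<theta> N ?l ?m = ?T' G1 * ?T G2"
  proof -
    have "(\<Prod>i\<in>{1..Suc N}. link_factor \<theta> a i (?l i - ?m a)) = (\<Prod>i\<in>{1..a}. G2 i a) * (\<Prod>i\<in>{Suc a..Suc N}. G1 a i)"
      if "a \<in> {1..N}" for a
    proof -
      have "{1..Suc N} = {1..a} \<union> {Suc a..Suc N}" using that by auto
      then have "(\<Prod>i\<in>{1..Suc N}. link_factor \<theta> a i (?l i - ?m a))
        = (\<Prod>i\<in>{1..a}. link_factor \<theta> a i (?l i - ?m a)) * (\<Prod>i\<in>{Suc a..Suc N}. link_factor \<theta> a i (?l i - ?m a))"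
        by (simp add: prod.union_disjoint)
      then show ?thesis by (simp add: link_factor_def G1_def G2_def algebra_simps)
    qed
    then have "link_weight \<theta> N ?l ?m = (\<Prod>a\<in>{1..N}. (\<Prod>i\<in>{1..a}. G2 i a) * (\<Prod>i\<in>{Suc a..Suc N}. G1 a i))"
      unfolding link_weight_def by (intro prod.cong refl) auto
    then show ?thesis unfolding prod.distrib prod_triangle_swap[of G1] by (simp only: mult.commute)
  qed
  show ?thesis unfolding psi w c[symmetric] d[symmetric] by (simp only: mult_ac)
qed

section \<open>Pieri rules\<close>

lemma pos_notin_nonpos_Ints: "x > 0 \<Longrightarrow> x \<notin> \<int>\<^sub>\<le>\<^sub>0" for x :: real
  by (auto elim!: nonpos_Ints_cases)

lemma prod_pairs:
  fixes g :: "nat \<Rightarrow> nat \<Rightarrow> 'a::comm_monoid_mult"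
  assumes "\<And>i. g i i = 1"
  shows "(\<Prod>i\<in>{1..N}. \<Prod>j\<in>{1..N}. g i j) = (\<Prod>j\<in>{1..N}. \<Prod>i\<in>{1..<j}. g i j * g j i)"
proof (induction N)
  case (Suc N)
  have "{1..<Suc N} = {1..N}" by auto
  then show ?case using Suc by (simp add: prod.distrib assms mult_ac)
qed simp

text \<open>The weights are products over pairs \<open>i < j\<close>; in this form a Pieri
  coefficient can be compared with them pair by pair.\<close>

lemma prod_cut_pairs:
  fixes R :: "nat \<Rightarrow> nat \<Rightarrow> 'a::comm_monoid_mult"
  assumes "I \<subseteq> {1..N}"
  shows "(\<Prod>i\<in>I. \<Prod>j\<in>{1..N} - I. R i j) = (\<Prod>j\<in>{1..N}. \<Prod>i\<in>{1..<j}.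
           if i \<in> I \<and> j \<notin> I then R i j else if j \<in> I \<and> i \<notin> I then R j i else 1)"
proof -
  let ?g = "\<lambda>i j. if i \<in> I \<and> j \<notin> I then R i j else 1"
  have "(\<Prod>i\<in>I. \<Prod>j\<in>{1..N} - I. R i j) = (\<Prod>i\<in>{1..N}. if i \<in> I then \<Prod>j\<in>{1..N} - I. R i j else 1)"
    using assms by (simp add: prod.If_cases Int_absorb1)
  also have "\<dots> = (\<Prod>i\<in>{1..N}. \<Prod>j\<in>{1..N}. ?g i j)"
    by (intro prod.cong refl) (auto simp: prod.If_cases Diff_eq Compl_eq)
  also have "\<dots> = (\<Prod>j\<in>{1..N}. \<Prod>i\<in>{1..<j}. ?g i j * ?g j i)"
    by (rule prod_pairs) simp
  also have "\<dots> = (\<Prod>j\<in>{1..N}. \<Prod>i\<in>{1..<j}.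
           if i \<in> I \<and> j \<notin> I then R i j else if j \<in> I \<and> i \<notin> I then R j i else 1)"
    by (intro prod.cong refl) auto
  finally show ?thesis .
qed

definition bump :: "(nat \<Rightarrow> int) \<Rightarrow> nat set \<Rightarrow> nat \<Rightarrow> int" where
  "bump lam I = (\<lambda>i. lam i + of_bool (i \<in> I))"

definition lower :: "(nat \<Rightarrow> int) \<Rightarrow> nat set \<Rightarrow> nat \<Rightarrow> int" where
  "lower lam I = (\<lambda>i. lam i - of_bool (i \<in> I))"

lemma lower_bump [simp]: "lower (bump lam I) I = lam" and bump_lower [simp]: "bump (lower lam I) I = lam"
  by (simp_all add: bump_def lower_def)

lemma pos_bump: "pos \<theta> (bump lam I) i = pos \<theta> lam i + of_bool (i \<in> I)"
  and pos_lower: "pos \<theta> (lower lam I) i = pos \<theta> lam i - of_bool (i \<in> I)"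
  by (simp_all add: pos_def bump_def lower_def)

definition pieri_coeff :: "real \<Rightarrow> nat \<Rightarrow> (nat \<Rightarrow> int) \<Rightarrow> nat set \<Rightarrow> real" where
  "pieri_coeff \<theta> N lam I = (\<Prod>i\<in>I. \<Prod>j\<in>{1..N} - I. 1 + \<theta> / (pos \<theta> lam i - pos \<theta> lam j))"

lemma bump_not_signature:
  assumes "lam \<in> signatures N" "I \<subseteq> {1..N}" "bump lam I \<notin> signatures N"
  obtains k where "1 \<le> k" "k < N" "k \<notin> I" "Suc k \<in> I" "lam k = lam (Suc k)"
proof -
  have "bump lam I \<in> extensional {1..N}"
    using assms(1,2) by (auto simp: bump_def signatures_def PiE_iff extensional_def)
  with assms(3) obtain i j where ij: "1 \<le> i" "j \<le> N" "i \<le> j" "bump lam I j > bump lam I i"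
    by (force simp: signatures_def PiE_iff)
  have le: "lam j' \<le> lam i'" if "1 \<le> i'" "i' \<le> j'" "j' \<le> N" for i' j'
    using that by (auto intro!: signaturesD[OF assms(1)])
  have eq: "lam i = lam j" "i \<notin> I" "j \<in> I"
    using ij(4) le[of i j] ij by (cases "i \<in> I"; cases "j \<in> I"; simp add: bump_def)+
  \<comment> \<open>By monotonicity \<open>lam\<close> is constant from \<open>i\<close> to
    \<open>j\<close>, and membership in \<open>I\<close> must switch from false to true somewhere in
    between.\<close>
  have "\<exists>k\<ge>i. k < j \<and> k \<notin> I \<and> Suc k \<in> I"
  proof (rule ccontr)
    assume *: "\<not> ?thesis"
    have "k \<le> j \<longrightarrow> k \<notin> I" if "i \<le> k" for k
      using that
    proof (induction k rule: dec_induct)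
      case base
      then show ?case using eq by simp
    next
      case (step n)
      then show ?case using * by (metis Suc_leD Suc_le_lessD)
    qed
    then show False using ij eq by auto
  qed
  then obtain k where k: "i \<le> k" "k < j" "k \<notin> I" "Suc k \<in> I" by blast
  have "lam k = lam (Suc k)"
    using le[of i k] le[of k "Suc k"] le[of "Suc k" j] k ij eq by auto
  then show thesis using that[of k] k ij by auto
qed

text \<open>Equal neighbouring entries sit at distance exactly \<open>\<theta>\<close>, which
  produces a factor \<open>1 - 1\<close>. This allows sums over all subsets \<open>I\<close> instead
  of only those that keep \<open>lam\<close> decreasing.\<close>

lemma pieri_coeff_eq_0:
  assumes "\<theta> > 0" "lam \<in> signatures N" "I \<subseteq> {1..N}" "bump lam I \<notin> signatures N"
  shows "pieri_coeff \<theta> N lam I = 0"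
proof -
  obtain k where k: "1 \<le> k" "k < N" "k \<notin> I" "Suc k \<in> I" "lam k = lam (Suc k)"
    using bump_not_signature[OF assms(2-4)] .
  have "pos \<theta> lam (Suc k) - pos \<theta> lam k = - \<theta>" using k by (simp add: pos_def algebra_simps)
  then have "1 + \<theta> / (pos \<theta> lam (Suc k) - pos \<theta> lam k) = 0" using assms(1) by simp
  moreover have "k \<in> {1..N} - I" "finite I" using k assms(3) finite_subset by auto
  ultimately show ?thesis unfolding pieri_coeff_def using k(4)
    by (intro prod_zero[of I] bexI[of _ "Suc k"] prod_zero[of "{1..N} - I"] bexI[of _ k]) auto
qed

text \<open>Moving one of two points by a unit changes the Gamma ratio by a rational factor that
  exchanges the numerators \<open>\<theta>\<close> and \<open>1 - \<theta>\<close>. After this the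
  upper level carries the coefficients of \<open>kn_left\<close> with
  \<open>\<phi> = 1 - \<theta>\<close>.\<close>

lemma dual_weight_bump:
  assumes "\<theta> > 0" "lam \<in> signatures N" "I \<subseteq> {1..N}" "bump lam I \<in> signatures N"
  shows "pieri_coeff \<theta> N lam I * dual_weight \<theta> N (pos \<theta> (bump lam I))
    = dual_weight \<theta> N (pos \<theta> lam)
      * (\<Prod>i\<in>I. \<Prod>j\<in>{1..N} - I. 1 + (1 - \<theta>) / (pos \<theta> lam i - pos \<theta> lam j))"
  unfolding pieri_coeff_def dual_weight_def prod_cut_pairs[OF assms(3)] prod.distrib[symmetric]
proof (intro prod.cong refl)
  fix i j assume "j \<in> {1..N}" "i \<in> {1..<j}"
  then have ij: "1 \<le> i" "i < j" "j \<le> N" by auto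
  define d where "d = pos \<theta> lam i - pos \<theta> lam j"
  have d: "d \<ge> \<theta>" unfolding d_def by (rule pos_diff_ge[OF assms(2) ij assms(1)])
  have d': "pos \<theta> lam j - pos \<theta> lam i = - d" by (simp add: d_def)
  have G: "Gamma (z + 1) = z * Gamma z" "Gamma z \<noteq> 0" if "z > 0" for z :: real
    using that by (auto intro!: Gamma_plus1 Gamma_real_neq_0 elim!: nonpos_Ints_cases)
  show "(if i \<in> I \<and> j \<notin> I then 1 + \<theta> / (pos \<theta> lam i - pos \<theta> lam j)
         else if j \<in> I \<and> i \<notin> I then 1 + \<theta> / (pos \<theta> lam j - pos \<theta> lam i) else 1) *
    (Gamma (pos \<theta> (bump lam I) i - pos \<theta> (bump lam I) j + 1 - \<theta>) / Gamma (pos \<theta> (bump lam I) i - pos \<theta> (bump lam I) j + \<theta>)) =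
    Gamma (pos \<theta> lam i - pos \<theta> lam j + 1 - \<theta>) / Gamma (pos \<theta> lam i - pos \<theta> lam j + \<theta>) *
    (if i \<in> I \<and> j \<notin> I then 1 + (1 - \<theta>) / (pos \<theta> lam i - pos \<theta> lam j)
     else if j \<in> I \<and> i \<notin> I then 1 + (1 - \<theta>) / (pos \<theta> lam j - pos \<theta> lam i) else 1)"
  proof (cases "i \<in> I \<longleftrightarrow> j \<in> I")
    case True
    then have "pos \<theta> (bump lam I) i - pos \<theta> (bump lam I) j = d" by (simp add: pos_bump d_def)
    then show ?thesis using True by (auto simp: d_def)
  next
    case False
    show ?thesis
    proof (cases "i \<in> I")
      case True
      then have e: "pos \<theta> (bump lam I) i - pos \<theta> (bump lam I) j = d + 1"
        using False by (simp add: pos_bump d_def)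
      have "Gamma (d + 1 + 1 - \<theta>) = (d + 1 - \<theta>) * Gamma (d + 1 - \<theta>)"
        "Gamma (d + 1 + \<theta>) = (d + \<theta>) * Gamma (d + \<theta>)" "Gamma (d + \<theta>) \<noteq> 0"
        using G[of "d + 1 - \<theta>"] G[of "d + \<theta>"] d assms(1) by (simp_all add: algebra_simps)
      then show ?thesis unfolding e d_def[symmetric] d' using True False d assms(1)
        by (simp add: divide_simps)
    next
      case i: False
      then have e: "pos \<theta> (bump lam I) i - pos \<theta> (bump lam I) j = d - 1"
        using False by (simp add: pos_bump d_def)
      \<comment> \<open>The difference shrinks by 1 here; that \<open>bump lam I\<close> is still a
        signature keeps the Gamma arguments positive.\<close>
      have "d - 1 \<ge> \<theta>" using pos_diff_ge[OF assms(4) ij assms(1)] unfolding e .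
      then have "Gamma (d + 1 - \<theta>) = (d - \<theta>) * Gamma (d - \<theta>)"
        "Gamma (d + \<theta>) = (d - 1 + \<theta>) * Gamma (d - 1 + \<theta>)" "Gamma (d - 1 + \<theta>) \<noteq> 0" "d - 1 + \<theta> \<noteq> 0"
        using G[of "d - \<theta>"] G[of "d - 1 + \<theta>"] assms(1) by (simp_all add: algebra_simps)
      then show ?thesis unfolding e d_def[symmetric] d' using i False d assms(1)
        by (simp add: divide_simps)
    qed
  qed
qed

text \<open>This is the counterpart of \<open>dual_weight_bump\<close> on the lower level. The
  coefficient is taken at the lowered positions \<open>m\<close> but expressed through
  \<open>n\<close>, which yields the minus sign found in \<open>kn_right\<close>.\<close>

lemma vandermonde_lower:
  fixes n :: "nat \<Rightarrow> real"
  assumes "J \<subseteq> {1..N}" "\<And>i j. i \<noteq> j \<Longrightarrow> n i - n j \<notin> \<int>"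
    and m: "\<And>i. m i = n i - of_bool (i \<in> J)"
  shows "(\<Prod>a\<in>J. \<Prod>b\<in>{1..N} - J. 1 + \<theta> / (m a - m b)) * vandermonde N m
    = vandermonde N n * (\<Prod>a\<in>J. \<Prod>b\<in>{1..N} - J. 1 - (1 - \<theta>) / (n a - n b))"
  unfolding vandermonde_def prod_cut_pairs[OF assms(1)] prod.distrib[symmetric]
proof (intro prod.cong refl)
  fix i j assume "j \<in> {1..N}" "i \<in> {1..<j}"
  then have "n i - n j \<notin> \<int>" "n j - n i \<notin> \<int>" using assms(2) by auto
  then have "n i - n j \<noteq> 0" "n i - n j - 1 \<noteq> 0" "n j - n i \<noteq> 0" "n j - n i - 1 \<noteq> 0"
    by (metis Ints_0, metis Ints_1 right_minus_eq, metis Ints_0, metis Ints_1 right_minus_eq)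
  then show "(if i \<in> J \<and> j \<notin> J then 1 + \<theta> / (m i - m j) else if j \<in> J \<and> i \<notin> J then 1 + \<theta> / (m j - m i) else 1)
     * (m i - m j) = (n i - n j) * (if i \<in> J \<and> j \<notin> J then 1 - (1 - \<theta>) / (n i - n j)
       else if j \<in> J \<and> i \<notin> J then 1 - (1 - \<theta>) / (n j - n i) else 1)"
    unfolding m by (auto simp: divide_simps) (simp add: algebra_simps)
qed

section \<open>The intertwining relation between adjacent levels\<close>

lemma irrational_notin_Ints:
  assumes "\<theta> \<notin> \<rat>" "k \<noteq> 0"
  shows "of_int a + \<theta> * of_int k \<notin> (\<int> :: real set)"
proof
  assume "of_int a + \<theta> * of_int k \<in> \<int>"
  then obtain b where "of_int a + \<theta> * of_int k = of_int b" by (blast elim: Ints_cases)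
  then have "\<theta> = of_int (b - a) / of_int k" using assms(2) by (simp add: field_simps)
  then show False using assms(1) by auto
qed

lemma pos_diff_notin_Ints:
  assumes "\<theta> \<notin> \<rat>" "i \<noteq> j"
  shows "pos \<theta> lam i - pos \<theta> mu j \<notin> \<int>"
  using irrational_notin_Ints[OF assms(1), of "int j - int i" "lam i - mu j"] assms(2)
  by (simp add: pos_def algebra_simps)

lemma inj_pos: "\<theta> \<notin> \<rat> \<Longrightarrow> inj (pos \<theta> lam)"
  using pos_diff_notin_Ints[of \<theta> _ _ lam lam] by (metis Ints_0 diff_self injI)

text \<open>For irrational \<open>\<theta>\<close> no Gamma function below meets a pole, except in the factors that force
  interlacing. \<open>link_base\<close> is chosen so that a unit shift only changes a polynomial factor, also
  across the boundary of interlacing.\<close>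

definition link_base :: "real \<Rightarrow> nat \<Rightarrow> nat \<Rightarrow> real \<Rightarrow> real" where
  "link_base \<theta> a i d = (if i \<le> a then Gamma (d + \<theta>) / Gamma (d + 1 + 1) else - Gamma (- d - 1) / Gamma (1 - \<theta> - d))"

lemma link_factor_base:
  assumes "\<theta> > 0" "\<theta> \<notin> \<rat>" "d = pos \<theta> lam i - pos \<theta> nu a"
    and "i \<le> a \<Longrightarrow> nu a \<le> lam i + 1" "a < i \<Longrightarrow> lam i \<le> nu a"
  shows "link_factor \<theta> a i (d + of_bool s) = link_base \<theta> a i d * (d + 1 - (if s then 1 - \<theta> else 0))"
proof (cases "i \<le> a")
  case True
  have d: "d = of_int (lam i - nu a) + \<theta> * real (a - i)" using assms(3) pos_diff[OF True] by simp
  have "0 \<le> \<theta> * real (a - i)" using assms(1) by simp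
  then have d1: "d + 1 \<ge> 0" using assms(4)[OF True] unfolding d by linarith
  have "d + \<theta> = of_int (lam i - nu a) + \<theta> * of_int (int (a - i) + 1)" unfolding d by (simp add: algebra_simps)
  then have "d + \<theta> \<notin> \<int>" using irrational_notin_Ints[OF assms(2), of "int (a - i) + 1"] by simp
  then have "Gamma (d + \<theta> + 1) = (d + \<theta>) * Gamma (d + \<theta>)"
    by (intro Gamma_plus1) (use nonpos_Ints_Int in blast)
  then have A: "Gamma (d + 1 + \<theta>) / Gamma (d + 1 + 1) = Gamma (d + \<theta>) / Gamma (d + 1 + 1) * (d + \<theta>)"
    by (simp add: ac_simps)
  \<comment> \<open>One unit beyond interlacing, for \<open>i = a\<close> and
    \<open>nu a = lam i + 1\<close>, one has \<open>d + 1 = 0\<close>. The left side is then 0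
    because \<open>Gamma 0 = 0\<close> and division by 0 gives 0, the right side because of its
    polynomial factor.\<close>
  have B: "Gamma (d + \<theta>) / Gamma (d + 1) = Gamma (d + \<theta>) / Gamma (d + 1 + 1) * (d + 1)"
  proof (cases "d + 1 = 0")
    case False
    then have "d + 1 > 0" using d1 by linarith
    then have "Gamma (d + 1 + 1) = (d + 1) * Gamma (d + 1)"
      by (intro Gamma_plus1 pos_notin_nonpos_Ints)
    then show ?thesis using False by simp
  qed simp
  have "d + 1 - (1 - \<theta>) = d + \<theta>" by simp
  then show ?thesis using True A B
    by (cases s) (simp_all only: link_factor_def link_base_def if_True if_False of_bool_eq add_0_right diff_zero)
next
  case False
  then have a: "a < i" by simp
  have e: "- d = of_int (nu a - lam i) + \<theta> * real (i - a)"
    using assms(3) pos_diff[OF less_imp_le[OF a]] by (metis minus_diff_eq)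
  have "\<theta> * 1 \<le> \<theta> * real (i - a)" using assms(1) a by (intro mult_left_mono) auto
  then have e1: "- d - \<theta> \<ge> 0" using assms(5)[OF a] unfolding e by linarith
  have "- d - 1 = of_int (nu a - lam i - 1) + \<theta> * of_int (int (i - a))" unfolding e by simp
  then have "- d - 1 \<notin> \<int>" using irrational_notin_Ints[OF assms(2), of "int (i - a)"] a by simp
  then have "- d - 1 \<notin> \<int>\<^sub>\<le>\<^sub>0" using nonpos_Ints_Int by blast
  then have "Gamma (- d) = (- d - 1) * Gamma (- d - 1)" using Gamma_plus1[of "- d - 1"] by simp
  then have e: "Gamma (- d) = - Gamma (- d - 1) * (d + 1)" by (simp add: algebra_simps)
  have A: "Gamma (- d) / Gamma (1 - \<theta> - d) = - Gamma (- d - 1) / Gamma (1 - \<theta> - d) * (d + 1)"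
    unfolding e by simp
  \<comment> \<open>The boundary case is now \<open>i = Suc a\<close> with
    \<open>nu a = lam i\<close>, where \<open>d + \<theta> = 0\<close>.\<close>
  have B: "Gamma (- d - 1) / Gamma (- d - \<theta>) = - Gamma (- d - 1) / Gamma (1 - \<theta> - d) * (d + \<theta>)"
  proof (cases "- d - \<theta> = 0")
    case True
    then have "d + \<theta> = 0" by simp
    then show ?thesis using True by (simp only: Gamma_0 div_by_0 mult_zero_right)
  next
    case False
    then have "- d - \<theta> > 0" using e1 by linarith
    then have "Gamma (- d - \<theta> + 1) = (- d - \<theta>) * Gamma (- d - \<theta>)"
      by (intro Gamma_plus1 pos_notin_nonpos_Ints)
    moreover have "- d - \<theta> + 1 = 1 - \<theta> - d" by simp
    ultimately have G: "Gamma (1 - \<theta> - d) = (- d - \<theta>) * Gamma (- d - \<theta>)" by simp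
    have "- p / (u * q) * (- u) = p / q" if "u \<noteq> 0" for p q u :: real using that by simp
    from this[OF False, of "Gamma (- d - 1)" "Gamma (- d - \<theta>)"] show ?thesis
      unfolding G by (simp add: add.commute)
  qed
  have "d + 1 - (1 - \<theta>) = d + \<theta>" "- (d + 1) = - d - 1" "1 - \<theta> - (d + 1) = - d - \<theta>" by simp_all
  then show ?thesis using False A B
    by (cases s) (simp_all only: link_factor_def link_base_def if_True if_False of_bool_eq add_0_right diff_zero)
qed

text \<open>Up to the constant \<open>Gamma \<theta> ^ N\<close>, this is the branching coefficient conjugated by
  \<open>jack_weight\<close>. It vanishes by itself unless \<open>mu\<close> interlaces with \<open>lam\<close>, because \<open>Gamma\<close> is
  0 at its poles and division by 0 gives 0.\<close>

definition link :: "real \<Rightarrow> nat \<Rightarrow> (nat \<Rightarrow> int) \<Rightarrow> (nat \<Rightarrow> int) \<Rightarrow> real" where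
  "link \<theta> N lam mu = dual_weight \<theta> (Suc N) (pos \<theta> lam) * vandermonde N (pos \<theta> mu)
       * link_weight \<theta> N (pos \<theta> lam) (pos \<theta> mu)"

text \<open>After the common factor \<open>K\<close> is removed, this is the cleared identity with
  \<open>\<phi> = 1 - \<theta>\<close>, the points \<open>pos \<theta> lam i\<close> and the points
  \<open>pos \<theta> nu a - 1\<close>. The single factor \<open>1 + t\<close> reflects that the
  levels differ by one point. The range of \<open>nu\<close> includes vectors that interlace with
  some \<open>bump lam I\<close> but not with \<open>lam\<close>.\<close>

lemma link_intertwines:
  assumes "\<theta> > 0" "\<theta> \<notin> \<rat>" "lam \<in> signatures (Suc N)"
    and nu: "\<And>a. a \<in> {1..N} \<Longrightarrow> nu a \<in> {lam (a + 1)..lam a + 1}"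
  shows "(\<Sum>I\<in>Pow {1..Suc N}. t ^ card I * (pieri_coeff \<theta> (Suc N) lam I * link \<theta> N (bump lam I) nu))
    = (1 + t) * (\<Sum>J\<in>Pow {1..N}. t ^ card J * (pieri_coeff \<theta> N (lower nu J) J * link \<theta> N lam (lower nu J)))"
proof -
  let ?l = "pos \<theta> lam" and ?n = "pos \<theta> nu" and ?A = "{1..Suc N}" and ?B = "{1..N}"
  let ?\<phi> = "1 - \<theta>"
  let ?L = "\<lambda>I. \<Prod>b\<in>?B. \<Prod>i\<in>?A. ?l i - (?n b - 1) - (if i \<in> I then ?\<phi> else 0)"
  let ?R = "\<lambda>J. \<Prod>b\<in>?B. \<Prod>i\<in>?A. ?l i - (?n b - 1) - (if b \<in> J then ?\<phi> else 0)"
  define c where "c = (\<Prod>a\<in>?B. \<Prod>i\<in>?A. link_base \<theta> a i (?l i - ?n a))"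
  define K where "K = dual_weight \<theta> (Suc N) ?l * vandermonde N ?n * c"
  have base: "link_factor \<theta> a i (?l i - ?n a + of_bool s)
      = link_base \<theta> a i (?l i - ?n a) * (?l i - (?n a - 1) - (if s then ?\<phi> else 0))"
    if ai: "a \<in> ?B" "i \<in> ?A" for a i s
  proof -
    have n: "lam (a + 1) \<le> nu a" "nu a \<le> lam a + 1" using nu[OF ai(1)] by auto
    have "nu a \<le> lam i + 1" if "i \<le> a"
      using n signaturesD[OF assms(3) ai(2), of a] ai that by auto
    moreover have "lam i \<le> nu a" if "a < i"
      using n signaturesD[OF assms(3) _ ai(2), of "a + 1"] ai that by auto
    ultimately show ?thesis using link_factor_base[OF assms(1,2) refl, where s = s]
      by (simp add: algebra_simps)
  qed
  have W1: "link_weight \<theta> N (pos \<theta> (bump lam I)) ?n = c * ?L I" for I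
    unfolding link_weight_def c_def prod.distrib[symmetric]
  proof (intro prod.cong refl)
    fix a i assume "a \<in> ?B" "i \<in> ?A"
    from base[OF this, of "i \<in> I"] show "link_factor \<theta> a i (pos \<theta> (bump lam I) i - ?n a)
      = link_base \<theta> a i (?l i - ?n a) * (?l i - (?n a - 1) - (if i \<in> I then ?\<phi> else 0))"
      by (simp add: pos_bump algebra_simps)
  qed
  have W2: "link_weight \<theta> N ?l (pos \<theta> (lower nu J)) = c * ?R J" for J
    unfolding link_weight_def c_def prod.distrib[symmetric]
  proof (intro prod.cong refl)
    fix a i assume "a \<in> ?B" "i \<in> ?A"
    from base[OF this, of "a \<in> J"] show "link_factor \<theta> a i (?l i - pos \<theta> (lower nu J) a)
      = link_base \<theta> a i (?l i - ?n a) * (?l i - (?n a - 1) - (if a \<in> J then ?\<phi> else 0))"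
      by (simp add: pos_lower algebra_simps)
  qed
  have T1: "pieri_coeff \<theta> (Suc N) lam I * link \<theta> N (bump lam I) nu
      = K * ((\<Prod>i\<in>I. \<Prod>j\<in>?A - I. 1 + ?\<phi> / (?l i - ?l j)) * ?L I)" if I: "I \<in> Pow ?A" for I
  proof (cases "bump lam I \<in> signatures (Suc N)")
    case True
    then show ?thesis using dual_weight_bump[OF assms(1,3) _ True] I
      unfolding link_def W1 K_def by (simp only: Pow_iff mult.assoc[symmetric]) (simp add: mult_ac)
  next
    case False
    \<comment> \<open>Outside the signatures both sides vanish separately. Equal entries
      \<open>lam k = lam (Suc k)\<close> leave only two values for \<open>nu k\<close>: the larger
      one makes the factor at \<open>i = k\<close> zero, the smaller one the factor at
      \<open>i = Suc k\<close>.\<close>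
    obtain k where k: "1 \<le> k" "k < Suc N" "k \<notin> I" "Suc k \<in> I" "lam k = lam (Suc k)"
      using bump_not_signature[OF assms(3) _ False] I by auto
    then have "nu k = lam k + 1 \<or> nu k = lam k" using nu[of k] by auto
    then have "\<exists>i\<in>?A. ?l i - (?n k - 1) - (if i \<in> I then ?\<phi> else 0) = 0"
    proof
      assume "nu k = lam k + 1"
      then show ?thesis using k by (intro bexI[of _ k]) (auto simp: pos_def)
    next
      assume "nu k = lam k"
      then show ?thesis using k by (intro bexI[of _ "Suc k"]) (auto simp: pos_def algebra_simps)
    qed
    then have z: "(\<Prod>i\<in>?A. ?l i - (?n k - 1) - (if i \<in> I then ?\<phi> else 0)) = 0"
      by (intro prod_zero) auto
    have "\<exists>b\<in>?B. (\<Prod>i\<in>?A. ?l i - (?n b - 1) - (if i \<in> I then ?\<phi> else 0)) = 0"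
    proof (rule bexI)
      show "k \<in> ?B" using k by simp
    qed (rule z)
    then have "?L I = 0" by (intro prod_zero) simp_all
    moreover have "pieri_coeff \<theta> (Suc N) lam I = 0"
      using pieri_coeff_eq_0[OF assms(1,3) _ False] I by auto
    ultimately show ?thesis by (simp only: mult_zero_left mult_zero_right)
  qed
  have T2: "pieri_coeff \<theta> N (lower nu J) J * link \<theta> N lam (lower nu J)
      = K * ((\<Prod>a\<in>J. \<Prod>b\<in>?B - J. 1 - ?\<phi> / (?n a - 1 - (?n b - 1))) * ?R J)" if J: "J \<in> Pow ?B" for J
  proof -
    have "pieri_coeff \<theta> N (lower nu J) J * vandermonde N (pos \<theta> (lower nu J))
      = vandermonde N ?n * (\<Prod>a\<in>J. \<Prod>b\<in>?B - J. 1 - ?\<phi> / (?n a - ?n b))"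
      unfolding pieri_coeff_def using J
      by (intro vandermonde_lower pos_diff_notin_Ints[OF assms(2)] pos_lower) auto
    then show ?thesis unfolding link_def W2 K_def by (simp add: mult_ac)
  qed
  have inj: "inj_on ?l ?A" "inj_on (\<lambda>a. ?n a - 1) ?B"
    using inj_pos[OF assms(2)] by (auto simp: inj_on_def inj_def)
  let ?S1 = "\<Sum>I\<in>Pow ?A. t ^ card I * (\<Prod>i\<in>I. \<Prod>j\<in>?A - I. 1 + ?\<phi> / (?l i - ?l j)) * ?L I"
  let ?S2 = "\<Sum>J\<in>Pow ?B. t ^ card J * (\<Prod>a\<in>J. \<Prod>b\<in>?B - J. 1 - ?\<phi> / (?n a - 1 - (?n b - 1))) * ?R J"
  have "(\<Sum>I\<in>Pow ?A. t ^ card I * (pieri_coeff \<theta> (Suc N) lam I * link \<theta> N (bump lam I) nu)) = K * ?S1"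
    unfolding sum_distrib_left
  proof (intro sum.cong refl)
    fix I assume "I \<in> Pow ?A"
    show "t ^ card I * (pieri_coeff \<theta> (Suc N) lam I * link \<theta> N (bump lam I) nu)
      = K * (t ^ card I * (\<Prod>i\<in>I. \<Prod>j\<in>?A - I. 1 + ?\<phi> / (?l i - ?l j)) * ?L I)"
      unfolding T1[OF \<open>I \<in> Pow ?A\<close>] by (simp only: mult_ac)
  qed
  moreover have "(\<Sum>J\<in>Pow ?B. t ^ card J * (pieri_coeff \<theta> N (lower nu J) J * link \<theta> N lam (lower nu J))) = K * ?S2"
    unfolding sum_distrib_left
  proof (intro sum.cong refl)
    fix J assume "J \<in> Pow ?B"
    show "t ^ card J * (pieri_coeff \<theta> N (lower nu J) J * link \<theta> N lam (lower nu J))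
      = K * (t ^ card J * (\<Prod>a\<in>J. \<Prod>b\<in>?B - J. 1 - ?\<phi> / (?n a - 1 - (?n b - 1))) * ?R J)"
      unfolding T2[OF \<open>J \<in> Pow ?B\<close>] by (simp only: mult_ac)
  qed
  moreover have "?S1 = (1 + t) ^ (card ?A - card ?B) * ?S2"
    by (rule kajihara_noumi_cleared) (use inj in auto)
  ultimately show ?thesis by simp
qed

definition norm_branch :: "real \<Rightarrow> nat \<Rightarrow> (int \<Rightarrow> complex) \<Rightarrow> (nat \<Rightarrow> int) \<Rightarrow> complex" where
  "norm_branch \<theta> N h lam = branch_sum \<theta> N lam h / of_real (jack_weight \<theta> N lam)"

lemma link_eq_0:
  assumes "nu \<in> extensional {1..N}" "nu \<notin> interlacing N lam"
  shows "link \<theta> N lam nu = 0"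
proof -
  obtain a where a: "a \<in> {1..N}" "nu a > lam a \<or> nu a < lam (a + 1)"
    using assms by (auto simp: PiE_iff not_le)
  have "\<exists>i\<in>{1..Suc N}. link_factor \<theta> a i (pos \<theta> lam i - pos \<theta> nu a) = 0"
  proof (cases "nu a > lam a")
    case True
    then have "pos \<theta> lam a - pos \<theta> nu a + 1 = of_int (lam a - nu a + 1)" "lam a - nu a + 1 \<le> 0"
      by (auto simp: pos_def)
    then have "Gamma (pos \<theta> lam a - pos \<theta> nu a + 1) = 0"
      by (simp only: Gamma_eq_zero_iff nonpos_Ints_of_int)
    then have "link_factor \<theta> a a (pos \<theta> lam a - pos \<theta> nu a) = 0" by (simp add: link_factor_def)
    then show ?thesis using a by (intro bexI[of _ a]) auto
  next
    case False
    then have "1 - \<theta> - (pos \<theta> lam (Suc a) - pos \<theta> nu a) = of_int (nu a + 1 - lam (Suc a))" "nu a + 1 - lam (Suc a) \<le> 0"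
      using a by (auto simp: pos_def algebra_simps)
    then have "Gamma (1 - \<theta> - (pos \<theta> lam (Suc a) - pos \<theta> nu a)) = 0"
      by (simp only: Gamma_eq_zero_iff nonpos_Ints_of_int)
    then have "link_factor \<theta> a (Suc a) (pos \<theta> lam (Suc a) - pos \<theta> nu a) = 0" by (simp add: link_factor_def)
    then show ?thesis using a by (intro bexI[of _ "Suc a"]) auto
  qed
  then have "(\<Prod>i\<in>{1..Suc N}. link_factor \<theta> a i (pos \<theta> lam i - pos \<theta> nu a)) = 0"
    by (intro prod_zero) auto
  then have "\<exists>a\<in>{1..N}. (\<Prod>i\<in>{1..Suc N}. link_factor \<theta> a i (pos \<theta> lam i - pos \<theta> nu a)) = 0"
    using a(1) by (rule bexI)
  then have "link_weight \<theta> N (pos \<theta> lam) (pos \<theta> nu) = 0"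
    unfolding link_weight_def by (intro prod_zero finite_atLeastAtMost)
  then show ?thesis by (simp add: link_def)
qed

text \<open>Since \<open>link\<close> vanishes off the interlacing set, the sum may run over any
  finite box \<open>B\<close> around it. This gives the sums for all \<open>bump lam I\<close> a
  common index set, as an interchange of summations requires.\<close>

lemma norm_branch_Suc:
  assumes "\<theta> > 0" "N \<ge> 1" "lam \<in> signatures (Suc N)"
    and "finite B" "interlacing N lam \<subseteq> B" "B \<subseteq> extensional {1..N}"
  shows "norm_branch \<theta> (Suc N) h lam
    = (\<Sum>mu\<in>B. of_real (link \<theta> N lam mu / Gamma \<theta> ^ N) * norm_branch \<theta> N h mu)"
proof -
  have "norm_branch \<theta> (Suc N) h lam
      = (\<Sum>mu\<in>interlacing N lam. of_real (link \<theta> N lam mu / Gamma \<theta> ^ N) * norm_branch \<theta> N h mu)"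
    unfolding norm_branch_def branch_sum_Suc[OF assms(2)] sum_divide_distrib
  proof (intro sum.cong refl)
    fix mu assume mu: "mu \<in> interlacing N lam"
    have p: "jack_weight \<theta> (Suc N) lam > 0" "jack_weight \<theta> N mu > 0" "Gamma \<theta> ^ N > 0"
      using jack_weight_pos[OF assms(1)] assms(3) interlacing_signatures[OF assms(3) mu] Gamma_real_pos[OF assms(1)]
      by auto
    have "p / j = L / g / w" if "p * w * g = j * L" "j > 0" "w > 0" "g > 0" for p j L g w :: real
      using that by (simp add: field_simps)
    then have "jack_psi \<theta> N lam mu / jack_weight \<theta> (Suc N) lam
      = link \<theta> N lam mu / Gamma \<theta> ^ N / jack_weight \<theta> N mu"
      using jack_psi_closed_form[OF assms(1,3) mu] p by (simp only: link_def)
    then have "complex_of_real (jack_psi \<theta> N lam mu) / of_real (jack_weight \<theta> (Suc N) lam)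
      = of_real (link \<theta> N lam mu / Gamma \<theta> ^ N) / of_real (jack_weight \<theta> N mu)"
      by (simp only: of_real_divide[symmetric])
    then show "of_real (jack_psi \<theta> N lam mu) * branch_sum \<theta> N mu h / of_real (jack_weight \<theta> (Suc N) lam)
      = of_real (link \<theta> N lam mu / Gamma \<theta> ^ N) * (branch_sum \<theta> N mu h / of_real (jack_weight \<theta> N mu))"
      by (metis (no_types, lifting) times_divide_eq_left times_divide_eq_right)
  qed
  also have "\<dots> = (\<Sum>mu\<in>B. of_real (link \<theta> N lam mu / Gamma \<theta> ^ N) * norm_branch \<theta> N h mu)"
    using link_eq_0[of _ N lam \<theta>] assms by (intro sum.mono_neutral_left) auto
  finally show ?thesis .
qed

lemma bump_interlacing:
  assumes "I \<subseteq> {1..Suc N}"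
  shows "interlacing N (bump lam I) \<subseteq> (\<Pi>\<^sub>E i\<in>{1..N}. {lam (i + 1)..lam i + 1})"
  by (intro PiE_mono) (auto simp: bump_def)

text \<open>The intertwining relation moves the Pieri sum from one level to the level below at the
  price of a factor \<open>1 + t\<close>. At level 1 there are only two subsets, and adding 1 to the
  entry is the shift of \<open>h\<close>.\<close>

theorem norm_branch_pieri:
  assumes "\<theta> > 0" "\<theta> \<notin> \<rat>" "N \<ge> 1" "lam \<in> signatures N"
  shows "(\<Sum>I\<in>Pow {1..N}. of_real (t ^ card I * pieri_coeff \<theta> N lam I) * norm_branch \<theta> N h (bump lam I))
    = of_real ((1 + t) ^ (N - 1)) * (norm_branch \<theta> N h lam + of_real t * norm_branch \<theta> N (\<lambda>k. h (k + 1)) lam)"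
  using assms(3,4)
proof (induction N arbitrary: lam rule: dec_induct)
  case base
  have "Pow {1..1::nat} = {{}, {1}}" by auto
  then show ?case by (simp add: pieri_coeff_def norm_branch_def jack_weight_def bump_def)
next
  case (step N)
  \<comment> \<open>This box contains all vectors interlacing with some \<open>bump lam I\<close>,
    and also all \<open>bump mu J\<close> for \<open>mu\<close> interlacing with
    \<open>lam\<close>.\<close>
  let ?E = "\<Pi>\<^sub>E i\<in>{1..N}. {lam (i + 1)..lam i + 1}" and ?A = "{1..Suc N}" and ?B = "{1..N}"
  let ?g = "Gamma \<theta> ^ N" and ?V = "norm_branch \<theta> N h"
  have E: "finite ?E" "?E \<subseteq> extensional ?B" by (intro finite_PiE) (auto simp: PiE_def)
  have L: "of_real (t ^ card I * pieri_coeff \<theta> (Suc N) lam I) * norm_branch \<theta> (Suc N) h (bump lam I)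
      = (\<Sum>nu\<in>?E. of_real (t ^ card I * (pieri_coeff \<theta> (Suc N) lam I * link \<theta> N (bump lam I) nu) / ?g) * ?V nu)"
    if I: "I \<in> Pow ?A" for I
  proof (cases "bump lam I \<in> signatures (Suc N)")
    case True
    have "norm_branch \<theta> (Suc N) h (bump lam I)
        = (\<Sum>nu\<in>?E. of_real (link \<theta> N (bump lam I) nu / ?g) * ?V nu)"
      using I by (intro norm_branch_Suc assms(1) step.hyps True E bump_interlacing) auto
    then show ?thesis by (simp add: sum_distrib_left mult_ac)
  next
    case False
    then show ?thesis using pieri_coeff_eq_0[OF assms(1) step.prems] I by simp
  qed
  have R: "(\<Sum>nu\<in>?E. of_real (t ^ card J * (pieri_coeff \<theta> N (lower nu J) J * link \<theta> N lam (lower nu J)) / ?g) * ?V nu)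
      = (\<Sum>mu\<in>interlacing N lam. of_real (link \<theta> N lam mu / ?g)
          * (of_real (t ^ card J * pieri_coeff \<theta> N mu J) * ?V (bump mu J)))"
    (is "sum ?F _ = sum ?G _") if J: "J \<in> Pow ?B" for J
  proof -
    let ?im = "(\<lambda>mu. bump mu J) ` interlacing N lam"
    have inj: "inj_on (\<lambda>mu. bump mu J) (interlacing N lam)"
      by (rule inj_on_inverseI[where g = "\<lambda>nu. lower nu J"]) simp
    have "?F (bump mu J) = ?G mu" for mu by (simp add: mult_ac)
    then have "sum ?G (interlacing N lam) = sum ?F ?im"
      by (simp only: sum.reindex[OF inj] comp_def)
    also have "\<dots> = sum ?F ?E"
    proof (rule sum.mono_neutral_left[OF E(1)])
      show "?im \<subseteq> ?E"
        using J by (force simp: bump_def PiE_iff extensional_def)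
      show "\<forall>nu\<in>?E - ?im. ?F nu = 0"
      proof
        fix nu assume nu: "nu \<in> ?E - ?im"
        have "lower nu J \<notin> interlacing N lam"
          using nu by (metis (no_types, lifting) DiffE bump_lower imageI)
        moreover have "lower nu J \<in> extensional ?B"
          using nu J by (auto simp: lower_def PiE_iff extensional_def)
        ultimately show "?F nu = 0" by (simp add: link_eq_0)
      qed
    qed
    finally show ?thesis by simp
  qed
  have B: "(\<Sum>mu\<in>interlacing N lam. of_real (link \<theta> N lam mu / ?g) * norm_branch \<theta> N h' mu)
      = norm_branch \<theta> (Suc N) h' lam" for h'
    by (rule norm_branch_Suc[symmetric]) (use assms(1) step finite_interlacing in \<open>auto simp: PiE_def\<close>)
  have "(\<Sum>I\<in>Pow ?A. of_real (t ^ card I * pieri_coeff \<theta> (Suc N) lam I) * norm_branch \<theta> (Suc N) h (bump lam I))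
      = (\<Sum>I\<in>Pow ?A. \<Sum>nu\<in>?E. of_real (t ^ card I * (pieri_coeff \<theta> (Suc N) lam I * link \<theta> N (bump lam I) nu) / ?g) * ?V nu)"
    by (intro sum.cong refl L)
  also have "\<dots> = (\<Sum>nu\<in>?E. \<Sum>I\<in>Pow ?A. of_real (t ^ card I * (pieri_coeff \<theta> (Suc N) lam I * link \<theta> N (bump lam I) nu) / ?g) * ?V nu)"
    by (rule sum.swap)
  also have "\<dots> = (\<Sum>nu\<in>?E. of_real (1 + t) * (\<Sum>J\<in>Pow ?B.
       of_real (t ^ card J * (pieri_coeff \<theta> N (lower nu J) J * link \<theta> N lam (lower nu J)) / ?g) * ?V nu))"
  proof (intro sum.cong refl)
    fix nu assume "nu \<in> ?E"
    then have nu: "nu a \<in> {lam (a + 1)..lam a + 1}" if "a \<in> ?B" for a using that by (rule PiE_mem)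
    show "(\<Sum>I\<in>Pow ?A. of_real (t ^ card I * (pieri_coeff \<theta> (Suc N) lam I * link \<theta> N (bump lam I) nu) / ?g) * ?V nu)
     = of_real (1 + t) * (\<Sum>J\<in>Pow ?B.
       of_real (t ^ card J * (pieri_coeff \<theta> N (lower nu J) J * link \<theta> N lam (lower nu J)) / ?g) * ?V nu)"
      (is "?X = of_real _ * ?Y")
    proof -
      have "?X = of_real ((\<Sum>I\<in>Pow ?A. t ^ card I * (pieri_coeff \<theta> (Suc N) lam I * link \<theta> N (bump lam I) nu)) / ?g) * ?V nu"
        by (simp only: sum_divide_distrib of_real_sum sum_distrib_right)
      also have "\<dots> = of_real ((1 + t) * (\<Sum>J\<in>Pow ?B. t ^ card J * (pieri_coeff \<theta> N (lower nu J) J * link \<theta> N lam (lower nu J))) / ?g) * ?V nu"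
        by (subst link_intertwines[OF assms(1,2) step.prems nu]) simp_all
      also have "\<dots> = of_real (1 + t) * (of_real ((\<Sum>J\<in>Pow ?B. t ^ card J * (pieri_coeff \<theta> N (lower nu J) J * link \<theta> N lam (lower nu J))) / ?g) * ?V nu)"
        by (simp only: of_real_mult times_divide_eq_right[symmetric] mult.assoc)
      also have "of_real ((\<Sum>J\<in>Pow ?B. t ^ card J * (pieri_coeff \<theta> N (lower nu J) J * link \<theta> N lam (lower nu J))) / ?g) * ?V nu = ?Y"
        by (simp only: sum_divide_distrib of_real_sum sum_distrib_right)
      finally show ?thesis .
    qed
  qed
  also have "\<dots> = of_real (1 + t) * (\<Sum>J\<in>Pow ?B. \<Sum>nu\<in>?E.
       of_real (t ^ card J * (pieri_coeff \<theta> N (lower nu J) J * link \<theta> N lam (lower nu J)) / ?g) * ?V nu)"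
    unfolding sum_distrib_left[symmetric] by (subst sum.swap) (rule refl)
  also have "\<dots> = of_real (1 + t) * (\<Sum>mu\<in>interlacing N lam. of_real (link \<theta> N lam mu / ?g)
          * (\<Sum>J\<in>Pow ?B. of_real (t ^ card J * pieri_coeff \<theta> N mu J) * ?V (bump mu J)))"
    (is "_ * ?X = _ * ?Y")
  proof (rule arg_cong[where f = "(*) _"])
    have "?X = (\<Sum>J\<in>Pow ?B. \<Sum>mu\<in>interlacing N lam. of_real (link \<theta> N lam mu / ?g)
          * (of_real (t ^ card J * pieri_coeff \<theta> N mu J) * ?V (bump mu J)))"
      by (intro sum.cong refl R)
    also have "\<dots> = (\<Sum>mu\<in>interlacing N lam. \<Sum>J\<in>Pow ?B. of_real (link \<theta> N lam mu / ?g)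
          * (of_real (t ^ card J * pieri_coeff \<theta> N mu J) * ?V (bump mu J)))"
      by (rule sum.swap)
    also have "\<dots> = ?Y" by (simp only: sum_distrib_left)
    finally show "?X = ?Y" .
  qed
  also have "\<dots> = of_real (1 + t) * (\<Sum>mu\<in>interlacing N lam. of_real (link \<theta> N lam mu / ?g)
          * (of_real ((1 + t) ^ (N - 1)) * (?V mu + of_real t * norm_branch \<theta> N (\<lambda>k. h (k + 1)) mu)))"
    by (intro arg_cong2[where f = "(*)"] sum.cong refl step.IH interlacing_signatures[OF step.prems])
  also have "\<dots> = of_real ((1 + t) * (1 + t) ^ (N - 1)) * ((\<Sum>mu\<in>interlacing N lam. of_real (link \<theta> N lam mu / ?g) * ?V mu)
       + of_real t * (\<Sum>mu\<in>interlacing N lam. of_real (link \<theta> N lam mu / ?g) * norm_branch \<theta> N (\<lambda>k. h (k + 1)) mu))"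
  proof -
    have "p * (\<Sum>i\<in>S. u i * (q * (v i + s * w i))) = (p * q) * ((\<Sum>i\<in>S. u i * v i) + s * (\<Sum>i\<in>S. u i * w i))"
      for p q s :: complex and u v w :: "(nat \<Rightarrow> int) \<Rightarrow> complex" and S
      by (simp add: sum_distrib_left sum.distrib algebra_simps)
    then show ?thesis by (simp only: of_real_mult)
  qed
  also have "(1 + t) * (1 + t) ^ (N - 1) = (1 + t) ^ (Suc N - 1)"
    using step.hyps by (cases N) auto
  finally show ?case by (simp only: B)
qed

section \<open>Pieri rules for the Gamma kernel\<close>

definition gamma_kernel :: "real \<Rightarrow> nat \<Rightarrow> (nat \<Rightarrow> int) \<Rightarrow> complex \<Rightarrow> complex" where
  "gamma_kernel \<theta> N lam z = (\<Prod>i\<in>{1..N}. Gamma (z - of_real (of_int (lam i) - \<theta> * real i + \<theta>))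
                 / Gamma (z - of_real (of_int (lam i) - \<theta> * real i)))"

lemma gamma_kernel_pos:
  "gamma_kernel \<theta> N lam z = (\<Prod>i\<in>{1..N}. Gamma (z - of_real (pos \<theta> lam i) - of_real \<theta>) / Gamma (z - of_real (pos \<theta> lam i)))"
  unfolding gamma_kernel_def pos_def by (intro prod.cong) (auto simp: algebra_simps)

text \<open>Writing the denominator with the entire function \<open>rGamma\<close> keeps the
  relation valid when \<open>w + a\<close> is a pole of \<open>Gamma\<close>.\<close>

lemma Gamma_ratio_shift:
  fixes w :: complex
  assumes "w \<notin> \<int>\<^sub>\<le>\<^sub>0"
  shows "Gamma w / Gamma (w + a) = Gamma (w + 1) / Gamma (w + a + 1) * (1 + a / w)"
proof -
  have "w \<noteq> 0" using assms by auto
  have "Gamma (w + 1) / Gamma (w + a + 1) = w * Gamma w * rGamma (w + a + 1)"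
    using Gamma_plus1[OF assms] by (simp add: rGamma_inverse_Gamma divide_inverse)
  moreover have "1 + a / w = (w + a) / w" using \<open>w \<noteq> 0\<close> by (simp add: field_simps)
  ultimately have "Gamma (w + 1) / Gamma (w + a + 1) * (1 + a / w) = Gamma w * ((w + a) * rGamma (w + a + 1))"
    using \<open>w \<noteq> 0\<close> by simp
  also have "(w + a) * rGamma (w + a + 1) = rGamma (w + a)" by (rule rGamma_plus1)
  finally show ?thesis by (simp add: rGamma_inverse_Gamma divide_inverse)
qed

lemma gamma_kernel_bump:
  assumes "I \<subseteq> {1..N}" "\<And>i. i \<in> {1..N} \<Longrightarrow> z - 1 - of_real \<theta> - of_real (pos \<theta> lam i) \<notin> \<int>\<^sub>\<le>\<^sub>0"
  shows "gamma_kernel \<theta> N (bump lam I) z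
    = gamma_kernel \<theta> N lam z * (\<Prod>i\<in>I. 1 + of_real \<theta> / (z - 1 - of_real \<theta> - of_real (pos \<theta> lam i)))"
proof -
  have "(\<Prod>i\<in>I. 1 + of_real \<theta> / (z - 1 - of_real \<theta> - of_real (pos \<theta> lam i)))
     = (\<Prod>i\<in>{1..N}. if i \<in> I then 1 + of_real \<theta> / (z - 1 - of_real \<theta> - of_real (pos \<theta> lam i)) else 1)"
    using assms(1) by (simp add: prod.If_cases Int_absorb1)
  moreover have "gamma_kernel \<theta> N (bump lam I) z = gamma_kernel \<theta> N lam z
     * (\<Prod>i\<in>{1..N}. if i \<in> I then 1 + of_real \<theta> / (z - 1 - of_real \<theta> - of_real (pos \<theta> lam i)) else 1)"
    unfolding gamma_kernel_pos prod.distrib[symmetric]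
  proof (intro prod.cong refl)
    fix i assume i: "i \<in> {1..N}"
    let ?w = "z - 1 - of_real \<theta> - of_real (pos \<theta> lam i)"
    have e: "?w + 1 = z - of_real (pos \<theta> lam i) - of_real \<theta>" "?w + of_real \<theta> + 1 = z - of_real (pos \<theta> lam i)"
      "z - of_real (pos \<theta> lam i + 1) - of_real \<theta> = ?w" "z - of_real (pos \<theta> lam i + 1) = ?w + of_real \<theta>"
      by simp_all
    show "Gamma (z - of_real (pos \<theta> (bump lam I) i) - of_real \<theta>) / Gamma (z - of_real (pos \<theta> (bump lam I) i)) =
      Gamma (z - of_real (pos \<theta> lam i) - of_real \<theta>) / Gamma (z - of_real (pos \<theta> lam i))
      * (if i \<in> I then 1 + of_real \<theta> / ?w else 1)"
      using Gamma_ratio_shift[OF assms(2)[OF i], of "of_real \<theta>"]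
      by (cases "i \<in> I") (simp_all only: pos_bump e of_bool_eq if_True if_False mult_1_right add_0_right simp_thms add_diff_cancel_right')
  qed
  ultimately show ?thesis by simp
qed

lemma gamma_kernel_shift:
  "gamma_kernel \<theta> N (bump lam {1..N}) z = gamma_kernel \<theta> N lam (z - 1)"
  unfolding gamma_kernel_pos by (intro prod.cong refl) (simp add: pos_bump algebra_simps)

text \<open>Bumping multiplies the kernel by factors
  \<open>1 + \<theta> / (y - pos \<theta> lam i)\<close> at the common point
  \<open>y = z - 1 - \<theta>\<close>, so \<open>kajihara_noumi_single\<close> applies. Bumping all
  indices amounts to replacing \<open>z\<close> by \<open>z - 1\<close>, which identifies the second
  term on the right.\<close>

lemma gamma_kernel_pieri:
  assumes "N \<ge> 1" "inj_on (pos \<theta> lam) {1..N}"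
    and nz: "\<And>i. i \<in> {1..N} \<Longrightarrow> z - 1 - of_real \<theta> - of_real (pos \<theta> lam i) \<notin> \<int>\<^sub>\<le>\<^sub>0"
  shows "(\<Sum>I\<in>Pow {1..N}. of_real (t ^ card I * pieri_coeff \<theta> N lam I) * gamma_kernel \<theta> N (bump lam I) z)
    = of_real ((1 + t) ^ (N - 1)) * (gamma_kernel \<theta> N lam z + of_real t * gamma_kernel \<theta> N lam (z - 1))"
proof -
  let ?x = "\<lambda>i. complex_of_real (pos \<theta> lam i)" and ?y = "z - 1 - of_real \<theta>" and ?A = "{1..N}"
  have "z - 1 - of_real \<theta> \<noteq> ?x i" if "i \<in> ?A" for i
    using nz[OF that] by auto
  then have y: "?y \<notin> ?x ` ?A" by blast
  have x: "inj_on ?x ?A" using assms(2) unfolding inj_on_def of_real_eq_iff .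
  have "(\<Sum>I\<in>Pow ?A. of_real (t ^ card I * pieri_coeff \<theta> N lam I) * gamma_kernel \<theta> N (bump lam I) z)
    = gamma_kernel \<theta> N lam z * (\<Sum>I\<in>Pow ?A. of_real t ^ card I * (\<Prod>i\<in>I. \<Prod>j\<in>?A - I. 1 + of_real \<theta> / (?x i - ?x j))
      * (\<Prod>i\<in>I. 1 + of_real \<theta> / (?y - ?x i)))"
    unfolding sum_distrib_left
  proof (intro sum.cong refl)
    fix I assume "I \<in> Pow ?A"
    then have "gamma_kernel \<theta> N (bump lam I) z = gamma_kernel \<theta> N lam z * (\<Prod>i\<in>I. 1 + of_real \<theta> / (?y - ?x i))"
      by (intro gamma_kernel_bump nz) auto
    then show "of_real (t ^ card I * pieri_coeff \<theta> N lam I) * gamma_kernel \<theta> N (bump lam I) z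
       = gamma_kernel \<theta> N lam z * (of_real t ^ card I * (\<Prod>i\<in>I. \<Prod>j\<in>?A - I. 1 + of_real \<theta> / (?x i - ?x j))
      * (\<Prod>i\<in>I. 1 + of_real \<theta> / (?y - ?x i)))"
      by (simp add: pieri_coeff_def mult_ac)
  qed
  also have "\<dots> = gamma_kernel \<theta> N lam z * ((1 + of_real t) ^ (N - 1) * (1 + of_real t * (\<Prod>i\<in>?A. 1 + of_real \<theta> / (?y - ?x i))))"
    using assms(1) kajihara_noumi_single[of ?A ?x ?y "of_real t" "of_real \<theta>"] x y by simp
  also have "\<dots> = of_real ((1 + t) ^ (N - 1)) * (gamma_kernel \<theta> N lam z
      + of_real t * (gamma_kernel \<theta> N lam z * (\<Prod>i\<in>?A. 1 + of_real \<theta> / (?y - ?x i))))"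
    by (simp add: algebra_simps)
  also have "gamma_kernel \<theta> N lam z * (\<Prod>i\<in>?A. 1 + of_real \<theta> / (?y - ?x i)) = gamma_kernel \<theta> N lam (z - 1)"
    using gamma_kernel_bump[of ?A N z \<theta> lam] nz gamma_kernel_shift[of \<theta> N lam z] by simp
  finally show ?thesis .
qed

section \<open>Uniqueness of solutions of the Pieri rules\<close>

lemma power_sum_coeff_0:
  fixes f :: "'i set \<Rightarrow> complex"
  assumes "finite A" "\<And>t::real. (\<Sum>I\<in>Pow A. of_real (t ^ card I) * f I) = 0"
  shows "(\<Sum>I\<in>{I \<in> Pow A. card I = k}. f I) = 0"
proof -
  define p where "p = (\<Sum>I\<in>Pow A. monom (f I) (card I))"
  have "poly p (of_real t) = 0" for t :: real
    using assms(2)[of t] by (simp add: p_def poly_sum poly_monom mult.commute)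
  then have "range complex_of_real \<subseteq> {x. poly p x = 0}" by auto
  moreover have "infinite (range complex_of_real)"
    by (metis finite_imageD infinite_UNIV_char_0 inj_of_real)
  ultimately have "p = 0" using poly_roots_finite infinite_super by blast
  moreover have "coeff p k = (\<Sum>I\<in>Pow A. if card I = k then f I else 0)"
    by (simp add: p_def coeff_sum)
  ultimately have "(\<Sum>I\<in>Pow A. if card I = k then f I else 0) = 0" by simp
  then show ?thesis using assms(1) by (subst sum.inter_filter) simp_all
qed

lemma sum_power_card:
  fixes t :: "'a::comm_ring_1"
  assumes "finite A"
  shows "(\<Sum>I\<in>Pow A. t ^ card I) = (1 + t) ^ card A"
  using assms
proof (induction A rule: finite_induct)
  case (insert a A)
  have "card (insert a I) = Suc (card I)" if "I \<in> Pow A" for I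
    using that insert.hyps by (metis PowD card_insert_disjoint finite_subset subsetD)
  then show ?case using insert
    by (simp add: sum_Pow_insert sum.distrib algebra_simps flip: sum_distrib_left)
qed simp

lemma pieri_coeff_top: "pieri_coeff \<theta> N lam {1..N} = 1"
  by (simp add: pieri_coeff_def)

text \<open>The weights \<open>N + 1 - i\<close> decrease strictly, and elements of \<open>I\<close>
  outside \<open>{1..k}\<close> are traded for equally many inside. Hence \<open>{1..k}\<close> is
  the only heaviest subset of its size, which makes the Pieri system triangular.\<close>

lemma sum_weight_initial_less:
  fixes I :: "nat set"
  assumes "I \<subseteq> {1..N}" "card I = k" "I \<noteq> {1..k}"
  shows "(\<Sum>i\<in>I. N + 1 - i) < (\<Sum>i\<in>{1..k}. N + 1 - i)"
proof -
  let ?K = "{1..k}"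
  have fin: "finite I" using assms(1) finite_subset by auto
  have kN: "k \<le> N" using assms card_mono[of "{1..N}" I] by simp
  have c: "card (I - ?K) = card (?K - I)"
    using assms(2) fin by (metis card_atLeastAtMost card_Diff_subset_Int diff_Suc_1 finite_Int finite_atLeastAtMost inf_commute)
  have ne: "?K - I \<noteq> {}"
  proof
    assume "?K - I = {}"
    then have "?K \<subseteq> I" by auto
    then have "?K = I" using card_subset_eq[OF fin, of ?K] assms(2) by simp
    then show False using assms(3) by simp
  qed
  then have pos: "0 < card (?K - I)" by (simp add: card_gt_0_iff)
  have "(\<Sum>i\<in>I - ?K. N + 1 - i) \<le> (\<Sum>i\<in>I - ?K. N - k)"
    using assms(1) by (intro sum_mono) force
  also have "\<dots> = card (?K - I) * (N - k)" by (simp only: sum_constant c of_nat_id)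
  also have "\<dots> < card (?K - I) * (N + 1 - k)" using pos kN by simp
  also have "\<dots> = (\<Sum>i\<in>?K - I. N + 1 - k)" by simp
  also have "\<dots> \<le> (\<Sum>i\<in>?K - I. N + 1 - i)" by (intro sum_mono) auto
  finally have lt: "(\<Sum>i\<in>I - ?K. N + 1 - i) < (\<Sum>i\<in>?K - I. N + 1 - i)" .
  have "(\<Sum>i\<in>I. N + 1 - i) = (\<Sum>i\<in>I \<inter> ?K. N + 1 - i) + (\<Sum>i\<in>I - ?K. N + 1 - i)"
    by (rule sum.Int_Diff) (rule fin)
  moreover have "(\<Sum>i\<in>?K. N + 1 - i) = (\<Sum>i\<in>?K \<inter> I. N + 1 - i) + (\<Sum>i\<in>?K - I. N + 1 - i)"
    by (rule sum.Int_Diff) simp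
  ultimately show ?thesis using lt by (simp add: Int_commute)
qed

text \<open>With \<open>k\<close> the number of positive parts of \<open>lam\<close>, the degree \<open>k\<close> part of the Pieri rule at
  \<open>lam - 1_{1..k}\<close> expresses the value at \<open>lam\<close> by values at signatures of smaller weight
  \<open>\<Sum>i. (N + 1 - i) * lam i\<close>. The degree \<open>N\<close> part reduces negative entries to nonnegative
  ones.\<close>

theorem pieri_unique:
  fixes \<delta> :: "(nat \<Rightarrow> int) \<Rightarrow> complex \<Rightarrow> complex"
  assumes "\<theta> > 0" "N \<ge> 1"
    and zero: "\<And>z. Im z \<noteq> 0 \<or> Re z > 0 \<Longrightarrow> \<delta> (\<lambda>i\<in>{1..N}. 0) z = 0"
    and pieri: "\<And>lam z t. lam \<in> signatures N \<Longrightarrow> Im z \<noteq> 0 \<or> Re z > of_int (lam 1) + 1 \<Longrightarrow>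
      (\<Sum>I\<in>Pow {1..N}. of_real (t ^ card I * pieri_coeff \<theta> N lam I) * \<delta> (bump lam I) z)
      = of_real ((1 + t) ^ (N - 1)) * (\<delta> lam z + of_real t * \<delta> lam (z - 1))"
    and "lam \<in> signatures N" "Im z \<noteq> 0 \<or> Re z > of_int (lam 1)"
  shows "\<delta> lam z = 0"
proof -
  have one: "(1::nat) \<in> {1..N}" using assms(2) by auto
  have nonneg: "\<delta> lam z = 0" if "lam \<in> signatures N" "Im z \<noteq> 0 \<or> Re z > of_int (lam 1)"
    "\<And>i. i \<in> {1..N} \<Longrightarrow> lam i \<ge> 0" for lam z
    using that
  proof (induction "nat (\<Sum>i\<in>{1..N}. int (N + 1 - i) * lam i)" arbitrary: lam z rule: less_induct)
    case less
    define w where "w mu = (\<Sum>i\<in>{1..N}. int (N + 1 - i) * mu i)" for mu :: "nat \<Rightarrow> int"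
    have w0: "w mu \<ge> 0" if "\<And>i. i \<in> {1..N} \<Longrightarrow> mu i \<ge> 0" for mu
      unfolding w_def using that by (intro sum_nonneg) auto
    define k where "k = card {i\<in>{1..N}. lam i > 0}"
    have K: "{i\<in>{1..N}. lam i > 0} = {1..k}"
    proof -
      let ?S = "{i\<in>{1..N}. lam i > 0}"
      have down: "j \<in> ?S" if "i \<in> ?S" "1 \<le> j" "j \<le> i" for i j
        using that signaturesD[OF less.prems(1), of j i] by auto
      show ?thesis
      proof (cases "?S = {}")
        case False
        define m where "m = Max ?S"
        have mS: "m \<in> ?S" unfolding m_def using False by (intro Max_in) auto
        have "i \<in> {1..m}" if "i \<in> ?S" for i
          using that Max_ge[of ?S i] unfolding m_def by simp
        moreover have "i \<in> ?S" if "i \<in> {1..m}" for i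
          by (rule down[OF mS]) (use that in simp_all)
        ultimately have "?S = {1..m}" by blast
        then show ?thesis unfolding k_def by simp
      qed (simp add: k_def)
    qed
    have "k \<le> card {1..N}" unfolding k_def by (intro card_mono) auto
    then have kN: "k \<le> N" by simp
    show ?case
    proof (cases "k = 0")
      case True
      then have "lam i \<le> 0" if "i \<in> {1..N}" for i using K that by fastforce
      then have "lam i = 0" if "i \<in> {1..N}" for i using less.prems(3)[OF that] that by force
      then have "lam = (\<lambda>i\<in>{1..N}. 0)"
        using less.prems(1) by (auto simp: signatures_def PiE_iff extensional_def fun_eq_iff)
      then show ?thesis using zero less.prems(2) one by simp
    next
      case False
      define mu where "mu = lower lam {1..k}"
      have lam: "lam = bump mu {1..k}" by (simp add: mu_def)
      have k1: "1 \<in> {1..k}" using False by simp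
      have mu0: "mu i \<ge> 0" if "i \<in> {1..N}" for i
        using less.prems(3)[OF that] that K[symmetric] by (auto simp: mu_def lower_def)
      have mu: "mu \<in> signatures N"
      proof -
        have "mu j \<le> mu i" if "i \<in> {1..N}" "j \<in> {1..N}" "i \<le> j" for i j
        proof (cases "j \<in> {1..k}")
          case True
          then have "i \<in> {1..k}" using that by auto
          then show ?thesis using True signaturesD[OF less.prems(1) that] by (simp add: mu_def lower_def)
        next
          case False
          then have "lam j = 0" using that less.prems(3)[of j] K by force
          then have "mu j = 0" using False by (simp only: mu_def lower_def of_bool_eq(1) diff_0_right)
          then show ?thesis using mu0[OF that(1)] by simp
        qed
        moreover have "mu \<in> extensional {1..N}"
          using less.prems(1) kN by (auto simp: mu_def lower_def signatures_def PiE_iff extensional_def)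
        ultimately show ?thesis by (auto simp: signatures_def PiE_iff)
      qed
      have w_bump: "w (bump mu I) = w mu + int (\<Sum>i\<in>I. N + 1 - i)" if "I \<subseteq> {1..N}" for I
      proof -
        have "w (bump mu I) = w mu + (\<Sum>i\<in>{1..N}. if i \<in> I then int (N + 1 - i) else 0)"
          unfolding w_def sum.distrib[symmetric] by (intro sum.cong refl) (simp add: bump_def algebra_simps)
        also have "(\<Sum>i\<in>{1..N}. if i \<in> I then int (N + 1 - i) else 0) = (\<Sum>i\<in>I. int (N + 1 - i))"
          using that by (simp add: sum.If_cases Int_absorb1)
        finally show ?thesis by simp
      qed
      have wk: "w lam = w mu + int (\<Sum>i\<in>{1..k}. N + 1 - i)" using w_bump[of "{1..k}"] kN lam by simp
      \<comment> \<open>As \<open>lam 1 = mu 1 + 1\<close>, the point \<open>z\<close> has a unit of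
        room to the right of \<open>mu 1\<close>, so that both \<open>z\<close> and
        \<open>z - 1\<close> are admissible for \<open>mu\<close>.\<close>
      have adm: "Im z \<noteq> 0 \<or> Re z > of_int (mu 1) + 1"
        using less.prems(2) k1 by (auto simp: mu_def lower_def)
      have "0 < (\<Sum>i\<in>{1..k}. N + 1 - i)" using False kN by (intro sum_pos) auto
      then have "w mu < w lam" unfolding wk by (simp only: of_nat_0_less_iff less_add_same_cancel1)
      then have "nat (w mu) < nat (w lam)" using w0[of mu] mu0 by simp
      then have IH: "\<delta> mu z' = 0" if "Im z' \<noteq> 0 \<or> Re z' > of_int (mu 1)" for z'
        using less.hyps[of mu z'] mu mu0 that unfolding w_def by blast
      have "\<delta> mu z = 0" using adm by (intro IH) auto
      moreover have "\<delta> mu (z - 1) = 0" using adm by (intro IH) auto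
      ultimately have "(\<Sum>I\<in>Pow {1..N}. of_real (t ^ card I) * (of_real (pieri_coeff \<theta> N mu I) * \<delta> (bump mu I) z)) = 0" for t
        using pieri[OF mu adm, of t] by (simp add: mult.assoc)
      then have "(\<Sum>I\<in>{I \<in> Pow {1..N}. card I = k}. of_real (pieri_coeff \<theta> N mu I) * \<delta> (bump mu I) z) = 0"
        by (intro power_sum_coeff_0) auto
      also have "(\<Sum>I\<in>{I \<in> Pow {1..N}. card I = k}. of_real (pieri_coeff \<theta> N mu I) * \<delta> (bump mu I) z)
        = (\<Sum>I\<in>{{1..k}}. of_real (pieri_coeff \<theta> N mu I) * \<delta> (bump mu I) z)"
      proof (rule sum.mono_neutral_right)
        show "{{1..k}} \<subseteq> {I \<in> Pow {1..N}. card I = k}" using kN by auto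
        show "\<forall>I\<in>{I \<in> Pow {1..N}. card I = k} - {{1..k}}. of_real (pieri_coeff \<theta> N mu I) * \<delta> (bump mu I) z = 0"
        proof
          fix I assume "I \<in> {I \<in> Pow {1..N}. card I = k} - {{1..k}}"
          then have I: "I \<subseteq> {1..N}" "card I = k" "I \<noteq> {1..k}" by auto
          show "of_real (pieri_coeff \<theta> N mu I) * \<delta> (bump mu I) z = 0"
          proof (cases "bump mu I \<in> signatures N")
            case True
            have "\<delta> (bump mu I) z = 0"
            proof (rule less.hyps)
              have "w (bump mu I) < w lam"
                unfolding w_bump[OF I(1)] wk using sum_weight_initial_less[OF I] by (simp only: of_nat_less_iff add_less_cancel_left)
              moreover have "w (bump mu I) \<ge> 0" using mu0 by (intro w0) (auto simp: bump_def)
              ultimately show "nat (\<Sum>i\<in>{1..N}. int (N + 1 - i) * bump mu I i) < nat (\<Sum>i\<in>{1..N}. int (N + 1 - i) * lam i)"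
                unfolding w_def by simp
              show "Im z \<noteq> 0 \<or> Re z > of_int (bump mu I 1)"
                using adm by (auto simp: bump_def)
              show "bump mu I i \<ge> 0" if "i \<in> {1..N}" for i using mu0[OF that] by (simp add: bump_def)
            qed (rule True)
            then show ?thesis by simp
          next
            case False
            then show ?thesis using pieri_coeff_eq_0[OF assms(1) mu I(1)] by simp
          qed
        qed
      qed auto
      also have "\<dots> = of_real (pieri_coeff \<theta> N mu {1..k}) * \<delta> lam z" by (simp add: lam)
      finally have "of_real (pieri_coeff \<theta> N mu {1..k}) * \<delta> lam z = 0" .
      moreover have "pieri_coeff \<theta> N mu {1..k} > 0"
        unfolding pieri_coeff_def
      proof (intro prod_pos)
        fix i j assume "i \<in> {1..k}" "j \<in> {1..N} - {1..k}"
        then have "pos \<theta> mu i - pos \<theta> mu j \<ge> \<theta>" by (intro pos_diff_ge[OF mu _ _ _ assms(1)]) auto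
        then show "0 < 1 + \<theta> / (pos \<theta> mu i - pos \<theta> mu j)" using assms(1) by (intro add_pos_nonneg) auto
      qed
      ultimately show ?thesis by simp
    qed
  qed
  have shift: "\<delta> (bump lam {1..N}) z = \<delta> lam (z - 1)"
    if "lam \<in> signatures N" "Im z \<noteq> 0 \<or> Re z > of_int (lam 1) + 1" for lam z
  proof -
    \<comment> \<open>The right-hand side of the Pieri rule is itself written as a sum over subsets:
      those containing \<open>N\<close> carry the value at \<open>z - 1\<close>, the others the
      value at \<open>z\<close>. The coefficient of \<open>t ^ N\<close> of the difference can then
      be read off.\<close>
    let ?f = "\<lambda>I. if N \<in> I then \<delta> lam (z - 1) else \<delta> lam z"
    have e: "{1..N} = insert N {1..N - 1}" "N \<notin> {1..N - 1}" using assms(2) by auto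
    have c: "card (insert N I) = Suc (card I)" "N \<notin> I" if "I \<in> Pow {1..N - 1}" for I
    proof -
      show n: "N \<notin> I" using that e(2) by blast
      have "finite I" using that by (auto intro: finite_subset)
      then show "card (insert N I) = Suc (card I)" using n by simp
    qed
    have "(\<Sum>I\<in>Pow {1..N}. of_real (t ^ card I) * ?f I) = of_real ((1 + t) ^ (N - 1)) * (\<delta> lam z + of_real t * \<delta> lam (z - 1))" for t
    proof -
      have "(\<Sum>I\<in>Pow {1..N}. of_real (t ^ card I) * ?f I)
        = (\<Sum>I\<in>Pow {1..N - 1}. of_real (t ^ card I) * (\<delta> lam z + of_real t * \<delta> lam (z - 1)))"
        by (subst e(1), subst sum_Pow_insert) (auto intro!: sum.cong simp: c algebra_simps)
      then show ?thesis by (simp only: sum_distrib_right[symmetric] of_real_sum[symmetric]) (simp add: sum_power_card)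
    qed
    then have "(\<Sum>I\<in>Pow {1..N}. of_real (t ^ card I) * (of_real (pieri_coeff \<theta> N lam I) * \<delta> (bump lam I) z - ?f I)) = 0" for t
      using pieri[OF that, of t] by (simp add: algebra_simps sum_subtractf)
    then have "(\<Sum>I\<in>{I \<in> Pow {1..N}. card I = N}. of_real (pieri_coeff \<theta> N lam I) * \<delta> (bump lam I) z - ?f I) = 0"
      by (intro power_sum_coeff_0) auto
    moreover have "{I \<in> Pow {1..N}. card I = N} = {{1..N}}"
      using card_subset_eq[of "{1..N}"] by auto
    ultimately show ?thesis using assms(2) pieri_coeff_top[of \<theta> N lam] by simp
  qed
  have "\<delta> lam z = 0" if "lam \<in> signatures N" "Im z \<noteq> 0 \<or> Re z > of_int (lam 1)"
    "\<And>i. i \<in> {1..N} \<Longrightarrow> lam i \<ge> - int m" for lam z m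
    using that
  proof (induction m arbitrary: lam z)
    case 0
    then show ?case by (intro nonneg) auto
  next
    case (Suc m)
    have "\<delta> (bump lam {1..N}) (z + 1) = 0"
    proof (rule Suc.IH)
      show "bump lam {1..N} \<in> signatures N"
        using Suc.prems(1) by (auto simp: bump_def signatures_def PiE_iff extensional_def)
      show "Im (z + 1) \<noteq> 0 \<or> Re (z + 1) > of_int (bump lam {1..N} 1)"
        using Suc.prems(2) one by (auto simp: bump_def)
      show "bump lam {1..N} i \<ge> - int m" if "i \<in> {1..N}" for i
        using Suc.prems(3)[OF that] that by (simp add: bump_def)
    qed
    then show ?case using shift[OF Suc.prems(1), of "z + 1"] Suc.prems(2) by simp
  qed
  moreover have "lam i \<ge> - int (nat (- lam N))" if "i \<in> {1..N}" for i
    using signaturesD[OF assms(5) that, of N] that by auto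
  ultimately show ?thesis using assms(5,6) by blast
qed

section \<open>Averaging the kernel over the branching rule\<close>

lemma half_plane_notin_nonpos_Ints: "Im z \<noteq> 0 \<or> Re z > 0 \<Longrightarrow> z \<notin> \<int>\<^sub>\<le>\<^sub>0"
  by (auto elim!: nonpos_Ints_cases)

text \<open>This is the Beta function \<open>B(z - n, a)\<close> divided by \<open>Gamma a\<close>,
  the kernel that belongs to the single power \<open>x^n\<close>.\<close>

definition beta_ratio :: "real \<Rightarrow> complex \<Rightarrow> int \<Rightarrow> complex" where
  "beta_ratio a z n = Gamma (z - of_int n) / Gamma (z - of_int n + of_real a)"

text \<open>For the zero signature the positions are spaced by exactly \<open>\<theta>\<close>, so
  the product telescopes. This is where the parameter \<open>\<theta> * N\<close> of the one-power
  kernel comes from.\<close>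

lemma gamma_kernel_zero:
  assumes "\<theta> > 0" "Im z \<noteq> 0 \<or> Re z > 0"
  shows "gamma_kernel \<theta> N (\<lambda>i\<in>{1..N}. 0) z = beta_ratio (\<theta> * real N) z 0"
proof -
  let ?g = "\<lambda>n. Gamma (z + of_real (\<theta> * real n))"
  have nz: "?g n \<noteq> 0" for n
    using assms by (auto simp: Gamma_eq_zero_iff intro!: half_plane_notin_nonpos_Ints add_pos_nonneg)
  have "(\<Prod>i\<in>{1..n}. ?g (i - 1) / ?g i) = ?g 0 / ?g n" for n
    using nz nz[of 0] by (induction n) simp_all
  moreover have "gamma_kernel \<theta> N (\<lambda>i\<in>{1..N}. 0) z = (\<Prod>i\<in>{1..N}. ?g (i - 1) / ?g i)"
    unfolding gamma_kernel_def
    by (intro prod.cong refl) (auto simp: of_nat_diff algebra_simps)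
  ultimately show ?thesis by (simp add: beta_ratio_def)
qed

text \<open>Through this sum, constant functions satisfy the Pieri rules.\<close>

lemma pieri_coeff_sum:
  assumes "inj_on (pos \<theta> lam) {1..N}"
  shows "(\<Sum>I\<in>Pow {1..N}. t ^ card I * pieri_coeff \<theta> N lam I) = (1 + t) ^ N"
  using kn_left_empty[of "{1..N}" "pos \<theta> lam" _ \<theta> t] assms by (simp add: kn_left_def pieri_coeff_def)

text \<open>Uniqueness is used twice. Applied to \<open>h = 1\<close> minus its value at the zero
  signature, it shows that the normalized total mass is the same constant \<open>c\<close> for every
  signature. Applied to the averaged kernel minus \<open>c\<close> times the product kernel, it
  gives the claim.\<close>

lemma markov_krein_irrational:
  assumes "\<theta> > 0" "\<theta> \<notin> \<rat>" "N \<ge> 1" "lam \<in> signatures N" "Im z \<noteq> 0 \<or> Re z > of_int (lam 1)"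
  shows "branch_sum \<theta> N lam (beta_ratio (\<theta> * real N) z) = branch_sum \<theta> N lam (\<lambda>_. 1) * gamma_kernel \<theta> N lam z"
proof -
  let ?one = "\<lambda>_::int. 1::complex"
  define c where "c = norm_branch \<theta> N ?one (\<lambda>i\<in>{1..N}. 0)"
  have inj: "inj_on (pos \<theta> mu) {1..N}" for mu
    using inj_pos[OF assms(2)] by (rule inj_on_subset) simp
  have N: "(1 + t) ^ N = (1 + t) ^ (N - 1) * (1 + t)" for t :: real
    using assms(3) by (cases N) auto
  have "norm_branch \<theta> N ?one lam - c = 0"
  proof (rule pieri_unique[OF assms(1,3) _ _ assms(4,5), where \<delta> = "\<lambda>lam _. norm_branch \<theta> N ?one lam - c"])
    fix mu and t :: real assume mu: "mu \<in> signatures N"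
    have "(\<Sum>I\<in>Pow {1..N}. of_real (t ^ card I * pieri_coeff \<theta> N mu I) * (norm_branch \<theta> N ?one (bump mu I) - c))
      = of_real ((1 + t) ^ (N - 1)) * (norm_branch \<theta> N ?one mu + of_real t * norm_branch \<theta> N ?one mu)
        - of_real (\<Sum>I\<in>Pow {1..N}. t ^ card I * pieri_coeff \<theta> N mu I) * c"
      using norm_branch_pieri[OF assms(1-3) mu, of t ?one]
      by (simp only: right_diff_distrib sum_subtractf of_real_sum sum_distrib_right)
    also have "\<dots> = of_real ((1 + t) ^ (N - 1)) * ((norm_branch \<theta> N ?one mu - c) + of_real t * (norm_branch \<theta> N ?one mu - c))"
      unfolding pieri_coeff_sum[OF inj] N by (simp add: algebra_simps)
    finally show "(\<Sum>I\<in>Pow {1..N}. of_real (t ^ card I * pieri_coeff \<theta> N mu I) * (norm_branch \<theta> N ?one (bump mu I) - c)) = \<dots>" .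
  qed (simp add: c_def)
  then have one: "norm_branch \<theta> N ?one lam = c" by simp
  let ?h = "beta_ratio (\<theta> * real N)"
  let ?d = "\<lambda>lam z. norm_branch \<theta> N (?h z) lam - c * gamma_kernel \<theta> N lam z"
  have "?d lam z = 0"
  proof (rule pieri_unique[OF assms(1,3) _ _ assms(4,5), where \<delta> = ?d])
    fix z :: complex assume z: "Im z \<noteq> 0 \<or> Re z > 0"
    have "norm_branch \<theta> N (?h z) (\<lambda>i\<in>{1..N}. 0) = ?h z 0 * c"
      unfolding c_def norm_branch_def using branch_sum_const[OF assms(3), of "\<lambda>i\<in>{1..N}. 0" 0 \<theta> "?h z"] by simp
    then show "?d (\<lambda>i\<in>{1..N}. 0) z = 0" using gamma_kernel_zero[OF assms(1) z] by simp
  next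
    fix mu z and t :: real assume mu: "mu \<in> signatures N" and z: "Im z \<noteq> 0 \<or> Re z > of_int (mu 1) + 1"
    have nz: "z - 1 - of_real \<theta> - of_real (pos \<theta> mu i) \<notin> \<int>\<^sub>\<le>\<^sub>0" if i: "i \<in> {1..N}" for i
    proof (rule half_plane_notin_nonpos_Ints)
      have "mu i \<le> mu 1" using signaturesD[OF mu _ i, of 1] i by auto
      moreover have "\<theta> * 1 \<le> \<theta> * real i" using assms(1) i by (intro mult_left_mono) auto
      ultimately have "pos \<theta> mu i + \<theta> \<le> of_int (mu 1)"
        unfolding pos_def by (smt (verit) of_int_le_iff mult_1_right)
      then show "Im (z - 1 - of_real \<theta> - of_real (pos \<theta> mu i)) \<noteq> 0 \<or> Re (z - 1 - of_real \<theta> - of_real (pos \<theta> mu i)) > 0"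
        using z by auto
    qed
    \<comment> \<open>The shift of \<open>h\<close> in the branching Pieri rule matches the shift of
      \<open>z\<close> in the rule of the kernel.\<close>
    have h: "(\<lambda>k. ?h z (k + 1)) = ?h (z - 1)"
      by (rule ext) (simp add: beta_ratio_def algebra_simps)
    have kernel: "(\<Sum>I\<in>Pow {1..N}. of_real (t ^ card I * pieri_coeff \<theta> N mu I) * gamma_kernel \<theta> N (bump mu I) z)
      = of_real ((1 + t) ^ (N - 1)) * (gamma_kernel \<theta> N mu z + of_real t * gamma_kernel \<theta> N mu (z - 1))"
      by (rule gamma_kernel_pieri[OF assms(3) inj]) (rule nz)
    have "(\<Sum>I\<in>Pow {1..N}. of_real (t ^ card I * pieri_coeff \<theta> N mu I) * ?d (bump mu I) z)
      = (\<Sum>I\<in>Pow {1..N}. of_real (t ^ card I * pieri_coeff \<theta> N mu I) * norm_branch \<theta> N (?h z) (bump mu I))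
       - c * (\<Sum>I\<in>Pow {1..N}. of_real (t ^ card I * pieri_coeff \<theta> N mu I) * gamma_kernel \<theta> N (bump mu I) z)"
      unfolding sum_distrib_left sum_subtractf[symmetric] by (intro sum.cong refl) (simp add: algebra_simps)
    also have "\<dots> = of_real ((1 + t) ^ (N - 1)) * (?d mu z + of_real t * ?d mu (z - 1))"
      unfolding norm_branch_pieri[OF assms(1-3) mu] kernel h
      by (simp add: algebra_simps)
    finally show "(\<Sum>I\<in>Pow {1..N}. of_real (t ^ card I * pieri_coeff \<theta> N mu I) * ?d (bump mu I) z) = \<dots>" .
  qed
  then show ?thesis
    using one jack_weight_pos[OF assms(1,4)] by (simp add: norm_branch_def field_simps)
qed

section \<open>Passage from irrational to arbitrary parameters\<close>

lemma continuous_on_Gamma':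
  fixes f :: "'a::topological_space \<Rightarrow> complex"
  assumes "continuous_on A f" "\<And>x. x \<in> A \<Longrightarrow> f x \<notin> \<int>\<^sub>\<le>\<^sub>0"
  shows "continuous_on A (\<lambda>x. Gamma (f x))"
proof -
  have "continuous_on (- \<int>\<^sub>\<le>\<^sub>0) (Gamma :: complex \<Rightarrow> complex)" by (rule continuous_on_Gamma) auto
  then show ?thesis by (rule continuous_on_compose2) (use assms in auto)
qed

lemma continuous_on_pochhammer:
  fixes f :: "real \<Rightarrow> real"
  shows "continuous_on S f \<Longrightarrow> continuous_on S (\<lambda>x. pochhammer (f x) n)"
  unfolding pochhammer_prod by (intro continuous_intros)

lemma continuous_on_jack_psi:
  assumes "lam \<in> signatures (Suc N)" "mu \<in> interlacing N lam"
  shows "continuous_on {0<..} (\<lambda>\<theta>. jack_psi \<theta> N lam mu)"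
  unfolding jack_psi_def
proof (intro continuous_intros continuous_on_pochhammer ballI)
  fix i j and \<theta> :: real assume ij: "j \<in> {1..N}" "i \<in> {1..j}" and "\<theta> \<in> {0<..}"
  then have "real_of_int (mu i - mu j) \<ge> 0" "real_of_int (lam i - mu j) \<ge> 0" "\<theta> * real (j - i) \<ge> 0" "\<theta> > 0"
    using interlacing_bounds[OF assms, of i j] by auto
  then have "0 < real_of_int (mu i - mu j) + \<theta> * real (j - i) + 1"
    "0 < real_of_int (lam i - mu j) + \<theta> * real (j - i) + \<theta>"
    by linarith+
  from this[THEN pochhammer_pos]
  show "pochhammer (real_of_int (mu i - mu j) + \<theta> * real (j - i) + 1) (nat (mu j - lam (j + 1))) \<noteq> 0"
    "pochhammer (real_of_int (lam i - mu j) + \<theta> * real (j - i) + \<theta>) (nat (mu j - lam (j + 1))) \<noteq> 0"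
    by (simp_all add: less_imp_neq[symmetric])
qed

lemma continuous_on_branch_sum:
  fixes h :: "real \<Rightarrow> int \<Rightarrow> complex"
  assumes "N \<ge> 1" "lam \<in> signatures N" "\<And>n. n \<le> lam 1 \<Longrightarrow> continuous_on {0<..} (\<lambda>\<theta>. h \<theta> n)"
  shows "continuous_on {0<..} (\<lambda>\<theta>. branch_sum \<theta> N lam (h \<theta>))"
  using assms
proof (induction N arbitrary: lam rule: dec_induct)
  case base
  then show ?case by simp
next
  case (step N)
  have "continuous_on {0<..} (\<lambda>\<theta>. branch_sum \<theta> N mu (h \<theta>))" if mu: "mu \<in> interlacing N lam" for mu
  proof (rule step.IH)
    show "mu \<in> signatures N" by (rule interlacing_signatures[OF step.prems(1) mu])
    have "mu 1 \<le> lam 1" using interlacing_bounds(2)[OF step.prems(1) mu, of 1 1] step.hyps by auto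
    then show "continuous_on {0<..} (\<lambda>\<theta>. h \<theta> n)" if "n \<le> mu 1" for n using step.prems(2) that by auto
  qed
  then show ?case unfolding branch_sum_Suc[OF step.hyps(1)]
    by (intro continuous_intros continuous_on_jack_psi[OF step.prems(1)])
qed

lemma continuous_zero_on_irrationals:
  fixes f :: "real \<Rightarrow> complex"
  assumes "continuous_on {0<..} f" "\<And>\<theta>. \<theta> > 0 \<Longrightarrow> \<theta> \<notin> \<rat> \<Longrightarrow> f \<theta> = 0" "\<theta> > 0"
  shows "f \<theta> = 0"
proof (rule ccontr)
  assume "f \<theta> \<noteq> 0"
  have "open ({0<..} \<inter> f -` (- {0}))"
    by (intro continuous_open_preimage[OF assms(1)]) auto
  then obtain e where e: "e > 0" "ball \<theta> e \<subseteq> {0<..} \<inter> f -` (- {0})"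
    using openE[of "{0<..} \<inter> f -` (- {0})" \<theta>] assms(3) \<open>f \<theta> \<noteq> 0\<close> by auto
  have "{\<theta><..<\<theta> + e} \<subseteq> ball \<theta> e" by (auto simp: dist_real_def)
  then have "{\<theta><..<\<theta> + e} \<subseteq> \<rat>" using e(2) assms(2) by blast
  then have "countable {\<theta><..<\<theta> + e}" using countable_rat countable_subset by blast
  then show False using uncountable_open_interval[of \<theta> "\<theta> + e"] e(1) by simp
qed

text \<open>For fixed \<open>lam\<close> and \<open>z\<close>, all Pochhammer denominators of
  \<open>jack_psi\<close> are positive and all Gamma arguments of both kernels stay off the poles
  for every \<open>\<theta> > 0\<close>. Both sides are thus continuous in \<open>\<theta>\<close>,
  and they agree at the irrational points.\<close>

theorem markov_krein:
  assumes "\<theta> > 0" "N \<ge> 1" "lam \<in> signatures N" "Im z \<noteq> 0 \<or> Re z > of_int (lam 1)"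
  shows "branch_sum \<theta> N lam (beta_ratio (\<theta> * real N) z) = branch_sum \<theta> N lam (\<lambda>_. 1) * gamma_kernel \<theta> N lam z"
proof -
  have "continuous_on {0<..} (\<lambda>\<theta>. branch_sum \<theta> N lam (beta_ratio (\<theta> * real N) z))"
  proof (rule continuous_on_branch_sum[OF assms(2,3)])
    fix n assume n: "n \<le> lam 1"
    have nz: "z - of_int n + of_real (\<theta> * real N) \<notin> \<int>\<^sub>\<le>\<^sub>0" if "\<theta> > 0" for \<theta>
    proof (rule half_plane_notin_nonpos_Ints)
      have "real_of_int n \<le> of_int (lam 1)" "\<theta> * real N \<ge> 0" using n that by auto
      then show "Im (z - of_int n + of_real (\<theta> * real N)) \<noteq> 0 \<or> Re (z - of_int n + of_real (\<theta> * real N)) > 0"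
        using assms(4) by auto
    qed
    have "continuous_on {0<..} (\<lambda>\<theta>. z - of_int n + of_real (\<theta> * real N))"
      by (intro continuous_intros)
    with nz have "continuous_on {0<..} (\<lambda>\<theta>. Gamma (z - of_int n + of_real (\<theta> * real N)))"
      by (intro continuous_on_Gamma') (simp_all only: greaterThan_iff not_False_eq_True)
    then show "continuous_on {0<..} (\<lambda>\<theta>. beta_ratio (\<theta> * real N) z n)"
      unfolding beta_ratio_def using nz
      by (intro continuous_on_divide continuous_on_const) (simp_all add: Gamma_eq_zero_iff del: of_real_mult)
  qed
  moreover have "continuous_on {0<..} (\<lambda>\<theta>. branch_sum \<theta> N lam (\<lambda>_. 1))"
    by (rule continuous_on_branch_sum[OF assms(2,3)]) auto
  moreover have "continuous_on {0<..} (\<lambda>\<theta>. gamma_kernel \<theta> N lam z)"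
    unfolding gamma_kernel_def
  proof (intro continuous_intros continuous_on_Gamma' ballI)
    fix i and \<theta> :: real assume i: "i \<in> {1..N}" and \<theta>: "\<theta> \<in> {0<..}"
    have "lam i \<le> lam 1" using signaturesD[OF assms(3) _ i, of 1] i by auto
    moreover have "\<theta> * 1 \<le> \<theta> * real i" using \<theta> i by (intro mult_left_mono) auto
    ultimately have b: "of_int (lam i) - \<theta> * real i + \<theta> \<le> of_int (lam 1)"
      by (smt (verit) of_int_le_iff mult_1_right)
    show "Gamma (z - of_real (of_int (lam i) - \<theta> * real i)) \<noteq> 0"
      unfolding Gamma_eq_zero_iff using b \<theta> assms(4) by (intro half_plane_notin_nonpos_Ints) auto
    then show "z - of_real (of_int (lam i) - \<theta> * real i) \<notin> \<int>\<^sub>\<le>\<^sub>0" by (simp add: Gamma_eq_zero_iff)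
    show "z - of_real (of_int (lam i) - \<theta> * real i + \<theta>) \<notin> \<int>\<^sub>\<le>\<^sub>0"
      using b assms(4) by (intro half_plane_notin_nonpos_Ints) auto
  qed
  ultimately have "continuous_on {0<..} (\<lambda>\<theta>. branch_sum \<theta> N lam (beta_ratio (\<theta> * real N) z)
      - branch_sum \<theta> N lam (\<lambda>_. 1) * gamma_kernel \<theta> N lam z)"
    by (intro continuous_intros)
  from continuous_zero_on_irrationals[OF this _ assms(1)] show ?thesis
    using markov_krein_irrational[OF _ _ assms(2-4)] by simp
qed

section \<open>The contour integral of one power\<close>

lemma exp_half_line_integral:
  fixes \<delta> T :: real
  assumes "\<delta> > 0"
  shows "set_integrable lborel {..T} (\<lambda>t. exp (\<delta> * t))" (is ?A)
    and "(LINT t:{..T}|lborel. exp (\<delta> * t)) = exp (\<delta> * T) / \<delta>" (is ?B)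
proof -
  have FTC: "set_integrable lborel (einterval (-\<infinity>) (ereal b)) (\<lambda>t. exp (\<delta> * t))"
    "(LBINT t=-\<infinity>..ereal b. exp (\<delta> * t)) = exp (\<delta> * b) / \<delta> - 0" for b
  proof -
    have *: "((\<lambda>t. exp (\<delta> * t) / \<delta>) \<longlongrightarrow> 0) at_bot"
      using assms by real_asymp
    have **: "((\<lambda>t. exp (\<delta> * t) / \<delta>) \<longlongrightarrow> exp (\<delta> * b) / \<delta>) (at_left b)"
      using assms by (intro tendsto_intros) auto
    have "set_integrable lborel (einterval (-\<infinity>) (ereal b)) (\<lambda>t. exp (\<delta> * t)) \<and>
      (LBINT t=-\<infinity>..ereal b. exp (\<delta> * t)) = exp (\<delta> * b) / \<delta> - 0"
    proof (intro conjI interval_integral_FTC_nonneg[where F = "\<lambda>t. exp (\<delta> * t) / \<delta>"])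
      show "((\<lambda>t. exp (\<delta> * t) / \<delta>) has_real_derivative exp (\<delta> * x)) (at x)"
        "((\<lambda>t. exp (\<delta> * t) / \<delta>) has_real_derivative exp (\<delta> * x)) (at x)" for x
        using assms by (auto intro!: derivative_eq_intros)
    qed (use * ** in \<open>auto simp: ereal_tendsto_simps1 intro!: continuous_intros\<close>)
    then show "set_integrable lborel (einterval (-\<infinity>) (ereal b)) (\<lambda>t. exp (\<delta> * t))"
      "(LBINT t=-\<infinity>..ereal b. exp (\<delta> * t)) = exp (\<delta> * b) / \<delta> - 0" by auto
  qed
  show ?A by (rule set_integrable_subset[OF FTC(1)[of "T + 1"]]) (auto simp: einterval_def)
  have e: "einterval (-\<infinity>) (ereal T) = {..<T}" by (auto simp: einterval_def)
  have "(LINT t:{..T}|lborel. exp (\<delta> * t)) = (LINT t:{..<T}|lborel. exp (\<delta> * t))"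
  proof (rule set_integral_cong_set)
    show "AE t in lborel. t \<in> {..<T} \<longleftrightarrow> t \<in> {..T}"
      using AE_lborel_singleton[of T] by eventually_elim auto
  qed (simp_all add: set_borel_measurable_def)
  then show ?B using FTC(2)[of T] by (simp add: interval_lebesgue_integral_def e)
qed

text \<open>The function \<open>h t * exp (ln \<kappa> * t)\<close> does not increase when
  \<open>t \<le> R\<close> is replaced by \<open>t - 1\<close>. It is therefore bounded by its
  maximum on \<open>{R - 1..M}\<close>, which contains a full unit step below
  \<open>R\<close>.\<close>

lemma geometric_decay_exp_bound:
  fixes h :: "real \<Rightarrow> real"
  assumes "continuous_on {..M} h" "R \<le> M" "0 < \<kappa>" "\<And>t. t \<le> R \<Longrightarrow> h (t - 1) \<le> \<kappa> * h t"
  obtains C where "\<And>t. t \<le> M \<Longrightarrow> h t \<le> C * exp (- ln \<kappa> * t)"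
proof -
  let ?e = "\<lambda>t. h t * exp (ln \<kappa> * t)"
  have "compact (?e ` {R - 1..M})"
    by (intro compact_continuous_image continuous_intros continuous_on_subset[OF assms(1)]) auto
  then obtain C where C: "\<And>t. R - 1 \<le> t \<Longrightarrow> t \<le> M \<Longrightarrow> ?e t \<le> C"
    by (fastforce dest!: compact_imp_bounded bounded_imp_bdd_above simp: bdd_above_def)
  have ind: "?e t \<le> C" if "R - 1 - real m \<le> t" "t \<le> M" for t m
    using that
  proof (induction m arbitrary: t)
    case 0
    then show ?case using C by simp
  next
    case (Suc m)
    show ?case
    proof (cases "R - 1 \<le> t")
      case True
      then show ?thesis using C Suc.prems by simp
    next
      case False
      have "h t \<le> \<kappa> * h (t + 1)" using assms(4)[of "t + 1"] False by simp
      then have "?e t \<le> \<kappa> * h (t + 1) * exp (ln \<kappa> * t)" by simp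
      also have "\<dots> = ?e (t + 1)" using assms(3) by (simp add: distrib_left exp_add)
      also have "\<dots> \<le> C" using Suc.IH[of "t + 1"] Suc.prems False assms(2) by simp
      finally show ?thesis .
    qed
  qed
  have "h t \<le> C * exp (- ln \<kappa> * t)" if "t \<le> M" for t
  proof -
    obtain m where "R - 1 - t \<le> real m" using real_arch_simple by blast
    then have "h t * exp (ln \<kappa> * t) \<le> C" using ind[of m t] that by simp
    then have "h t * exp (ln \<kappa> * t) * exp (- ln \<kappa> * t) \<le> C * exp (- ln \<kappa> * t)" by (intro mult_right_mono) auto
    then show ?thesis by (simp add: mult.assoc flip: exp_add)
  qed
  then show thesis by (rule that)
qed

lemma geometric_decay_integral:
  fixes F :: "real \<Rightarrow> complex"
  assumes "continuous_on {..M} F" "R \<le> M" "0 < \<kappa>" "\<kappa> < 1"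
    and "\<And>t. t \<le> R \<Longrightarrow> norm (F (t - 1)) \<le> \<kappa> * norm (F t)"
  shows "set_integrable lborel {..M} F"
    and "((\<lambda>T. LINT t:{..T}|lborel. F t) \<longlongrightarrow> 0) at_bot"
proof -
  define \<delta> where "\<delta> = - ln \<kappa>"
  have \<delta>: "\<delta> > 0" using assms(3,4) by (simp add: \<delta>_def)
  obtain C where C: "\<And>t. t \<le> M \<Longrightarrow> norm (F t) \<le> C * exp (\<delta> * t)"
    unfolding \<delta>_def
    using geometric_decay_exp_bound[OF continuous_on_norm[OF assms(1)] assms(2,3,5)] by blast
  have int: "set_integrable lborel {..T} (\<lambda>t. C * exp (\<delta> * t))" for T
    by (intro set_integrable_mult_right exp_half_line_integral \<delta>)
  show F: "set_integrable lborel {..M} F"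
  proof (rule set_integrable_bound[OF int[of M]])
    have "(\<lambda>t. indicator {..M} t *\<^sub>R F t) \<in> borel_measurable borel"
      by (intro borel_measurable_continuous_on_indicator assms(1)) simp
    then show "set_borel_measurable lborel {..M} F" by (simp add: set_borel_measurable_def)
    show "AE t in lborel. t \<in> {..M} \<longrightarrow> norm (F t) \<le> norm (C * exp (\<delta> * t))"
      using C by (intro AE_I2) (force intro: order_trans[OF _ abs_ge_self])
  qed
  have "norm (LINT t:{..T}|lborel. F t) \<le> C * (exp (\<delta> * T) / \<delta>)" if "T \<le> M" for T
  proof -
    have FT: "set_integrable lborel {..T} F"
      by (rule set_integrable_subset[OF F]) (use that in auto)
    have "norm (LINT t:{..T}|lborel. F t) \<le> (LINT t:{..T}|lborel. norm (F t))"
      by (rule set_integral_norm_bound[OF FT])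
    also have "\<dots> \<le> (LINT t:{..T}|lborel. C * exp (\<delta> * t))"
      by (intro set_integral_mono set_integrable_norm FT int) (use C that in auto)
    also have "\<dots> = C * (exp (\<delta> * T) / \<delta>)"
      using exp_half_line_integral(2)[OF \<delta>, of T] by (simp only: set_integral_mult_right)
    finally show ?thesis .
  qed
  then have "\<forall>\<^sub>F T in at_bot. norm (LINT t:{..T}|lborel. F t) \<le> C * (exp (\<delta> * T) / \<delta>)"
    by (rule eventually_mono[OF eventually_le_at_bot[of M]])
  moreover have "((\<lambda>T. C * (exp (\<delta> * T) / \<delta>)) \<longlongrightarrow> 0) at_bot" using \<delta> by real_asymp
  ultimately show "((\<lambda>T. LINT t:{..T}|lborel. F t) \<longlongrightarrow> 0) at_bot" by (rule Lim_null_comparison)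
qed

lemma contour_integral_linepath_horizontal:
  assumes "p < q"
  shows "contour_integral (linepath (Complex p s) (Complex q s)) f = integral {p..q} (\<lambda>t. f (Complex t s))"
proof -
  let ?g = "\<lambda>w. f (w + \<i> * of_real s)"
  have e: "linepath (Complex p s) (Complex q s) t = linepath (of_real p) (of_real q) t + \<i> * of_real s" for t
    by (simp add: complex_eq_iff linepath_def algebra_simps)
  have d: "Complex (q - p) 0 = of_real q - of_real p" by (simp add: complex_eq_iff)
  have "contour_integral (linepath (Complex p s) (Complex q s)) f
      = contour_integral (linepath (of_real p) (of_real q)) ?g"
    unfolding contour_integral_integral by (simp add: e d complex_diff)
  also have "\<dots> = integral {p..q} (\<lambda>t. ?g (of_real t))"
    using assms by (subst contour_integral_linepath_Reals_eq) auto
  finally show ?thesis by (simp add: Complex_eq add.commute mult.commute)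
qed

text \<open>The rays to the left of \<open>P\<close> cancel, and the remaining pieces form the
  boundary of a rectangle.\<close>

lemma left_contour_integral_diff:
  assumes "P < M" "r > 0"
    and cont: "continuous_on (path_image (rectpath (Complex P (- r)) (Complex M r))) f"
    and int: "set_integrable lborel {..M} (\<lambda>t. f (Complex t (- r)))" "set_integrable lborel {..M} (\<lambda>t. f (Complex t r))"
  shows "left_contour_integral M r f - left_contour_integral P r f
    = contour_integral (rectpath (Complex P (- r)) (Complex M r)) f"
proof -
  have cs: "closed_segment (Complex P (- r)) (Complex M (- r)) \<union> closed_segment (Complex M (- r)) (Complex M r)
     \<union> closed_segment (Complex M r) (Complex P r) \<union> closed_segment (Complex P r) (Complex P (- r))
     = path_image (rectpath (Complex P (- r)) (Complex M r))"
    by (simp add: rectpath_def Let_def path_image_join Un_assoc)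
  have c: "continuous_on (closed_segment (Complex P (- r)) (Complex M (- r))) f"
    "continuous_on (closed_segment (Complex M (- r)) (Complex M r)) f"
    "continuous_on (closed_segment (Complex M r) (Complex P r)) f"
    "continuous_on (closed_segment (Complex P r) (Complex P (- r))) f"
    by (rule continuous_on_subset[OF cont], use cs in blast)+
  have split: "(LINT t:{..M}|lborel. g t) - (LINT t:{..P}|lborel. g t) = integral {P..M} g"
    if g: "set_integrable lborel {..M} g" for g :: "real \<Rightarrow> complex"
  proof -
    have "set_integrable lborel {..P} g" "set_integrable lborel {P<..M} g" "set_integrable lborel {P..M} g"
      using assms(1) by (auto intro!: set_integrable_subset[OF g])
    note i = this
    have "{..P} \<inter> {P<..M} = {}" by auto
    note u = set_integral_Un[OF this i(1,2)]
    have "{..M} = {..P} \<union> {P<..M}" using assms(1) by auto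
    then have "(LINT t:{..M}|lborel. g t) - (LINT t:{..P}|lborel. g t) = (LINT t:{P<..M}|lborel. g t)"
      using u by simp
    also have "\<dots> = (LINT t:{P..M}|lborel. g t)"
    proof (rule set_integral_cong_set)
      show "AE t in lborel. t \<in> {P..M} \<longleftrightarrow> t \<in> {P<..M}"
        using AE_lborel_singleton[of P] by eventually_elim auto
    qed (use i in \<open>auto simp: set_integrable_def set_borel_measurable_def\<close>)
    also have "\<dots> = integral {P..M} g" by (rule set_borel_integral_eq_integral(2)[OF i(3)])
    finally show ?thesis .
  qed
  have "contour_integral (rectpath (Complex P (- r)) (Complex M r)) f
    = contour_integral (linepath (Complex P (- r)) (Complex M (- r))) f
      + contour_integral (linepath (Complex M (- r)) (Complex M r)) f
      + contour_integral (linepath (Complex M r) (Complex P r)) f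
      + contour_integral (linepath (Complex P r) (Complex P (- r))) f"
    using c by (simp add: rectpath_def Let_def contour_integrable_continuous_linepath add.assoc)
  also have "contour_integral (linepath (Complex M r) (Complex P r)) f = - integral {P..M} (\<lambda>t. f (Complex t r))"
    using contour_integral_reverse_linepath[OF c(3)] contour_integral_linepath_horizontal[OF assms(1)] by simp
  also have "contour_integral (linepath (Complex P r) (Complex P (- r))) f
     = - contour_integral (linepath (Complex P (- r)) (Complex P r)) f"
    by (rule contour_integral_reverse_linepath[OF c(4)])
  finally show ?thesis
    using split[OF int(1)] split[OF int(2)]
    by (simp add: left_contour_integral_def contour_integral_linepath_horizontal[OF assms(1)] algebra_simps)
qed

text \<open>\<open>Gamma a / Gamma (a - k)\<close> is a falling factorial, and
  \<open>(- 1) ^ k / fact k\<close> is the residue of \<open>Gamma\<close> at \<open>- k\<close>;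
  together they form a binomial coefficient. For a positive integer \<open>a\<close> and
  \<open>k \<ge> a\<close> both sides are 0, which is why \<open>rGamma\<close> is used.\<close>

lemma rGamma_shift_down:
  "Gamma (of_real a :: complex) * rGamma (of_real a - of_nat k) * ((- 1) ^ k / fact k)
    = ((of_real a - 1) gchoose k) * (- 1) ^ k"
  if "a > 0" for a :: real
proof -
  have p: "rGamma (of_real a - of_nat k :: complex) = pochhammer (of_real a - of_nat k) k * rGamma (of_real a)"
    using pochhammer_rGamma[of "of_real a - of_nat k :: complex" k] by simp
  have one: "Gamma (of_real a :: complex) * rGamma (of_real a) = 1"
  proof -
    have "of_real a \<notin> (\<int>\<^sub>\<le>\<^sub>0 :: complex set)" using that by (intro half_plane_notin_nonpos_Ints) simp
    then have "Gamma (of_real a :: complex) \<noteq> 0" by (simp add: Gamma_eq_zero_iff)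
    then show ?thesis by (simp add: rGamma_inverse_Gamma)
  qed
  have "Gamma (of_real a :: complex) * rGamma (of_real a - of_nat k)
      = pochhammer (of_real a - of_nat k) k * (Gamma (of_real a) * rGamma (of_real a))"
    unfolding p by (simp only: mult_ac)
  moreover have "((of_real a - 1 :: complex) gchoose k) = pochhammer (of_real a - of_nat k) k / fact k"
    by (simp add: gbinomial_pochhammer')
  ultimately show ?thesis by (simp add: one)
qed

section \<open>Decay and residues of the one-power integrand\<close>

definition mellin_integrand :: "complex \<Rightarrow> real \<Rightarrow> int \<Rightarrow> complex \<Rightarrow> complex" where
  "mellin_integrand x a n z = x powr z * beta_ratio a z n"

context
  fixes x :: complex and a :: real and n :: int
  assumes x: "norm x > 1" and a: "a > 0"
begin

abbreviation "F \<equiv> mellin_integrand x a n"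

lemma x_nonzero: "x \<noteq> 0" using x by auto

lemma pole_iff: "z - of_int n \<in> \<int>\<^sub>\<le>\<^sub>0 \<longleftrightarrow> (\<exists>k. z = of_int n - of_nat k)" for z :: complex
proof
  assume "z - of_int n \<in> \<int>\<^sub>\<le>\<^sub>0"
  then obtain k where "z - of_int n = - of_nat k" by (elim nonpos_Ints_cases')
  then have "z = of_int n - of_nat k" by (simp add: algebra_simps)
  then show "\<exists>k. z = of_int n - of_nat k" ..
next
  assume "\<exists>k. z = of_int n - of_nat k"
  then obtain k where "z - of_int n = of_int (- int k)" by auto
  then show "z - of_int n \<in> \<int>\<^sub>\<le>\<^sub>0" by (simp only:) (rule nonpos_Ints_of_int, simp)
qed

text \<open>For fixed \<open>x\<close> the power is entire in \<open>z\<close>, with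
  \<open>Ln x\<close> taken on the branch that has imaginary part \<open>pi\<close> on the negative
  axis. The reciprocal Gamma factor is entire too, so only the poles of \<open>Gamma (z - n)\<close>
  remain.\<close>

lemma mellin_holomorphic: "F holomorphic_on {z. z - of_int n \<notin> \<int>\<^sub>\<le>\<^sub>0}"
proof -
  have "(\<lambda>z. exp (z * Ln x) * (Gamma (z - of_int n) * rGamma (z - of_int n + of_real a)))
      holomorphic_on {z. z - of_int n \<notin> \<int>\<^sub>\<le>\<^sub>0}"
    by (intro holomorphic_intros) auto
  moreover have "F = (\<lambda>z. exp (z * Ln x) * (Gamma (z - of_int n) * rGamma (z - of_int n + of_real a)))"
    using x_nonzero by (simp add: fun_eq_iff mellin_integrand_def beta_ratio_def powr_def rGamma_inverse_Gamma divide_inverse)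
  ultimately show ?thesis by simp
qed

lemma mellin_continuous:
  assumes "\<And>z. z \<in> A \<Longrightarrow> z - of_int n \<notin> \<int>\<^sub>\<le>\<^sub>0"
  shows "continuous_on A F"
  by (rule holomorphic_on_imp_continuous_on, rule holomorphic_on_subset[OF mellin_holomorphic]) (use assms in auto)

text \<open>The functional equation of \<open>Gamma\<close> gives
  \<open>F (z - 1) = F z * (1 + a / (z - n - 1)) / x\<close>. The middle factor tends to 1 far to
  the left, so \<open>norm x > 1\<close> makes every unit step a contraction, and no asymptotics of
  \<open>Gamma\<close> enter.\<close>

lemma mellin_decay:
  obtains R \<kappa> where "0 < \<kappa>" "\<kappa> < 1"
    "\<And>z. Re z \<le> R \<Longrightarrow> z - of_int n \<notin> \<int>\<^sub>\<le>\<^sub>0 \<Longrightarrow> norm (F (z - 1)) \<le> \<kappa> * norm (F z)"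
proof -
  \<comment> \<open>With this choice \<open>1 + e\<close> lies midway between 1 and
    \<open>norm x\<close>, hence \<open>\<kappa> < 1\<close>. The threshold \<open>n - a / e\<close>
    below is what bounds \<open>a / norm (z - n - 1)\<close> by \<open>e\<close>.\<close>
  define e where "e = (norm x - 1) / 2"
  have e: "e > 0" using x by (simp add: e_def)
  define \<kappa> where "\<kappa> = (1 + e) / norm x"
  show thesis
  proof (rule that[of \<kappa> "of_int n - a / e"])
    have "1 + e < norm x" using x by (simp add: e_def field_simps)
    then show "0 < \<kappa>" "\<kappa> < 1" using x e by (auto simp: \<kappa>_def divide_less_eq intro!: divide_pos_pos)
    fix z assume z: "Re z \<le> of_int n - a / e" "z - of_int n \<notin> \<int>\<^sub>\<le>\<^sub>0"
    let ?w = "z - of_int n - 1"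
    have w: "?w \<notin> \<int>\<^sub>\<le>\<^sub>0"
    proof
      assume "?w \<in> \<int>\<^sub>\<le>\<^sub>0"
      then obtain m where m: "?w = - of_nat m" by (auto elim: nonpos_Ints_cases')
      have "m \<noteq> 0"
      proof
        assume "m = 0"
        then have "Re z = of_int n + 1" using m by (simp add: complex_eq_iff)
        then show False using z(1) a e by (smt (verit) divide_pos_pos)
      qed
      then obtain m' where "m = Suc m'" by (cases m) auto
      then have "z - of_int n = of_int (- int m')" using m by (simp add: algebra_simps)
      then show False using z(2) nonpos_Ints_of_int[of "- int m'"] by simp
    qed
    have "a / e \<le> \<bar>Re ?w\<bar>" using z(1) a e by (smt (verit) Re_complex_of_real complex_Re_of_int minus_complex.sel(1) one_complex.sel(1))
    then have "a / e \<le> norm ?w" using abs_Re_le_cmod[of ?w] by linarith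
    moreover have "norm ?w > 0" using w by auto
    ultimately have "a / norm ?w \<le> e" using e by (simp add: field_simps)
    then have u: "norm (1 + of_real a / ?w) \<le> 1 + e"
      using norm_triangle_ineq[of 1 "of_real a / ?w"] a by (simp add: norm_divide)
    have "F (z - 1) = F z * ((1 + of_real a / ?w) / x)"
    proof -
      have "beta_ratio a (z - 1) n = beta_ratio a z n * (1 + of_real a / ?w)"
        using Gamma_ratio_shift[OF w, of "of_real a"] by (simp add: beta_ratio_def algebra_simps)
      moreover have "x powr (z - 1) = x powr z / x" using x_nonzero by (simp add: powr_diff)
      ultimately show ?thesis by (simp add: mellin_integrand_def)
    qed
    then have "norm (F (z - 1)) = norm (1 + of_real a / ?w) / norm x * norm (F z)"
      by (simp only: norm_mult norm_divide mult.commute)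
    also have "\<dots> \<le> \<kappa> * norm (F z)"
      unfolding \<kappa>_def by (intro mult_right_mono divide_right_mono u) auto
    finally show "norm (F (z - 1)) \<le> \<kappa> * norm (F z)" .
  qed
qed

lemma horizontal_no_pole: "s \<noteq> 0 \<Longrightarrow> Complex t s - of_int n \<notin> \<int>\<^sub>\<le>\<^sub>0"
  by (auto elim!: nonpos_Ints_cases simp: complex_eq_iff)

lemma mellin_horizontal:
  assumes "s \<noteq> 0"
  shows "set_integrable lborel {..M} (\<lambda>t. F (Complex t s))"
    and "((\<lambda>T. LINT t:{..T}|lborel. F (Complex t s)) \<longlongrightarrow> 0) at_bot"
proof -
  obtain R \<kappa> where k: "0 < \<kappa>" "\<kappa> < 1"
    "\<And>z. Re z \<le> R \<Longrightarrow> z - of_int n \<notin> \<int>\<^sub>\<le>\<^sub>0 \<Longrightarrow> norm (F (z - 1)) \<le> \<kappa> * norm (F z)"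
    using mellin_decay by blast
  have np: "z - of_int n \<notin> \<int>\<^sub>\<le>\<^sub>0" if "Im z = s" for z
    using horizontal_no_pole[OF assms, of "Re z"] that by (metis complex.exhaust_sel)
  have "continuous_on {z. Im z = s} F" using np by (intro mellin_continuous) auto
  moreover have "continuous_on {..T} (\<lambda>t. Complex t s)" for T
    unfolding Complex_eq by (intro continuous_intros)
  ultimately have c: "continuous_on {..T} (\<lambda>t. F (Complex t s))" for T
    by (rule continuous_on_compose2) auto
  have d: "norm (F (Complex (t - 1) s)) \<le> \<kappa> * norm (F (Complex t s))" if "t \<le> R" for t
  proof -
    have "Complex (t - 1) s = Complex t s - 1" by (simp add: complex_eq_iff)
    then show ?thesis using k(3)[of "Complex t s"] np that by simp
  qed
  show "set_integrable lborel {..M} (\<lambda>t. F (Complex t s))"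
    by (rule set_integrable_subset[OF geometric_decay_integral(1)[OF c[of "max M R"] _ k(1,2) d]]) auto
  show "((\<lambda>T. LINT t:{..T}|lborel. F (Complex t s)) \<longlongrightarrow> 0) at_bot"
    by (rule geometric_decay_integral(2)[OF c order.refl k(1,2) d])
qed

lemma half_integer_no_pole: "Re z = of_int n - real K - 1 / 2 \<Longrightarrow> z - of_int n \<notin> \<int>\<^sub>\<le>\<^sub>0"
proof
  assume z: "Re z = of_int n - real K - 1 / 2" and "z - of_int n \<in> \<int>\<^sub>\<le>\<^sub>0"
  then obtain m where "z - of_int n = of_int m" by (auto elim: nonpos_Ints_cases)
  then have "Re (z - of_int n) = of_int m" by simp
  then have "2 * of_int m = (- 2 * of_nat K - 1 :: real)" using z by simp
  then have "(of_int (2 * m) :: real) = of_int (- 2 * int K - 1)" by simp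
  then have "2 * m = - 2 * int K - 1" by (simp only: of_int_eq_iff)
  then show False by presburger
qed

text \<open>The segments lie midway between consecutive poles and are integer translates of each
  other. A bound on one of them, far enough to the left, is carried to the next by
  \<open>mellin_decay\<close> with a factor \<open>\<kappa>\<close> per step.\<close>

lemma mellin_vertical:
  assumes "r > 0"
  shows "(\<lambda>K. contour_integral (linepath (Complex (of_int n - real K - 1 / 2) (- r))
      (Complex (of_int n - real K - 1 / 2) r)) F) \<longlonglongrightarrow> 0"
proof -
  let ?P = "\<lambda>K. of_int n - real K - 1 / 2"
  let ?S = "\<lambda>K. closed_segment (Complex (?P K) (- r)) (Complex (?P K) r)"
  have S: "?S K = {z. Re z = ?P K \<and> Im z \<in> {- r..r}}" for K
    using assms by (subst closed_segment_same_Re) (auto simp: closed_segment_eq_real_ivl)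
  have cont: "continuous_on (?S K) F" for K
    by (rule mellin_continuous, rule half_integer_no_pole[of _ K]) (auto simp: S)
  obtain R \<kappa> where k: "0 < \<kappa>" "\<kappa> < 1"
    "\<And>z. Re z \<le> R \<Longrightarrow> z - of_int n \<notin> \<int>\<^sub>\<le>\<^sub>0 \<Longrightarrow> norm (F (z - 1)) \<le> \<kappa> * norm (F z)"
    using mellin_decay by blast
  obtain L where L: "of_int n - R \<le> real L" using real_arch_simple by blast
  have "bounded (F ` ?S L)"
    by (intro compact_imp_bounded compact_continuous_image cont compact_segment)
  then obtain B where B: "B > 0" "\<And>z. z \<in> ?S L \<Longrightarrow> norm (F z) \<le> B"
    by (auto simp: bounded_pos)
  have ind: "norm (F (z - of_nat j)) \<le> \<kappa> ^ j * B" if z: "z \<in> ?S L" for z j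
  proof (induction j)
    case 0
    then show ?case using B z by simp
  next
    case (Suc j)
    have re: "Re (z - of_nat j) = ?P (L + j)" using z by (simp add: S)
    then have "norm (F (z - of_nat j - 1)) \<le> \<kappa> * norm (F (z - of_nat j))"
      using L by (intro k(3) half_integer_no_pole[of _ "L + j"]) auto
    also have "\<dots> \<le> \<kappa> * (\<kappa> ^ j * B)" using Suc k(1) by (intro mult_left_mono) auto
    finally show ?case by (simp add: algebra_simps)
  qed
  have bound: "norm (contour_integral (linepath (Complex (?P (j + L)) (- r)) (Complex (?P (j + L)) r)) F)
      \<le> \<kappa> ^ j * B * (2 * r)" for j
  proof -
    have "norm (F z) \<le> \<kappa> ^ j * B" if "z \<in> ?S (j + L)" for z
    proof -
      have "Re z = ?P (j + L)" "Im z \<in> {- r..r}" using that unfolding S by auto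
      then have "z + of_nat j \<in> ?S L" unfolding S by simp
      from ind[OF this, of j] show ?thesis by simp
    qed
    then have "norm (contour_integral (linepath (Complex (?P (j + L)) (- r)) (Complex (?P (j + L)) r)) F)
      \<le> \<kappa> ^ j * B * norm (Complex (?P (j + L)) r - Complex (?P (j + L)) (- r))"
      using B(1) k(1) by (intro contour_integral_bound_linepath contour_integrable_continuous_linepath cont) auto
    moreover have "norm (Complex (?P (j + L)) r - Complex (?P (j + L)) (- r)) = 2 * r"
      using assms by (simp add: complex_diff cmod_eq_Im)
    ultimately show ?thesis by simp
  qed
  have "(\<lambda>j. \<kappa> ^ j * B * (2 * r)) \<longlonglongrightarrow> 0"
    using k(1,2) by (intro tendsto_mult_left_zero LIMSEQ_power_zero) auto
  then have "(\<lambda>j. contour_integral (linepath (Complex (?P (j + L)) (- r)) (Complex (?P (j + L)) r)) F) \<longlonglongrightarrow> 0"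
    by (rule Lim_null_comparison[OF always_eventually[OF allI[OF bound]]])
  then show ?thesis by (rule LIMSEQ_offset)
qed

lemma mellin_residue:
  "residue F (of_int n - of_nat k)
    = x powi n * (- inverse x) ^ k * rGamma (of_real a - of_nat k) / fact k"
proof -
  let ?p = "of_int n - of_nat k :: complex"
  have "F holomorphic_on (ball ?p 1 - {?p})"
  proof (rule holomorphic_on_subset[OF mellin_holomorphic], rule subsetI)
    fix z assume z: "z \<in> ball ?p 1 - {?p}"
    have False if zk: "z = of_int n - of_nat m" for m
    proof -
      have "dist ?p z = \<bar>of_int (int m - int k)\<bar>"
        unfolding dist_norm zk by (metis (no_types, opaque_lifting) add_diff_cancel_left' diff_add_cancel diff_diff_eq2 norm_of_int of_int_diff of_int_of_nat_eq)
      moreover have "m \<noteq> k" using z zk by auto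
      ultimately have "dist ?p z \<ge> 1" by linarith
      then show False using z by simp
    qed
    then show "z \<in> {z. z - of_int n \<notin> \<int>\<^sub>\<le>\<^sub>0}" using pole_iff by blast
  qed
  moreover have "((\<lambda>w. F w * (w - ?p)) \<longlongrightarrow>
      exp (?p * Ln x) * rGamma (?p - of_int n + of_real a) * ((- 1) ^ k / fact k)) (at ?p)"
  proof -
    have "((\<lambda>w. exp (w * Ln x) * rGamma (w - of_int n + of_real a)) \<longlongrightarrow> exp (?p * Ln x) * rGamma (?p - of_int n + of_real a)) (at ?p)"
    proof -
      have "isCont (\<lambda>w. exp (w * Ln x) * rGamma (w - of_int n + of_real a)) ?p" by (intro continuous_intros)
      then show ?thesis by (simp only: isCont_def)
    qed
    moreover have "(\<lambda>w. Gamma (w - of_int n) * (w - ?p)) \<midarrow>?p\<rightarrow> ((- 1) ^ k / fact k)"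
      using LIM_offset[OF Gamma_residues[of k, where 'a = complex], of "- of_int n"] by (simp add: algebra_simps)
    ultimately have "((\<lambda>w. exp (w * Ln x) * rGamma (w - of_int n + of_real a) * (Gamma (w - of_int n) * (w - ?p)))
      \<longlongrightarrow> exp (?p * Ln x) * rGamma (?p - of_int n + of_real a) * ((- 1) ^ k / fact k)) (at ?p)"
      by (rule tendsto_mult)
    then show ?thesis
      using x_nonzero by (simp add: mellin_integrand_def beta_ratio_def powr_def rGamma_inverse_Gamma divide_inverse mult_ac)
  qed
  ultimately have "residue F ?p = exp (?p * Ln x) * rGamma (?p - of_int n + of_real a) * ((- 1) ^ k / fact k)"
    by (intro residue_simple'[of "ball ?p 1"]) auto
  moreover have "exp (?p * Ln x) = x powi n * inverse x ^ k"
  proof -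
    have "exp (?p * Ln x) = x powr of_int (n - int k)" using x_nonzero by (simp add: powr_def)
    also have "\<dots> = x powi (n - int k)" using x_nonzero by (intro complex_powr_of_int) simp
    finally show ?thesis using x_nonzero by (simp add: power_int_diff divide_inverse power_inverse)
  qed
  moreover have "?p - of_int n + of_real a = of_real a - of_nat k" by simp
  moreover have "(- inverse x) ^ k = (- 1) ^ k * inverse x ^ k" by (rule power_minus)
  ultimately show ?thesis by simp
qed

lemma mellin_rectangle:
  assumes "M > of_int n" "r > 0"
  shows "contour_integral (rectpath (Complex (of_int n - real K - 1 / 2) (- r)) (Complex M r)) F
     = 2 * of_real pi * \<i> * (\<Sum>k\<le>K. residue F (of_int n - of_nat k))"
proof -
  let ?P = "of_int n - real K - 1 / 2"
  let ?g = "rectpath (Complex ?P (- r)) (Complex M r)"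
  \<comment> \<open>The bound \<open>?P - 1 / 2\<close> equals \<open>n - K - 1\<close>, the first
    pole that is left out, so the poles in the half plane \<open>?S\<close> are exactly
    \<open>?pts\<close>.\<close>
  let ?S = "{z. Re z > ?P - 1 / 2}" and ?pts = "(\<lambda>k. of_int n - of_nat k :: complex) ` {..K}"
  have PM: "?P \<le> M" using assms by simp
  have np: "z - of_int n \<notin> \<int>\<^sub>\<le>\<^sub>0" if z: "z \<in> ?S - ?pts" for z
  proof
    assume "z - of_int n \<in> \<int>\<^sub>\<le>\<^sub>0"
    then obtain k where k: "z = of_int n - of_nat k" using pole_iff by blast
    then have "real k < real K + 1" using z by simp
    then have "k \<le> K" by linarith
    then show False using z k by auto
  qed
  have img: "path_image ?g \<subseteq> ?S - ?pts"
  proof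
    fix z assume "z \<in> path_image ?g"
    then have z: "(Re z = ?P \<or> Re z = M \<or> Im z = - r \<or> Im z = r) \<and> ?P \<le> Re z"
      using PM assms(2) by (auto simp: path_image_rectpath)
    have "z - of_int n \<notin> \<int>\<^sub>\<le>\<^sub>0"
    proof (cases "Re z = ?P")
      case True
      then show ?thesis by (rule half_integer_no_pole)
    next
      case False
      then show ?thesis using z assms by (intro half_plane_notin_nonpos_Ints) auto
    qed
    moreover have "p - of_int n \<in> \<int>\<^sub>\<le>\<^sub>0" if "p \<in> ?pts" for p using that pole_iff by auto
    ultimately show "z \<in> ?S - ?pts" using z by auto
  qed
  have w1: "winding_number ?g p = 1" if "p \<in> ?pts" for p
    using that assms by (intro winding_number_rectpath) (auto simp: in_box_complex_iff)
  have "contour_integral ?g F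
    = 2 * pi * \<i> * (\<Sum>p\<in>?pts. winding_number ?g p * residue F p)"
  proof (rule Residue_theorem)
    show "open ?S" by (rule open_halfspace_Re_gt)
    show "connected ?S" by (intro convex_connected convex_halfspace_Re_gt)
    show "F holomorphic_on ?S - ?pts"
      by (rule holomorphic_on_subset[OF mellin_holomorphic]) (use np in auto)
    show "\<forall>z. z \<notin> ?S \<longrightarrow> winding_number ?g z = 0"
    proof (intro allI impI)
      fix z assume "z \<notin> ?S"
      then show "winding_number ?g z = 0"
        using img by (intro winding_number_zero_outside[of _ ?S] convex_halfspace_Re_gt) auto
    qed
  qed (use img in auto)
  also have "(\<Sum>p\<in>?pts. winding_number ?g p * residue F p) = (\<Sum>p\<in>?pts. residue F p)"
    by (intro sum.cong refl) (simp add: w1)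
  also have "\<dots> = (\<Sum>k\<le>K. residue F (of_int n - of_nat k))"
    by (subst sum.reindex) (auto simp: inj_on_def)
  finally show ?thesis by simp
qed

text \<open>Pushing the vertical side to the left through the half-integers \<open>?P K\<close>
  leaves a contour integral that tends to 0, and the rectangles in between collect residues. Their
  partial sums converge to \<open>(1 - inverse x) powr (a - 1)\<close> because
  \<open>norm (inverse x) < 1\<close>.\<close>

theorem mellin_left_contour:
  assumes "M > of_int n" "r > 0"
  shows "left_contour_abs_convergent M r F"
    and "Gamma (of_real a) * left_contour_integral M r F
      = 2 * of_real pi * \<i> * (x powi n * (1 - inverse x) powr (of_real a - 1))"
proof -
  have seg: "continuous_on (closed_segment (Complex M (- r)) (Complex M r)) F"
    using assms by (intro mellin_continuous half_plane_notin_nonpos_Ints)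
      (auto simp: closed_segment_same_Re)
  have "continuous_on {- r..r} (\<lambda>s. F (Complex M s))"
  proof (rule continuous_on_compose2[OF seg])
    show "continuous_on {- r..r} (Complex M)" unfolding Complex_eq by (intro continuous_intros)
    show "Complex M ` {- r..r} \<subseteq> closed_segment (Complex M (- r)) (Complex M r)"
      by (subst closed_segment_same_Re) (auto simp: closed_segment_eq_real_ivl)
  qed
  then have "set_integrable lborel {- r..r} (\<lambda>s. F (Complex M s))"
    by (rule borel_integrable_atLeastAtMost')
  then show "left_contour_abs_convergent M r F"
    using assms by (simp add: left_contour_abs_convergent_def mellin_horizontal(1))
  let ?P = "\<lambda>K. of_int n - real K - 1 / 2"
  let ?I = "left_contour_integral M r F"
  let ?c = "2 * of_real pi * \<i> :: complex"
  have step: "?I - left_contour_integral (?P K) r F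
      = ?c * (\<Sum>k\<le>K. residue F (of_int n - of_nat k))" for K
  proof -
    have "continuous_on (path_image (rectpath (Complex (?P K) (- r)) (Complex M r))) F"
    proof (rule mellin_continuous)
      fix z assume z: "z \<in> path_image (rectpath (Complex (?P K) (- r)) (Complex M r))"
      show "z - of_int n \<notin> \<int>\<^sub>\<le>\<^sub>0"
      proof (cases "Re z = ?P K")
        case True
        then show ?thesis by (rule half_integer_no_pole)
      next
        case False
        then show ?thesis using z assms
          by (intro half_plane_notin_nonpos_Ints) (auto simp: path_image_rectpath)
      qed
    qed
    then show ?thesis
      using assms mellin_horizontal(1) mellin_rectangle[OF assms]
      by (subst left_contour_integral_diff) auto
  qed
  have P: "filterlim ?P at_bot sequentially" by real_asymp
  have "(\<lambda>K. left_contour_integral (?P K) r F) \<longlonglongrightarrow> 0 + 0 - 0"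
    unfolding left_contour_integral_def
    using assms(2) by (intro tendsto_add tendsto_diff mellin_vertical
      filterlim_compose[OF mellin_horizontal(2) P]) auto
  then have "(\<lambda>K. ?I - left_contour_integral (?P K) r F) \<longlonglongrightarrow> ?I - (0 + 0 - 0)"
    by (intro tendsto_diff tendsto_const)
  then have "(\<lambda>K. Gamma (of_real a) * (?c * (\<Sum>k\<le>K. residue F (of_int n - of_nat k))))
      \<longlonglongrightarrow> Gamma (of_real a) * ?I"
    unfolding step by (intro tendsto_mult tendsto_const) simp
  moreover have "(\<lambda>K. Gamma (of_real a) * (?c * (\<Sum>k\<le>K. residue F (of_int n - of_nat k))))
      \<longlonglongrightarrow> ?c * (x powi n * (1 - inverse x) powr (of_real a - 1))"
  proof -
    have "Gamma (of_real a) * residue F (of_int n - of_nat k)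
      = x powi n * (((of_real a - 1) gchoose k) * (- inverse x) ^ k)" for k
    proof -
      have "Gamma (of_real a) * residue F (of_int n - of_nat k)
        = x powi n * (inverse x ^ k * (Gamma (of_real a) * rGamma (of_real a - of_nat k) * ((- 1) ^ k / fact k)))"
        unfolding mellin_residue by (subst power_minus) (simp add: mult_ac)
      also have "\<dots> = x powi n * (((of_real a - 1) gchoose k) * (- inverse x) ^ k)"
        unfolding rGamma_shift_down[OF a] by (subst (2) power_minus) (simp add: mult_ac)
      finally show ?thesis .
    qed
    then have e: "Gamma (of_real a) * (?c * (\<Sum>k\<le>K. residue F (of_int n - of_nat k)))
      = ?c * (x powi n * (\<Sum>k\<le>K. ((of_real a - 1) gchoose k) * (- inverse x) ^ k))" for K
      by (simp add: sum_distrib_left mult.left_commute[of "Gamma _"])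
    have "norm (- inverse x) < 1" using x by (simp add: norm_inverse inverse_less_1_iff)
    from gen_binomial_complex[OF this, of "of_real a - 1"]
    have "(\<lambda>K. \<Sum>k\<le>K. ((of_real a - 1) gchoose k) * (- inverse x) ^ k) \<longlonglongrightarrow> (1 - inverse x) powr (of_real a - 1)"
      by (simp add: sums_def_le)
    then show ?thesis unfolding e by (intro tendsto_intros)
  qed
  ultimately show "Gamma (of_real a) * ?I = ?c * (x powi n * (1 - inverse x) powr (of_real a - 1))"
    by (rule LIMSEQ_unique)
qed

end

section \<open>The integral representation\<close>

lemma set_integral_linear_combination:
  fixes g :: "'i \<Rightarrow> 'a \<Rightarrow> complex"
  assumes "\<And>n. n \<in> S \<Longrightarrow> set_integrable \<mu> A (g n)"
  shows "set_integrable \<mu> A (\<lambda>t. \<Sum>n\<in>S. c n * g n t)"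
    and "(LINT t:A|\<mu>. \<Sum>n\<in>S. c n * g n t) = (\<Sum>n\<in>S. c n * (LINT t:A|\<mu>. g n t))"
proof -
  have e: "indicator A t *\<^sub>R (\<Sum>n\<in>S. c n * g n t) = (\<Sum>n\<in>S. c n * (indicator A t *\<^sub>R g n t))" for t
    by (simp add: scaleR_sum_right)
  have i: "integrable \<mu> (\<lambda>t. c n * (indicator A t *\<^sub>R g n t))" if "n \<in> S" for n
    using assms[OF that] unfolding set_integrable_def by (rule integrable_mult_right)
  show "set_integrable \<mu> A (\<lambda>t. \<Sum>n\<in>S. c n * g n t)"
    unfolding set_integrable_def e by (rule Bochner_Integration.integrable_sum) (rule i)
  show "(LINT t:A|\<mu>. \<Sum>n\<in>S. c n * g n t) = (\<Sum>n\<in>S. c n * (LINT t:A|\<mu>. g n t))"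
    unfolding set_lebesgue_integral_def e by (simp only: Bochner_Integration.integral_sum[OF i] integral_mult_right_zero cong: sum.cong)
qed

lemma left_contour_integral_sum:
  assumes "finite S" "\<And>n. n \<in> S \<Longrightarrow> left_contour_abs_convergent M r (g n)"
    and "\<And>n. n \<in> S \<Longrightarrow> g n contour_integrable_on (linepath (Complex M (- r)) (Complex M r))"
  shows "left_contour_abs_convergent M r (\<lambda>z. \<Sum>n\<in>S. c n * g n z)"
    and "left_contour_integral M r (\<lambda>z. \<Sum>n\<in>S. c n * g n z) = (\<Sum>n\<in>S. c n * left_contour_integral M r (g n))"
proof -
  have conv: "set_integrable lborel {..M} (\<lambda>t. g n (Complex t (- r)))"
    "set_integrable lborel {- r..r} (\<lambda>s. g n (Complex M s))"
    "set_integrable lborel {..M} (\<lambda>t. g n (Complex t r))" if "n \<in> S" for n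
    using assms(2)[OF that] by (simp_all add: left_contour_abs_convergent_def)
  show "left_contour_abs_convergent M r (\<lambda>z. \<Sum>n\<in>S. c n * g n z)"
    unfolding left_contour_abs_convergent_def
    by (intro conjI set_integral_linear_combination(1) conv)
  have "contour_integral (linepath (Complex M (- r)) (Complex M r)) (\<lambda>z. \<Sum>n\<in>S. c n * g n z)
    = (\<Sum>n\<in>S. c n * contour_integral (linepath (Complex M (- r)) (Complex M r)) (g n))"
    using assms by (subst contour_integral_sum) (auto intro!: contour_integrable_lmul sum.cong contour_integral_lmul)
  then show "left_contour_integral M r (\<lambda>z. \<Sum>n\<in>S. c n * g n z) = (\<Sum>n\<in>S. c n * left_contour_integral M r (g n))"
    using set_integral_linear_combination(2)[of S, OF conv(1)] set_integral_linear_combination(2)[of S, OF conv(3)]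
    by (simp add: left_contour_integral_def sum.distrib sum_subtractf distrib_left right_diff_distrib)
qed

text \<open>The contour lies in the set where \<open>Im z \<noteq> 0\<close> or
  \<open>Re z = M\<close>, and for \<open>M\<close> to the right of \<open>lam 1\<close> this set is
  within reach of \<open>markov_krein\<close>.\<close>

lemma left_contour_cong:
  assumes "r > 0" "\<And>z. Im z \<noteq> 0 \<or> Re z = M \<Longrightarrow> f z = g z"
  shows "left_contour_abs_convergent M r f = left_contour_abs_convergent M r g"
    and "left_contour_integral M r f = left_contour_integral M r g"
proof -
  have *: "f (Complex t (- r)) = g (Complex t (- r))" "f (Complex t r) = g (Complex t r)"
    "f (Complex M s) = g (Complex M s)" for t s
    using assms by auto
  show "left_contour_abs_convergent M r f = left_contour_abs_convergent M r g"
    by (simp add: left_contour_abs_convergent_def *)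
  have "contour_integral (linepath (Complex M (- r)) (Complex M r)) f
    = contour_integral (linepath (Complex M (- r)) (Complex M r)) g"
    by (rule contour_integral_cong) (use assms in \<open>auto simp: closed_segment_same_Re\<close>)
  then show "left_contour_integral M r f = left_contour_integral M r g"
    by (simp add: left_contour_integral_def *)
qed

theorem theorem2p8:
  fixes \<theta> M r :: real and N :: nat and lam :: "nat \<Rightarrow> int" and x :: complex
  assumes "\<theta> > 0" and "N \<ge> 1" and "lam \<in> signatures N" and "norm x > 1"
    and "M > of_int (lam 1)" and "r > 0"
  defines "f \<equiv> (\<lambda>z. x powr z *
      (\<Prod>i\<in>{1..N}. Gamma (z - of_real (of_int (lam i) - \<theta> * real i + \<theta>))
                 / Gamma (z - of_real (of_int (lam i) - \<theta> * real i))))"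
  shows "left_contour_abs_convergent M r f \<and>
    jack_character \<theta> N 1 lam (\<lambda>_. x) =
      Gamma (of_real (\<theta> * real N)) / (1 - inverse x) powr of_real (\<theta> * real N - 1)
      * (1 / (2 * of_real pi * \<i>) * left_contour_integral M r f)"
proof -
  define a where "a = \<theta> * real N"
  have a: "a > 0" using assms(1,2) by (simp add: a_def)
  let ?S = "{lam N..lam 1}"
  \<comment> \<open>\<open>b n / B\<close> is the weight of the entry \<open>n\<close> at level 1 in
    the normalized average over Gelfand-Tsetlin patterns.\<close>
  define b where "b n = branch_sum \<theta> N lam (\<lambda>k. of_bool (k = n))" for n
  define B where "B = branch_sum \<theta> N lam (\<lambda>_. 1)"
  have expand: "branch_sum \<theta> N lam h = (\<Sum>n\<in>?S. b n * h n)" for h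
    unfolding b_def by (rule branch_sum_expand[OF assms(2,3)]) auto
  have B: "B \<noteq> 0" using branch_sum_one_pos[OF assms(1-3)] by (auto simp: B_def)
  have x0: "x \<noteq> 0" using assms(4) by auto
  let ?g = "\<lambda>n. mellin_integrand x a n"
  let ?F = "\<lambda>z. \<Sum>n\<in>?S. (b n / B) * ?g n z"
  have eq: "f z = ?F z" if "Im z \<noteq> 0 \<or> Re z = M" for z
  proof -
    have z: "Im z \<noteq> 0 \<or> Re z > of_int (lam 1)" using that assms(5) by auto
    have "f z = x powr z * gamma_kernel \<theta> N lam z" by (simp add: f_def gamma_kernel_def)
    also have "\<dots> = x powr z * (branch_sum \<theta> N lam (beta_ratio a z) / B)"
      using markov_krein[OF assms(1-3) z] B by (simp add: a_def B_def)
    also have "\<dots> = ?F z"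
      by (simp add: expand mellin_integrand_def sum_distrib_left sum_divide_distrib mult_ac)
    finally show ?thesis .
  qed
  have M: "M > of_int n" if "n \<in> ?S" for n using that assms(5) by (smt (verit) atLeastAtMost_iff of_int_le_iff)
  have conv: "left_contour_abs_convergent M r (?g n)" if "n \<in> ?S" for n
    by (rule mellin_left_contour(1)[OF assms(4) a M[OF that] assms(6)])
  have val: "Gamma (of_real a) * left_contour_integral M r (?g n)
      = 2 * of_real pi * \<i> * (x powi n * (1 - inverse x) powr (of_real a - 1))" if "n \<in> ?S" for n
    by (rule mellin_left_contour(2)[OF assms(4) a M[OF that] assms(6)])
  have ci: "?g n contour_integrable_on (linepath (Complex M (- r)) (Complex M r))" if "n \<in> ?S" for n
    using M[OF that]
    by (intro contour_integrable_continuous_linepath mellin_continuous[OF assms(4) a] half_plane_notin_nonpos_Ints)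
      (auto simp: closed_segment_same_Re)
  note sums = left_contour_integral_sum[where S = ?S and g = ?g and c = "\<lambda>n. b n / B", OF _ conv ci]
  have "left_contour_abs_convergent M r f"
    using sums(1) left_contour_cong(1)[of r M f ?F, OF assms(6) eq] by simp
  moreover have "jack_character \<theta> N 1 lam (\<lambda>_. x) =
      Gamma (of_real (\<theta> * real N)) / (1 - inverse x) powr of_real (\<theta> * real N - 1)
      * (1 / (2 * of_real pi * \<i>) * left_contour_integral M r f)"
  proof -
    let ?p = "(1 - inverse x) powr (of_real a - 1)" and ?c = "2 * of_real pi * \<i> :: complex"
    have "x \<noteq> 1" using assms(4) by auto
    then have p: "?p \<noteq> 0" by simp
    have "Gamma (of_real a) * left_contour_integral M r f = (\<Sum>n\<in>?S. (b n / B) * (Gamma (of_real a) * left_contour_integral M r (?g n)))"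
      using sums(2) left_contour_cong(2)[of r M f ?F, OF assms(6) eq] by (simp add: sum_distrib_left mult_ac)
    also have "\<dots> = (\<Sum>n\<in>?S. (b n / B) * (?c * (x powi n * ?p)))"
      by (intro sum.cong refl) (simp only: val)
    also have "\<dots> = ?c * ?p * ((\<Sum>n\<in>?S. b n * x powi n) / B)"
      by (simp add: sum_distrib_left sum_divide_distrib mult_ac)
    also have "(\<Sum>n\<in>?S. b n * x powi n) / B = jack_character \<theta> N 1 lam (\<lambda>_. x)"
      unfolding jack_character_eq[OF assms(2) x0] expand[symmetric] B_def ..
    finally show ?thesis using p by (simp add: a_def field_simps)
  qed
  ultimately show ?thesis ..
qed

end
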